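(* Let $\mu\in\mathbb R$, $\sigma^2>0$, let $X_1,X_2,\dots$ be i.i.d. $\mathcal N(\mu,\sigma^2)$, fix $T\in(0,\infty)$, $M\in\mathbb N$, $\beta>0$, and let $w(t)=\exp(-\beta t^2)$. With the quantities in the context, $$\big(T_1^{(n)},\dots,T_M^{(n)}\big)\xrightarrow{d}(T_1,\dots,T_M)\qquad(n\to\infty),$$ and consequently $T^{(n)}\xrightarrow{d}T$ and $\widetilde T^{(n)}\xrightarrow{d}T$.
   Context: For a sample $X_1,\dots,X_n$: $\bar X=\frac1n\sum_k X_k$, $S_X^2=\frac1n\sum_k(X_k-\bar X)^2$, $\widehat\psi_X(t)=\frac1n\sum_k e^{itX_k}$, $\widehat\psi_X^*(t)=\exp(-it\bar X/S_X)\,\widehat\psi_X(t/S_X)$, $\psi_0(t)=e^{-t^2/2}$, $\psi(t)=\exp(i\mu t-\sigma^2t^2/2)$, $U_n(t)=\sqrt n(\widehat\psi_X^*(t)-\psi_0(t))$ on $[-T,T]$. For $m\in\mathbb N$: $S_m^{(n)}(t)=(\widehat\psi_X^*(t/\sqrt m))^m$, $D_m^{(n)}=S_{m+1}^{(n)}-S_m^{(n)}$, $\Delta_m^{(n)}=\int_{-T}^T w(t)|D_m^{(n)}(t)|^2dt$, $H_m^{(n)}(t)=(m+1)\frac{U_n(t/\sqrt{m+1})}{\psi_0(t/\sqrt{m+1})}-m\frac{U_n(t/\sqrt m)}{\psi_0(t/\sqrt m)}$, $Q_m^{(n)}=\int_{-T}^T w(t)\psi_0(t)^2|H_m^{(n)}(t)|^2dt$.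 With $\mathbb E_{H_0},\mathrm{Var}_{H_0}$ the mean and variance computed from $n$ i.i.d. standard normal observations: $T_m^{(n)}=(\Delta_m^{(n)}-\mathbb E_{H_0}[\Delta_m^{(n)}])/\sqrt{\mathrm{Var}_{H_0}(\Delta_m^{(n)})}$, $\widetilde T_m^{(n)}=(Q_m^{(n)}-\mathbb E_{H_0}[Q_m^{(n)}])/\sqrt{\mathrm{Var}_{H_0}(Q_m^{(n)})}$, $T^{(n)}=\max_{m\le M}|T_m^{(n)}|$, $\widetilde T^{(n)}=\max_{m\le M}|\widetilde T_m^{(n)}|$. Limit objects: let $(G,Y_1,Y_2)$ be the joint weak limit in $C([-T/\sigma,T/\sigma];\mathbb C)\times\mathbb R^2$ of $\big(\sqrt n(\widehat\psi_X-\psi),\sqrt n(\bar X-\mu),\sqrt n(S_X-\sigma)\big)$ ($G$ centered complex Gaussian with $\mathrm{Cov}(G(s),\overline{G(t)})=\psi(s-t)-\psi(s)\psi(-t)$; $Y_1,Y_2$ uncorrelated centered normals with variances $\sigma^2,\sigma^2/2$). $G_0(t)=\exp(-it\mu/\sigma)G(t/\sigma)-\frac{it}{\sigma}\psi_0(t)Y_1+\frac{t^2}{\sigma}\psi_0(t)Y_2$, $H_m(t)=(m+1)\frac{G_0(t/\sqrt{m+1})}{\psi_0(t/\sqrt{m+1})}-m\frac{G_0(t/\sqrt m)}{\psi_0(t/\sqrt m)}$, $Q_m=\int_{-T}^T w(t)\psi_0(t)^2|H_m(t)|^2dt$, $\mu_m=\mathbb E[Q_m]$, $\sigma_m^2=\mathrm{Var}(Q_m)$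 (finite and positive), $T_m=(Q_m-\mu_m)/\sigma_m$, and $T=\max_{1\le m\le M}|T_m|$. *)

theory Defs
  imports "HOL-Probability.Probability"
begin

definition weak_conv_gen :: "(nat \<Rightarrow> 'a::metric_space measure) \<Rightarrow> 'a measure \<Rightarrow> bool" where
  "weak_conv_gen Pn Q \<longleftrightarrow>
     (\<forall>f :: 'a \<Rightarrow> real. continuous_on UNIV f \<and> bounded (range f) \<longrightarrow>
        (\<lambda>n. integral\<^sup>L (Pn n) f) \<longlonglongrightarrow> integral\<^sup>L Q f)"

definition conv_distr ::
  "'p measure \<Rightarrow> (nat \<Rightarrow> 'p \<Rightarrow> 'a::metric_space) \<Rightarrow> 'q measure \<Rightarrow> ('q \<Rightarrow> 'a) \<Rightarrow> bool" where
  "conv_distr P Zn Q Z \<longleftrightarrow> weak_conv_gen (\<lambda>n. distr P borel (Zn n)) (distr Q borel Z)"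

definition smean :: "nat \<Rightarrow> (nat \<Rightarrow> real) \<Rightarrow> real" where
  "smean n xs = (\<Sum>k<n. xs k) / real n"

definition ssd :: "nat \<Rightarrow> (nat \<Rightarrow> real) \<Rightarrow> real" where
  "ssd n xs = sqrt ((\<Sum>k<n. (xs k - smean n xs)\<^sup>2) / real n)"

definition ecf :: "nat \<Rightarrow> (nat \<Rightarrow> real) \<Rightarrow> real \<Rightarrow> complex" where
  "ecf n xs t = (\<Sum>k<n. exp (\<i> * complex_of_real (t * xs k))) / of_nat n"

definition ecf_std :: "nat \<Rightarrow> (nat \<Rightarrow> real) \<Rightarrow> real \<Rightarrow> complex" where
  "ecf_std n xs t = exp (- \<i> * complex_of_real (t * smean n xs / ssd n xs)) * ecf n xs (t / ssd n xs)"

definition psi0 :: "real \<Rightarrow> real" where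
  "psi0 t = exp (- t\<^sup>2 / 2)"

definition psiN :: "real \<Rightarrow> real \<Rightarrow> real \<Rightarrow> complex" where
  "psiN \<mu> \<sigma> t = exp (\<i> * complex_of_real (\<mu> * t) - complex_of_real (\<sigma>\<^sup>2 * t\<^sup>2 / 2))"

definition wt :: "real \<Rightarrow> real \<Rightarrow> real" where
  "wt \<beta> t = exp (- \<beta> * t\<^sup>2)"

definition Uproc :: "nat \<Rightarrow> (nat \<Rightarrow> real) \<Rightarrow> real \<Rightarrow> complex" where
  "Uproc n xs t = complex_of_real (sqrt (real n)) * (ecf_std n xs t - complex_of_real (psi0 t))"

definition Sm :: "nat \<Rightarrow> (nat \<Rightarrow> real) \<Rightarrow> nat \<Rightarrow> real \<Rightarrow> complex" where
  "Sm n xs m t = (ecf_std n xs (t / sqrt (real m))) ^ m"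

definition Dm :: "nat \<Rightarrow> (nat \<Rightarrow> real) \<Rightarrow> nat \<Rightarrow> real \<Rightarrow> complex" where
  "Dm n xs m t = Sm n xs (m + 1) t - Sm n xs m t"

definition Deltam :: "real \<Rightarrow> real \<Rightarrow> nat \<Rightarrow> (nat \<Rightarrow> real) \<Rightarrow> nat \<Rightarrow> real" where
  "Deltam T \<beta> n xs m = integral {-T..T} (\<lambda>t. wt \<beta> t * (cmod (Dm n xs m t))\<^sup>2)"

definition Hgen :: "(real \<Rightarrow> complex) \<Rightarrow> nat \<Rightarrow> real \<Rightarrow> complex" where
  "Hgen V m t =
     of_nat (m + 1) * V (t / sqrt (real (m + 1))) / complex_of_real (psi0 (t / sqrt (real (m + 1))))
     - of_nat m * V (t / sqrt (real m)) / complex_of_real (psi0 (t / sqrt (real m)))"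

definition Qgen :: "real \<Rightarrow> real \<Rightarrow> (real \<Rightarrow> complex) \<Rightarrow> nat \<Rightarrow> real" where
  "Qgen T \<beta> V m = integral {-T..T} (\<lambda>t. wt \<beta> t * (psi0 t)\<^sup>2 * (cmod (Hgen V m t))\<^sup>2)"

definition Qm :: "real \<Rightarrow> real \<Rightarrow> nat \<Rightarrow> (nat \<Rightarrow> real) \<Rightarrow> nat \<Rightarrow> real" where
  "Qm T \<beta> n xs m = Qgen T \<beta> (Uproc n xs) m"

definition H0 :: "nat \<Rightarrow> (nat \<Rightarrow> real) measure" where
  "H0 n = PiM {..<n} (\<lambda>_. density lborel std_normal_density)"

definition EH0 :: "nat \<Rightarrow> ((nat \<Rightarrow> real) \<Rightarrow> real) \<Rightarrow> real" where
  "EH0 n f = integral\<^sup>L (H0 n) f"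

definition VarH0 :: "nat \<Rightarrow> ((nat \<Rightarrow> real) \<Rightarrow> real) \<Rightarrow> real" where
  "VarH0 n f = integral\<^sup>L (H0 n) (\<lambda>xs. (f xs - EH0 n f)\<^sup>2)"

definition standardize :: "nat \<Rightarrow> ((nat \<Rightarrow> real) \<Rightarrow> real) \<Rightarrow> (nat \<Rightarrow> real) \<Rightarrow> real" where
  "standardize n f xs = (f xs - EH0 n f) / sqrt (VarH0 n f)"

definition Tnm :: "real \<Rightarrow> real \<Rightarrow> nat \<Rightarrow> nat \<Rightarrow> (nat \<Rightarrow> real) \<Rightarrow> real" where
  "Tnm T \<beta> n m xs = standardize n (\<lambda>ys. Deltam T \<beta> n ys m) xs"

definition Ttnm :: "real \<Rightarrow> real \<Rightarrow> nat \<Rightarrow> nat \<Rightarrow> (nat \<Rightarrow> real) \<Rightarrow> real" where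
  "Ttnm T \<beta> n m xs = standardize n (\<lambda>ys. Qm T \<beta> n ys m) xs"

definition Tn :: "real \<Rightarrow> real \<Rightarrow> nat \<Rightarrow> nat \<Rightarrow> (nat \<Rightarrow> real) \<Rightarrow> real" where
  "Tn T \<beta> M n xs = Max ((\<lambda>m. \<bar>Tnm T \<beta> n m xs\<bar>) ` {1..M})"

definition Ttn :: "real \<Rightarrow> real \<Rightarrow> nat \<Rightarrow> nat \<Rightarrow> (nat \<Rightarrow> real) \<Rightarrow> real" where
  "Ttn T \<beta> M n xs = Max ((\<lambda>m. \<bar>Ttnm T \<beta> n m xs\<bar>) ` {1..M})"

text \<open>The process sqrt n (ecf - psi) restricted to [-a,a], viewed as an element of
  C([-a,a]; complex) (embedded isometrically into the bounded continuous functions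
  by constant extension outside [-a,a]).\<close>
definition ecf_proc :: "real \<Rightarrow> real \<Rightarrow> real \<Rightarrow> nat \<Rightarrow> (nat \<Rightarrow> real) \<Rightarrow> (real \<Rightarrow>\<^sub>C complex)" where
  "ecf_proc \<mu> \<sigma> a n xs =
     Bcontfun (ext_cont (\<lambda>t. complex_of_real (sqrt (real n)) * (ecf n xs t - psiN \<mu> \<sigma> t)) (-a) a)"

definition G0 :: "real \<Rightarrow> real \<Rightarrow> (real \<Rightarrow>\<^sub>C complex) \<Rightarrow> real \<Rightarrow> real \<Rightarrow> real \<Rightarrow> complex" where
  "G0 \<mu> \<sigma> g y1 y2 t =
     exp (- \<i> * complex_of_real (t * \<mu> / \<sigma>)) * apply_bcontfun g (t / \<sigma>)
     - \<i> * complex_of_real (t / \<sigma> * psi0 t * y1)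
     + complex_of_real (t\<^sup>2 / \<sigma> * psi0 t * y2)"

definition Tlim :: "'b measure \<Rightarrow> real \<Rightarrow> real \<Rightarrow> real \<Rightarrow> real \<Rightarrow>
    ('b \<Rightarrow> real \<Rightarrow>\<^sub>C complex) \<Rightarrow> ('b \<Rightarrow> real) \<Rightarrow> ('b \<Rightarrow> real) \<Rightarrow> nat \<Rightarrow> 'b \<Rightarrow> real" where
  "Tlim N \<mu> \<sigma> T \<beta> G Y1 Y2 m \<omega> =
     (let Q = (\<lambda>\<omega>. Qgen T \<beta> (G0 \<mu> \<sigma> (G \<omega>) (Y1 \<omega>) (Y2 \<omega>)) m);
          mu_m = integral\<^sup>L N Q;
          sigma_m = sqrt (integral\<^sup>L N (\<lambda>\<omega>. (Q \<omega> - mu_m)\<^sup>2))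
      in (Q \<omega> - mu_m) / sigma_m)"

definition TlimMax :: "'b measure \<Rightarrow> real \<Rightarrow> real \<Rightarrow> real \<Rightarrow> real \<Rightarrow> nat \<Rightarrow>
    ('b \<Rightarrow> real \<Rightarrow>\<^sub>C complex) \<Rightarrow> ('b \<Rightarrow> real) \<Rightarrow> ('b \<Rightarrow> real) \<Rightarrow> 'b \<Rightarrow> real" where
  "TlimMax N \<mu> \<sigma> T \<beta> M G Y1 Y2 \<omega> = Max ((\<lambda>m. \<bar>Tlim N \<mu> \<sigma> T \<beta> G Y1 Y2 m \<omega>\<bar>) ` {1..M})"

end

theory Submission
  imports Defs "HOL-Real_Asymp.Real_Asymp"
begin

text \<open>
  Write \<open>Z\<^sub>k = (X\<^sub>k - \<mu>) / \<sigma>\<close>; all statistics are invariant under this change, so the null mean and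
  variance are those of the sample itself. Expanding \<open>exp (i t Z\<^sub>k)\<close> around the standardized
  observations (whose empirical second moment is at most 1) shows that \<open>U\<^sub>n\<close> differs from the image of the
  triple \<open>(\<surd>n (ecf - \<psi>), \<surd>n (mean - \<mu>), \<surd>n (S - \<sigma>))\<close> under \<open>G0\<close> by \<open>O(1/\<surd>n)\<close> in every \<open>L\<^sup>p\<close>, uniformly on
  \<open>[-T, T]\<close>; likewise \<open>n \<Delta>\<^sub>m\<close> differs from \<open>Q\<^sub>m\<close> by \<open>O(1/\<surd>n)\<close>. The image of the triple under the continuous
  functional \<open>Q\<^sub>m\<close> converges weakly, and with uniformly bounded moments its mean and variance converge
  too, so the claim follows from a Slutsky argument once the limit variance is known to be positive.
  If it were zero, the linear functional \<open>\<integral> w \<psi>\<^sub>0\<^sup>2 Re H\<^sub>m\<close>, which is bounded by a constant plus \<open>Q\<^sub>m\<close>, would be bounded;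
  but by the central limit theorem it is a non-degenerate normal variable.
\<close>

subsection \<open>Families of random variables with uniformly bounded moments\<close>

text \<open>Weak convergence says nothing about the null mean and variance, which vary with
  \<open>n\<close>; hence every approximation is controlled through moments and not merely in
  probability. The statistics are quadratic in the processes and their variances quartic, and a
  product doubles the order of the moments it consumes, so only a class bounded at every order is
  closed under the operations involved. "Of order 1 / sqrt n" is encoded as boundedness of
  \<open>sqrt n * F n\<close>; a product of two such quantities then absorbs a full factor
  \<open>n\<close>.

  The obstacle in the expansion is \<open>1 / ssd\<close>, whose higher moments are infinite for
  small \<open>n\<close>. It never appears on its own: only \<open>ssd - 1\<close> and the mean do,
  multiplied by averages with deterministic bounds. The moments of the limit are in turn obtained as
  limits of sample moments. Estimates are uniform over \<open>n \<ge> 1\<close>; at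
  \<open>n = 0\<close> the averages divide by zero.\<close>

definition (in prob_space) moments_bounded :: "'i set \<Rightarrow> ('i \<Rightarrow> 'a \<Rightarrow> real) \<Rightarrow> bool" where
  "moments_bounded I F \<longleftrightarrow> (\<forall>i\<in>I. F i \<in> borel_measurable M) \<and>
     (\<forall>p. \<exists>K. \<forall>i\<in>I. integrable M (\<lambda>x. \<bar>F i x\<bar> ^ p) \<and> expectation (\<lambda>x. \<bar>F i x\<bar> ^ p) \<le> K)"

section \<open>Power inequalities and Jensen's inequality\<close>

lemma abs_add_power_le:
  fixes a b :: real
  shows "\<bar>a + b\<bar> ^ p \<le> 2 ^ p * (\<bar>a\<bar> ^ p + \<bar>b\<bar> ^ p)"
proof -
  have "\<bar>a + b\<bar> ^ p \<le> (2 * max \<bar>a\<bar> \<bar>b\<bar>) ^ p"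
    by (intro power_mono) auto
  also have "\<dots> = 2 ^ p * max \<bar>a\<bar> \<bar>b\<bar> ^ p"
    by (simp add: power_mult_distrib)
  also have "\<dots> \<le> 2 ^ p * (\<bar>a\<bar> ^ p + \<bar>b\<bar> ^ p)"
    by (intro mult_left_mono) (auto simp: max_def)
  finally show ?thesis .
qed

lemma abs_mult_power_le:
  fixes a b :: real
  shows "\<bar>a * b\<bar> ^ p \<le> \<bar>a\<bar> ^ (2 * p) + \<bar>b\<bar> ^ (2 * p)"
proof -
  have "\<bar>a * b\<bar> ^ p = \<bar>a\<bar> ^ p * \<bar>b\<bar> ^ p"
    by (simp add: abs_mult power_mult_distrib)
  also have "\<dots> \<le> (\<bar>a\<bar> ^ p)\<^sup>2 + (\<bar>b\<bar> ^ p)\<^sup>2"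
  proof -
    have "0 \<le> \<bar>a\<bar> ^ p * \<bar>b\<bar> ^ p" by simp
    then show ?thesis
      using sum_squares_bound[of "\<bar>a\<bar> ^ p" "\<bar>b\<bar> ^ p"] by linarith
  qed
  finally show ?thesis
    by (simp only: power_even_eq)
qed

text \<open>The tangent to \<open>x ^ Suc p\<close> at \<open>a\<close> lies below the graph;
  integrated, this becomes Jensen's inequality. In the inductive step the previous inequality is
  multiplied by \<open>a\<close>, and the product of two differences of equal sign supplies the
  rest.\<close>

lemma tangent_power_le:
  fixes a x :: real
  assumes "0 \<le> a" "0 \<le> x"
  shows "real (Suc p) * a ^ p * x \<le> real p * a ^ Suc p + x ^ Suc p"
proof (induction p)
  case (Suc p)
  have "0 \<le> (a ^ Suc p - x ^ Suc p) * (a - x)"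
  proof (cases "x \<le> a")
    case True
    then show ?thesis
      using power_mono[OF True, of "Suc p"] assms by (intro mult_nonneg_nonneg) auto
  next
    case False
    then show ?thesis
      using power_mono[of a x "Suc p"] assms by (intro mult_nonpos_nonpos) auto
  qed
  moreover have "a * (real (Suc p) * a ^ p * x) \<le> a * (real p * a ^ Suc p + x ^ Suc p)"
    using assms by (intro mult_left_mono Suc.IH)
  ultimately show ?case
    by (simp add: algebra_simps)
qed simp

text \<open>Jensen's inequality for powers on a measure that is finite but not normalized: the
  tangent inequality is integrated with tangent point the average \<open>a\<close>. The power of the
  total mass is the price of normalization.\<close>

lemma (in finite_measure) integral_power_le:
  fixes f :: "'a \<Rightarrow> real"
  assumes f: "f \<in> borel_measurable M" "\<And>x. x \<in> space M \<Longrightarrow> 0 \<le> f x" "integrable M f" "integrable M (\<lambda>x. f x ^ Suc p)"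
  shows "(\<integral>x. f x \<partial>M) ^ Suc p \<le> measure M (space M) ^ p * (\<integral>x. f x ^ Suc p \<partial>M)"
proof -
  define m where "m = measure M (space M)"
  define a where "a = (\<integral>x. f x \<partial>M) / m"
  have nn: "0 \<le> (\<integral>x. f x \<partial>M)"
    using f by (intro Bochner_Integration.integral_nonneg_AE) auto
  show ?thesis
  proof (cases "m = 0")
    case True
    then have "emeasure M (space M) = 0"
      by (simp add: m_def emeasure_eq_measure)
    then have "AE x in M. False"
      by (intro AE_I[where N = "space M"]) auto
    then have "(\<integral>x. f x \<partial>M) = (\<integral>x. 0 \<partial>M)"
      by (intro integral_cong_AE) (use f(1) in auto)
    moreover have "0 \<le> (\<integral>x. f x ^ Suc p \<partial>M)"
      using f by (intro Bochner_Integration.integral_nonneg_AE) auto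
    ultimately show ?thesis
      by (auto simp: measure_nonneg)
  next
    case False
    then have m: "m > 0"
      using measure_nonneg[of M "space M"] by (auto simp: m_def less_le)
    have a: "0 \<le> a"
      using nn m by (simp add: a_def)
    have "(\<integral>x. real (Suc p) * a ^ p * f x \<partial>M) \<le> (\<integral>x. real p * a ^ Suc p + f x ^ Suc p \<partial>M)"
      using f a by (intro integral_mono tangent_power_le Bochner_Integration.integrable_add) auto
    then have "real (Suc p) * a ^ p * (m * a) \<le> real p * a ^ Suc p * m + (\<integral>x. f x ^ Suc p \<partial>M)"
      using f m by (simp add: m_def [symmetric] a_def)
    then have "m * a ^ Suc p \<le> (\<integral>x. f x ^ Suc p \<partial>M)"
      by (simp add: algebra_simps)
    then have "m ^ p * (m * a ^ Suc p) \<le> m ^ p * (\<integral>x. f x ^ Suc p \<partial>M)"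
      using m by (intro mult_left_mono) auto
    moreover have "m ^ p * (m * a ^ Suc p) = (\<integral>x. f x \<partial>M) ^ Suc p"
      using m by (simp add: a_def power_divide)
    ultimately show ?thesis
      by (simp add: m_def)
  qed
qed

section \<open>Closure properties of uniform moment bounds\<close>

context prob_space
begin

lemma moments_boundedD:
  assumes "moments_bounded I F"
  obtains K where "K \<ge> 0" "\<And>i. i \<in> I \<Longrightarrow> integrable M (\<lambda>x. \<bar>F i x\<bar> ^ p)"
    "\<And>i. i \<in> I \<Longrightarrow> expectation (\<lambda>x. \<bar>F i x\<bar> ^ p) \<le> K"
proof -
  obtain K where K: "\<And>i. i \<in> I \<Longrightarrow> integrable M (\<lambda>x. \<bar>F i x\<bar> ^ p)"
    "\<And>i. i \<in> I \<Longrightarrow> expectation (\<lambda>x. \<bar>F i x\<bar> ^ p) \<le> K"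
    using assms unfolding moments_bounded_def by meson
  show thesis
    by (rule that[of "max 0 K"]) (use K in \<open>auto intro: max.coboundedI2\<close>)
qed

lemma moments_bounded_measurable: "moments_bounded I F \<Longrightarrow> i \<in> I \<Longrightarrow> F i \<in> borel_measurable M"
  by (auto simp: moments_bounded_def)

lemma moments_bounded_integrable:
  "moments_bounded I F \<Longrightarrow> i \<in> I \<Longrightarrow> integrable M (\<lambda>x. F i x ^ p)"
proof -
  assume F: "moments_bounded I F" and i: "i \<in> I"
  obtain K where "\<And>i. i \<in> I \<Longrightarrow> integrable M (\<lambda>x. \<bar>F i x\<bar> ^ p)"
    using moments_boundedD[OF F, where p = p] by blast
  from this[OF i] show ?thesis
    by (rule Bochner_Integration.integrable_bound)
       (use moments_bounded_measurable[OF F i] in \<open>auto simp: power_abs\<close>)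
qed

text \<open>The exponents \<open>q\<close>, \<open>r\<close> and the constant \<open>c\<close> may
  depend on \<open>p\<close> but not on the index, so uniformity survives. Domination, sums and
  products are all instances; a product trades order \<open>p\<close> for order \<open>2 * p\<close>
  of its factors.\<close>

lemma moments_bounded_power_dom:
  assumes G: "moments_bounded I G" and H: "moments_bounded I H" and F: "\<And>i. i \<in> I \<Longrightarrow> F i \<in> borel_measurable M"
    and le: "\<And>p. \<exists>q r c. \<forall>i\<in>I. \<forall>x\<in>space M. \<bar>F i x\<bar> ^ p \<le> c * (\<bar>G i x\<bar> ^ q + \<bar>H i x\<bar> ^ r)"
  shows "moments_bounded I F"
  unfolding moments_bounded_def
proof (intro conjI ballI allI)
  fix p
  obtain q r c where le: "\<And>i x. i \<in> I \<Longrightarrow> x \<in> space M \<Longrightarrow> \<bar>F i x\<bar> ^ p \<le> c * (\<bar>G i x\<bar> ^ q + \<bar>H i x\<bar> ^ r)"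
    using le[of p] by blast
  obtain K where K: "\<And>i. i \<in> I \<Longrightarrow> integrable M (\<lambda>x. \<bar>G i x\<bar> ^ q)"
    "\<And>i. i \<in> I \<Longrightarrow> expectation (\<lambda>x. \<bar>G i x\<bar> ^ q) \<le> K"
    using moments_boundedD[OF G, where p = q] by metis
  obtain L where L: "\<And>i. i \<in> I \<Longrightarrow> integrable M (\<lambda>x. \<bar>H i x\<bar> ^ r)"
    "\<And>i. i \<in> I \<Longrightarrow> expectation (\<lambda>x. \<bar>H i x\<bar> ^ r) \<le> L"
    using moments_boundedD[OF H, where p = r] by metis
  show "\<exists>K. \<forall>i\<in>I. integrable M (\<lambda>x. \<bar>F i x\<bar> ^ p) \<and> expectation (\<lambda>x. \<bar>F i x\<bar> ^ p) \<le> K"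
  proof (intro exI ballI conjI)
    fix i assume i: "i \<in> I"
    let ?B = "\<lambda>x. \<bar>c\<bar> * (\<bar>G i x\<bar> ^ q + \<bar>H i x\<bar> ^ r)"
    have le': "\<bar>F i x\<bar> ^ p \<le> ?B x" if "x \<in> space M" for x
      by (rule order_trans[OF le[OF i that]]) (auto intro!: mult_right_mono)
    have int2: "integrable M ?B"
      using K(1)[OF i] L(1)[OF i] by auto
    show int: "integrable M (\<lambda>x. \<bar>F i x\<bar> ^ p)"
      by (rule Bochner_Integration.integrable_bound[OF int2])
         (use F[OF i] le' in \<open>auto intro!: AE_I2 intro: order_trans[OF _ abs_ge_self]\<close>)
    have "expectation (\<lambda>x. \<bar>F i x\<bar> ^ p) \<le> expectation ?B"
      by (intro integral_mono int int2 le')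
    also have "\<dots> = \<bar>c\<bar> * (expectation (\<lambda>x. \<bar>G i x\<bar> ^ q) + expectation (\<lambda>x. \<bar>H i x\<bar> ^ r))"
      using K(1)[OF i] L(1)[OF i] by simp
    also have "\<dots> \<le> \<bar>c\<bar> * (K + L)"
      using K(2)[OF i] L(2)[OF i] by (intro mult_left_mono add_mono) auto
    finally show "expectation (\<lambda>x. \<bar>F i x\<bar> ^ p) \<le> \<bar>c\<bar> * (K + L)" .
  qed
qed (use F in auto)

lemma moments_bounded_dom:
  assumes G: "moments_bounded I G" and F: "\<And>i. i \<in> I \<Longrightarrow> F i \<in> borel_measurable M"
    and le: "\<And>i x. i \<in> I \<Longrightarrow> x \<in> space M \<Longrightarrow> \<bar>F i x\<bar> \<le> \<bar>G i x\<bar>"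
  shows "moments_bounded I F"
proof (rule moments_bounded_power_dom[OF G G F])
  have "\<bar>F i x\<bar> ^ p \<le> 1 * (\<bar>G i x\<bar> ^ p + \<bar>G i x\<bar> ^ p)" if "i \<in> I" "x \<in> space M" for i x p
    using power_mono[OF le[OF that], of p] zero_le_power[of "\<bar>G i x\<bar>" p] unfolding mult_1_left by linarith
  then show "\<exists>q r c. \<forall>i\<in>I. \<forall>x\<in>space M. \<bar>F i x\<bar> ^ p \<le> c * (\<bar>G i x\<bar> ^ q + \<bar>G i x\<bar> ^ r)" for p
    by blast
qed

lemma
  assumes F: "moments_bounded I F" and G: "moments_bounded I G"
  shows moments_bounded_add: "moments_bounded I (\<lambda>i x. F i x + G i x)"
    and moments_bounded_mult: "moments_bounded I (\<lambda>i x. F i x * G i x)"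
proof -
  note [measurable] = moments_bounded_measurable[OF F] moments_bounded_measurable[OF G]
  show "moments_bounded I (\<lambda>i x. F i x + G i x)"
    by (rule moments_bounded_power_dom[OF F G]) (measurable, use abs_add_power_le in blast)
  have "\<bar>F i x * G i x\<bar> ^ p \<le> 1 * (\<bar>F i x\<bar> ^ (2 * p) + \<bar>G i x\<bar> ^ (2 * p))" for i x p
    unfolding mult_1_left by (rule abs_mult_power_le)
  then show "moments_bounded I (\<lambda>i x. F i x * G i x)"
    by (intro moments_bounded_power_dom[OF F G]) (measurable, blast)
qed

lemma moments_bounded_const: "moments_bounded I (\<lambda>i x. c)"
  by (auto simp: moments_bounded_def prob_space)

lemma moments_bounded_cmult: "moments_bounded I F \<Longrightarrow> moments_bounded I (\<lambda>i x. c * F i x)"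
  by (intro moments_bounded_mult moments_bounded_const)

lemma moments_bounded_reindex:
  "moments_bounded I F \<Longrightarrow> (\<And>j. j \<in> J \<Longrightarrow> h j \<in> I) \<Longrightarrow> moments_bounded J (\<lambda>j. F (h j))"
  unfolding moments_bounded_def by meson

lemma moments_bounded_cong:
  assumes "moments_bounded I F" "\<And>i x. i \<in> I \<Longrightarrow> x \<in> space M \<Longrightarrow> F i x = G i x"
  shows "moments_bounded I G"
  using assms
  by (intro moments_bounded_dom[OF assms(1)])
     (auto simp: moments_bounded_def cong: measurable_cong)

text \<open>Indexing by pairs \<open>(n, t)\<close> makes one constant per order serve all
  \<open>n \<ge> 1\<close> and all \<open>t\<close> in the interval at once, which is what
  integration over \<open>t\<close> requires.\<close>

abbreviation process_bounded :: "real \<Rightarrow> (nat \<Rightarrow> real \<Rightarrow> 'a \<Rightarrow> real) \<Rightarrow> bool" where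
  "process_bounded T F \<equiv> moments_bounded ({1..} \<times> {-T..T}) (\<lambda>j. F (fst j) (snd j))"

lemma process_bounded_dom:
  assumes "process_bounded T G" "\<And>n t. F n t \<in> borel_measurable M"
    and "\<And>n t x. n \<ge> 1 \<Longrightarrow> \<bar>t\<bar> \<le> T \<Longrightarrow> F n t x \<le> G n t x" and "\<And>n t x. 0 \<le> F n t x"
  shows "process_bounded T F"
  by (rule moments_bounded_dom[OF assms(1)])
     (use assms in \<open>auto simp: abs_le_iff intro!: order_trans[OF _ abs_ge_self]\<close>)

text \<open>Jensen in \<open>t\<close> moves the power inside the integral, Tonelli exchanges the
  integrals, and the bound for each fixed \<open>t\<close> is integrated against the finite measure.
  Jensen is available for positive exponents, so order 0 is split off.\<close>

lemma moments_bounded_integral: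
  fixes F :: "'j \<times> 't \<Rightarrow> 'a \<Rightarrow> real" and \<Lambda> :: "'t measure"
  assumes "finite_measure \<Lambda>"
    and F: "moments_bounded (J \<times> space \<Lambda>) F"
    and meas: "\<And>j. j \<in> J \<Longrightarrow> (\<lambda>(x, t). F (j, t) x) \<in> borel_measurable (M \<Otimes>\<^sub>M \<Lambda>)"
    and nn: "\<And>j t x. j \<in> J \<Longrightarrow> t \<in> space \<Lambda> \<Longrightarrow> x \<in> space M \<Longrightarrow> 0 \<le> F (j, t) x"
    and int: "\<And>j x p. j \<in> J \<Longrightarrow> x \<in> space M \<Longrightarrow> integrable \<Lambda> (\<lambda>t. F (j, t) x ^ p)"
  shows "moments_bounded J (\<lambda>j x. \<integral>t. F (j, t) x \<partial>\<Lambda>)"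
proof -
  interpret L: finite_measure \<Lambda> by fact
  interpret pair_sigma_finite M \<Lambda> ..
  have m: "(\<lambda>x. \<integral>t. F (j, t) x \<partial>\<Lambda>) \<in> borel_measurable M" if j: "j \<in> J" for j
    using meas[OF j] by (rule L.borel_measurable_lebesgue_integral)
  define c where "c = measure \<Lambda> (space \<Lambda>)"
  have "\<exists>K. \<forall>j\<in>J. integrable M (\<lambda>x. \<bar>\<integral>t. F (j, t) x \<partial>\<Lambda>\<bar> ^ Suc p) \<and> expectation (\<lambda>x. \<bar>\<integral>t. F (j, t) x \<partial>\<Lambda>\<bar> ^ Suc p) \<le> K" for p
  proof -
    obtain K where K: "K \<ge> 0" "\<And>i. i \<in> J \<times> space \<Lambda> \<Longrightarrow> integrable M (\<lambda>x. \<bar>F i x\<bar> ^ Suc p)"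
      "\<And>i. i \<in> J \<times> space \<Lambda> \<Longrightarrow> expectation (\<lambda>x. \<bar>F i x\<bar> ^ Suc p) \<le> K"
      using moments_boundedD[OF F, where p = "Suc p"] by blast
    show ?thesis
    proof (intro exI ballI)
      fix j assume j: "j \<in> J"
      note [measurable] = m[OF j] meas[OF j]
      let ?I = "\<lambda>x. \<integral>t. F (j, t) x \<partial>\<Lambda>"
      have nnI: "0 \<le> ?I x" if "x \<in> space M" for x
        using that nn[OF j] by (intro Bochner_Integration.integral_nonneg_AE) auto
      have "(\<integral>\<^sup>+x. ennreal (\<bar>?I x\<bar> ^ Suc p) \<partial>M) \<le> (\<integral>\<^sup>+x. \<integral>\<^sup>+t. ennreal (c ^ p * F (j, t) x ^ Suc p) \<partial>\<Lambda> \<partial>M)"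
      proof (intro nn_integral_mono)
        fix x assume x: "x \<in> space M"
        have "\<bar>?I x\<bar> ^ Suc p \<le> c ^ p * (\<integral>t. F (j, t) x ^ Suc p \<partial>\<Lambda>)"
          using L.integral_power_le[of "\<lambda>t. F (j, t) x" p] nn[OF j _ x] int[OF j x, of 1] int[OF j x, of "Suc p"] nnI[OF x]
          by (simp add: c_def)
        also have "\<dots> = (\<integral>t. c ^ p * F (j, t) x ^ Suc p \<partial>\<Lambda>)"
          by simp
        finally have "ennreal (\<bar>?I x\<bar> ^ Suc p) \<le> ennreal (\<integral>t. c ^ p * F (j, t) x ^ Suc p \<partial>\<Lambda>)"
          by (rule ennreal_leI)
        also have "\<dots> = (\<integral>\<^sup>+t. ennreal (c ^ p * F (j, t) x ^ Suc p) \<partial>\<Lambda>)"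
          using nn[OF j _ x] int[OF j x, of "Suc p"]
          by (intro nn_integral_eq_integral[symmetric]) (auto simp: c_def measure_nonneg simp del: power_Suc)
        finally show "ennreal (\<bar>?I x\<bar> ^ Suc p) \<le> \<dots>" .
      qed
      also have "\<dots> = (\<integral>\<^sup>+t. \<integral>\<^sup>+x. ennreal (c ^ p * F (j, t) x ^ Suc p) \<partial>M \<partial>\<Lambda>)"
      proof -
        have "(\<lambda>(x, t). ennreal (c ^ p * F (j, t) x ^ Suc p)) \<in> borel_measurable (M \<Otimes>\<^sub>M \<Lambda>)"
          using meas[OF j] by (simp add: split_beta')
        from Fubini'[OF this] show ?thesis by simp
      qed
      also have "\<dots> \<le> (\<integral>\<^sup>+t. ennreal (c ^ p * K) \<partial>\<Lambda>)"
      proof (intro nn_integral_mono)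
        fix t assume t: "t \<in> space \<Lambda>"
        have e: "F (j, t) x ^ Suc p = \<bar>F (j, t) x\<bar> ^ Suc p" if "x \<in> space M" for x
          using nn[OF j t that] by simp
        have "(\<integral>\<^sup>+x. ennreal (c ^ p * F (j, t) x ^ Suc p) \<partial>M) = (\<integral>\<^sup>+x. ennreal (c ^ p * \<bar>F (j, t) x\<bar> ^ Suc p) \<partial>M)"
          by (intro nn_integral_cong) (simp only: e)
        also have "\<dots> = ennreal (\<integral>x. c ^ p * \<bar>F (j, t) x\<bar> ^ Suc p \<partial>M)"
          using K(2)[of "(j, t)"] j t
          by (intro nn_integral_eq_integral) (auto simp: c_def measure_nonneg simp del: power_Suc)
        also have "\<dots> \<le> ennreal (c ^ p * K)"
          using K(3)[of "(j, t)"] j t by (intro ennreal_leI) (auto simp: c_def measure_nonneg simp del: power_Suc intro!: mult_left_mono)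
        finally show "(\<integral>\<^sup>+x. ennreal (c ^ p * F (j, t) x ^ Suc p) \<partial>M) \<le> ennreal (c ^ p * K)" .
      qed
      also have "\<dots> = ennreal (c ^ p * K * c)"
        using K(1) by (simp add: c_def L.emeasure_eq_measure ennreal_mult'' measure_nonneg)
      finally have le: "(\<integral>\<^sup>+x. ennreal (\<bar>?I x\<bar> ^ Suc p) \<partial>M) \<le> ennreal (c ^ p * K * c)" .
      have i: "integrable M (\<lambda>x. \<bar>?I x\<bar> ^ Suc p)"
        using le by (intro integrableI_nonneg) (auto simp: less_top intro: le_less_trans simp del: power_Suc)
      moreover have "expectation (\<lambda>x. \<bar>?I x\<bar> ^ Suc p) \<le> c ^ p * K * c"
        using le K(1) i by (subst (asm) nn_integral_eq_integral) (auto simp: c_def measure_nonneg simp del: power_Suc)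
      ultimately show "integrable M (\<lambda>x. \<bar>?I x\<bar> ^ Suc p) \<and> expectation (\<lambda>x. \<bar>?I x\<bar> ^ Suc p) \<le> c ^ p * K * c"
        by simp
    qed
  qed
  moreover have "\<exists>K. \<forall>j\<in>J. integrable M (\<lambda>x. \<bar>\<integral>t. F (j, t) x \<partial>\<Lambda>\<bar> ^ 0) \<and> expectation (\<lambda>x. \<bar>\<integral>t. F (j, t) x \<partial>\<Lambda>\<bar> ^ 0) \<le> K"
    by auto
  ultimately show ?thesis
    unfolding moments_bounded_def using m by (intro conjI ballI allI, blast) (case_tac p, auto simp only:)
qed

end

subsection \<open>Normalized sums of functions of normal observations\<close>

text \<open>The linear term is kept exactly because it integrates to zero for a centred summand;
  after scaling by \<open>1 / sqrt n\<close> the rest is of order \<open>1 / n\<close>. For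
  \<open>x \<ge> 0\<close> the bound \<open>exp x \<le> 1 + x * exp x\<close> is fed into
  itself.\<close>

lemma exp_le_quadratic_remainder:
  fixes x :: real
  shows "exp x \<le> 1 + x + x\<^sup>2 * exp \<bar>x\<bar>"
proof (cases "x \<ge> 0")
  case True
  have "(1 - x) * exp x \<le> exp (- x) * exp x"
    using exp_ge_add_one_self[of "- x"] by (intro mult_right_mono) auto
  then have *: "exp x \<le> 1 + x * exp x"
    by (simp add: exp_minus algebra_simps)
  have "x * exp x \<le> x * (1 + x * exp x)"
    using True * by (intro mult_left_mono) auto
  with * True show ?thesis
    by (simp add: power2_eq_square algebra_simps)
next
  case False
  define y where "y = - x"
  have y: "y > 0" using False by (simp add: y_def)
  have "exp (- y) \<le> 1 / (1 + y)"
    using exp_ge_add_one_self[of y] y by (simp add: exp_minus field_simps)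
  also have "\<dots> \<le> 1 - y + y\<^sup>2"
  proof -
    \<comment> \<open>The product is \<open>1 + y ^ 3\<close>.\<close>
    have "1 \<le> (1 - y + y\<^sup>2) * (1 + y)"
      using y by (simp add: algebra_simps power2_eq_square)
    then show ?thesis
      using y by (simp add: divide_simps)
  qed
  also have "\<dots> \<le> 1 - y + y\<^sup>2 * exp y"
    using y mult_left_mono[of 1 "exp y" "y\<^sup>2"] by simp
  finally show ?thesis
    using y by (simp add: y_def)
qed

text \<open>A single term of the exponential series. It converts exponential moments into moments of
  every order.\<close>

lemma power_le_fact_mult_exp:
  fixes x :: real
  assumes "x \<ge> 0"
  shows "x ^ p \<le> fact p * exp x"
proof -
  have "x ^ p / fact p \<le> (\<Sum>n. x ^ n / fact n)"
    using sum_le_suminf[OF summable_exp[of x], of "{p}"] assms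
    by (simp add: divide_inverse mult.commute)
  also have "\<dots> = exp x"
    by (simp add: exp_def divide_inverse mult.commute)
  finally show ?thesis
    by (simp add: field_simps)
qed

text \<open>Up to a factor, the integrand times the standard normal density is the normal density of
  variance 2. The exponent is twice \<open>(z\<^sup>2 + 1) / 8\<close>, the growth allowed for
  summands below; the doubling comes from absorbing the quadratic remainder into the
  exponential.\<close>

lemma integrable_std_normal_exp_square:
  "integrable std_normal_distribution (\<lambda>z. exp ((z\<^sup>2 + 1) / 4))"
proof -
  have e: "std_normal_density z * exp ((z\<^sup>2 + 1) / 4) = exp (1/4) * sqrt 2 * normal_density 0 (sqrt 2) z" for z
  proof -
    have "exp (- z\<^sup>2 / 2) * exp ((z\<^sup>2 + 1) / 4) = exp (1/4) * exp (- z\<^sup>2 / 4)"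
      by (simp add: exp_add [symmetric] field_simps)
    then show ?thesis
      by (simp add: normal_density_def real_sqrt_mult field_simps)
  qed
  have "integrable lborel (\<lambda>z. std_normal_density z * exp ((z\<^sup>2 + 1) / 4))"
    unfolding e by (intro integrable_mult_right integrable_normal_density) auto
  then show ?thesis
    by (subst integrable_density) (auto simp: normal_density_nonneg)
qed

lemma integrable_std_normal_quadratic:
  fixes y :: "real \<Rightarrow> 'c::{banach, second_countable_topology}"
  assumes [measurable]: "y \<in> borel_measurable borel" and le: "\<And>z. norm (y z) \<le> C * (z\<^sup>2 + 1)"
  shows "integrable std_normal_distribution y"
proof -
  have "integrable std_normal_distribution (\<lambda>z. C * (z\<^sup>2 + 1))"
    using integrable_std_normal_distribution_moment[of 2] integrable_std_normal_distribution_moment[of 0]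
    by (auto intro!: integrable_mult_right Bochner_Integration.integrable_add)
  then show ?thesis
    by (rule Bochner_Integration.integrable_bound) (auto intro!: AE_I2 order_trans[OF le])
qed

lemma integrable_const_std_normal:
  fixes c :: "'c::{banach, second_countable_topology}"
  shows "integrable std_normal_distribution (\<lambda>_. c)"
    and "(\<integral>z. c \<partial>std_normal_distribution) = c"
proof -
  interpret N: prob_space std_normal_distribution
    by (rule prob_space_normal_density) simp
  show "integrable std_normal_distribution (\<lambda>_. c)" "(\<integral>z. c \<partial>std_normal_distribution) = c"
    using N.prob_space by (auto simp del: space_density)
qed

lemma abs_le_square_plus_one: "\<bar>z\<bar> \<le> (z::real)\<^sup>2 + 1"
proof -
  have "0 \<le> (\<bar>z\<bar> - 1)\<^sup>2" by simp
  then show ?thesis unfolding power2_diff by simp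
qed

lemma integrable_std_normal_iexp: "integrable std_normal_distribution (\<lambda>z. iexp (t * z))"
  by (rule integrable_std_normal_quadratic[where C = 1]) auto

lemma integral_std_normal_iexp:
  "(\<integral>z. iexp (t * z) \<partial>std_normal_distribution) = complex_of_real (psi0 t)"
  using fun_cong[OF char_std_normal_distribution, of t] by (simp add: char_def psi0_def)

lemma has_bochner_integral_iexp_minus_psi0:
  "has_bochner_integral std_normal_distribution (\<lambda>z. iexp (t * z) - complex_of_real (psi0 t)) 0"
  using has_bochner_integral_diff[OF has_bochner_integral_integrable[OF integrable_std_normal_iexp[of t]]
      has_bochner_integral_integrable[OF integrable_const_std_normal(1)[of "complex_of_real (psi0 t)"]]]
  by (simp only: integral_std_normal_iexp integrable_const_std_normal(2) diff_self)

text \<open>Integrating the derivative of \<open>- exp (- z\<^sup>2 / 2) * iexp (t * z)\<close> over the line.\<close>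
lemma has_bochner_integral_id_iexp:
  "has_bochner_integral std_normal_distribution (\<lambda>z. complex_of_real z * iexp (t * z) - \<i> * complex_of_real (t * psi0 t)) 0"
proof -
  define f where "f z = complex_of_real (std_normal_density z) * ((complex_of_real z - \<i> * complex_of_real t) * iexp (t * z))" for z
  define F where "F z = - complex_of_real (std_normal_density z) * iexp (t * z)" for z
  have i1: "integrable std_normal_distribution (\<lambda>z. complex_of_real z * iexp (t * z))"
  proof (rule integrable_std_normal_quadratic[where C = 1])
    show "norm (complex_of_real z * iexp (t * z)) \<le> 1 * (z\<^sup>2 + 1)" for z
      by (simp add: norm_mult abs_le_square_plus_one)
  qed measurable
  note i2 = integrable_std_normal_iexp[of t]
  have i: "integrable std_normal_distribution (\<lambda>z. complex_of_real z * iexp (t * z) - (\<i> * complex_of_real t) * iexp (t * z))"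
    by (intro Bochner_Integration.integrable_diff i1 integrable_mult_right i2)
  then have intf: "integrable lborel f"
    by (subst (asm) integrable_density) (auto simp: normal_density_nonneg f_def [abs_def] scaleR_conv_of_real algebra_simps)
  have "(\<integral>z. complex_of_real z * iexp (t * z) - (\<i> * complex_of_real t) * iexp (t * z) \<partial>std_normal_distribution) = (\<integral>z. f z \<partial>lborel)"
    by (subst integral_density) (auto simp: normal_density_nonneg f_def [abs_def] scaleR_conv_of_real algebra_simps)
  also have "\<dots> = (LBINT z=-\<infinity>..\<infinity>. f z)"
    by (simp add: interval_integral_eq_integral[symmetric] interval_lebesgue_integral_def einterval_def set_lebesgue_integral_def)
  also have "\<dots> = 0 - 0"
  proof (rule interval_integral_FTC_integrable[where F = F])
    show "(F has_vector_derivative f x) (at x)" for x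
    proof -
      have 1: "((\<lambda>z. complex_of_real (std_normal_density z)) has_vector_derivative complex_of_real (- x * std_normal_density x)) (at x)"
      proof (intro has_vector_derivative_of_real)
        have "(std_normal_density has_real_derivative (1 / sqrt (2 * pi)) * (exp (- x\<^sup>2 / 2) * (- x))) (at x)"
          unfolding std_normal_density_def
          by (intro DERIV_cmult) (auto intro!: derivative_eq_intros)
        then show "(std_normal_density has_real_derivative - x * std_normal_density x) (at x)"
          by (simp add: std_normal_density_def mult_ac)
      qed
      have 2: "((\<lambda>z. iexp (t * z)) has_vector_derivative (\<i> * complex_of_real t * iexp (t * x))) (at x)"
      proof -
        have "((\<lambda>z. exp (\<i> * complex_of_real t * z)) has_field_derivative (\<i> * complex_of_real t * exp (\<i> * complex_of_real t * complex_of_real x))) (at (complex_of_real x))"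
          by (auto intro!: derivative_eq_intros)
        from has_vector_derivative_real_field[OF this] show ?thesis
          by (simp add: mult_ac)
      qed
      show ?thesis
        unfolding F_def f_def
        by (rule has_vector_derivative_eq_rhs[OF has_vector_derivative_mult[OF has_vector_derivative_minus[OF 1] 2]])
           (simp add: algebra_simps)
    qed
    show "isCont f x" for x
      unfolding f_def normal_density_def by (intro continuous_intros) auto
    show "set_integrable lborel (einterval (-\<infinity>) \<infinity>) f"
      using intf by (simp add: set_integrable_def einterval_def)
    have d: "(std_normal_density \<longlongrightarrow> 0) at_top" "(std_normal_density \<longlongrightarrow> 0) at_bot"
      unfolding normal_density_def by real_asymp+
    have "((\<lambda>z. norm (F z)) \<longlongrightarrow> 0) at_top" "((\<lambda>z. norm (F z)) \<longlongrightarrow> 0) at_bot"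
      using d by (auto simp: F_def norm_mult normal_density_nonneg)
    then have "(F \<longlongrightarrow> 0) at_top" "(F \<longlongrightarrow> 0) at_bot"
      by (auto intro: tendsto_norm_zero_cancel)
    then show "((F \<circ> real_of_ereal) \<longlongrightarrow> 0) (at_right (-\<infinity>))" "((F \<circ> real_of_ereal) \<longlongrightarrow> 0) (at_left \<infinity>)"
      by (auto simp: ereal_tendsto_simps)
  qed simp
  finally have "(\<integral>z. complex_of_real z * iexp (t * z) \<partial>std_normal_distribution) = (\<i> * complex_of_real t) * (\<integral>z. iexp (t * z) \<partial>std_normal_distribution)"
    using i1 i2 by simp
  then have "(\<integral>z. complex_of_real z * iexp (t * z) \<partial>std_normal_distribution) = \<i> * complex_of_real (t * psi0 t)"
    unfolding integral_std_normal_iexp by simp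
  with has_bochner_integral_diff[OF has_bochner_integral_integrable[OF i1]
      has_bochner_integral_integrable[OF integrable_const_std_normal(1)[of "\<i> * complex_of_real (t * psi0 t)"]]]
  show ?thesis
    by (simp only: integrable_const_std_normal(2) diff_self)
qed

section \<open>Moments of normalized sums of functions of a standard normal sample\<close>

locale std_normal_sample = prob_space +
  fixes Z :: "nat \<Rightarrow> 'a \<Rightarrow> real"
  assumes indep: "indep_vars (\<lambda>_. borel) Z UNIV"
    and std_normal: "\<And>k. distributed M lborel (Z k) std_normal_density"
begin

lemma measurable_Z[measurable]: "Z k \<in> borel_measurable M"
  using std_normal[of k] by (simp add: distributed_def)

lemma distr_Z: "distr M borel (Z k) = std_normal_distribution"
  using std_normal[of k] by (simp add: distributed_def cong: distr_cong)

lemma expectation_Z: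
  fixes f :: "real \<Rightarrow> 'c::{banach, second_countable_topology}"
  shows "f \<in> borel_measurable borel \<Longrightarrow> expectation (\<lambda>x. f (Z k x)) = (\<integral>z. f z \<partial>std_normal_distribution)"
  by (subst distr_Z[of k, symmetric], subst integral_distr) auto

lemma integrable_Z:
  fixes f :: "real \<Rightarrow> 'c::{banach, second_countable_topology}"
  shows "f \<in> borel_measurable borel \<Longrightarrow> integrable M (\<lambda>x. f (Z k x)) \<longleftrightarrow> integrable std_normal_distribution f"
  by (subst distr_Z[of k, symmetric], subst integrable_distr_eq) auto

text \<open>\<open>1 + exp_bound / n\<close> bounds the exponential moment of one centred summand
  divided by \<open>sqrt n\<close>, whichever admissible function is summed. The factor 2 is
  \<open>fact 2\<close>, from \<open>x\<^sup>2 \<le> 2 * exp x\<close> for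
  \<open>x \<ge> 0\<close>.\<close>

definition exp_bound :: real where
  "exp_bound = 2 * (\<integral>z. exp ((z\<^sup>2 + 1) / 4) \<partial>std_normal_distribution)"

text \<open>Independence turns the exponential moment into a product of \<open>n\<close> factors.
  Centring removes the linear term, so each factor is at most
  \<open>1 + exp_bound / n \<le> exp (exp_bound / n)\<close>, and the bound on the product depends
  neither on \<open>n\<close> nor on \<open>y\<close>.\<close>

lemma normalized_sum_exp_moment:
  assumes [measurable]: "y \<in> borel_measurable borel" and le: "\<And>z. \<bar>y z\<bar> \<le> (z\<^sup>2 + 1) / 8"
    and mean: "(\<integral>z. y z \<partial>std_normal_distribution) = 0" and n: "n \<ge> 1"
  shows "integrable M (\<lambda>x. exp ((\<Sum>k<n. y (Z k x)) / sqrt n))"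
    and "expectation (\<lambda>x. exp ((\<Sum>k<n. y (Z k x)) / sqrt n)) \<le> exp exp_bound"
proof -
  have sn: "sqrt n \<ge> 1" using n by simp
  have eq: "exp ((\<Sum>k<n. y (Z k x)) / sqrt n) = (\<Prod>k<n. exp (y (Z k x) / sqrt n))" for x
    by (simp add: sum_divide_distrib exp_sum)
  have abs: "\<bar>y z / sqrt n\<bar> \<le> \<bar>y z\<bar>" for z
    using sn by (auto simp: abs_divide divide_simps intro: mult_left_mono[of 1 "sqrt n" "\<bar>y z\<bar>", simplified])
  have inty: "integrable std_normal_distribution y"
    by (rule integrable_std_normal_quadratic[where C = "1/8"]) (use le in auto)
  have bnd: "exp (y z / sqrt n) \<le> 1 + y z / sqrt n + 2 * exp ((z\<^sup>2 + 1) / 4) / n" for z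
  proof -
    have "exp (y z / sqrt n) \<le> 1 + y z / sqrt n + (y z / sqrt n)\<^sup>2 * exp \<bar>y z / sqrt n\<bar>"
      by (rule exp_le_quadratic_remainder)
    also have "(y z / sqrt n)\<^sup>2 * exp \<bar>y z / sqrt n\<bar> \<le> (y z)\<^sup>2 / n * exp \<bar>y z\<bar>"
      using abs[of z] by (intro mult_mono) (auto simp: power_divide)
    also have "(y z)\<^sup>2 / n * exp \<bar>y z\<bar> \<le> 2 * exp \<bar>y z\<bar> / n * exp \<bar>y z\<bar>"
      using power_le_fact_mult_exp[of "\<bar>y z\<bar>" 2] by (intro mult_right_mono divide_right_mono) auto
    also have "\<dots> = 2 * exp (2 * \<bar>y z\<bar>) / n"
      by (simp add: exp_double power2_eq_square)
    also have "\<dots> \<le> 2 * exp ((z\<^sup>2 + 1) / 4) / n"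
      using le[of z] by (intro divide_right_mono mult_left_mono) auto
    finally show ?thesis by simp
  qed
  have inte: "integrable std_normal_distribution (\<lambda>z. exp (y z / sqrt n))"
  proof (rule Bochner_Integration.integrable_bound[OF integrable_std_normal_exp_square])
    have "y z / sqrt n \<le> (z\<^sup>2 + 1) / 4" for z
      using abs[of z] le[of z] zero_le_power2[of z] by linarith
    then show "AE z in std_normal_distribution. norm (exp (y z / sqrt n)) \<le> norm (exp ((z\<^sup>2 + 1) / 4))"
      by auto
  qed measurable
  interpret N: prob_space std_normal_distribution
    by (rule prob_space_normal_density) simp
  have int1: "integrable M (\<lambda>x. exp (y (Z k x) / sqrt n))" for k
    using inte by (subst integrable_Z) auto
  have ind: "indep_vars (\<lambda>_. borel) (\<lambda>k x. exp (y (Z k x) / sqrt n)) {..<n}"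
    by (rule indep_vars_compose2[OF indep_vars_subset[OF indep]]) auto
  have one: "expectation (\<lambda>x. exp (y (Z k x) / sqrt n)) \<le> exp (exp_bound / n)" for k
  proof -
    have "expectation (\<lambda>x. exp (y (Z k x) / sqrt n)) = (\<integral>z. exp (y z / sqrt n) \<partial>std_normal_distribution)"
      by (rule expectation_Z) measurable
    also have "\<dots> \<le> (\<integral>z. 1 + y z / sqrt n + 2 * exp ((z\<^sup>2 + 1) / 4) / n \<partial>std_normal_distribution)"
      using integrable_std_normal_exp_square inty inte by (intro integral_mono bnd) auto
    also have "\<dots> = 1 + exp_bound / n"
      using integrable_std_normal_exp_square inty mean by (simp add: exp_bound_def N.prob_space del: space_density space_lborel)
    also have "\<dots> \<le> exp (exp_bound / n)"
      by (rule exp_ge_add_one_self)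
    finally show ?thesis .
  qed
  show "integrable M (\<lambda>x. exp ((\<Sum>k<n. y (Z k x)) / sqrt n))"
    unfolding eq using int1 by (intro indep_vars_integrable ind) auto
  have "expectation (\<lambda>x. exp ((\<Sum>k<n. y (Z k x)) / sqrt n)) = (\<Prod>k<n. expectation (\<lambda>x. exp (y (Z k x) / sqrt n)))"
    unfolding eq using int1 by (intro indep_vars_lebesgue_integral ind) auto
  also have "\<dots> \<le> (\<Prod>k<n. exp (exp_bound / n))"
    using one by (intro prod_mono) auto
  also have "\<dots> = exp exp_bound"
    using n by (simp add: exp_of_nat_mult[symmetric])
  finally show "expectation (\<lambda>x. exp ((\<Sum>k<n. y (Z k x)) / sqrt n)) \<le> exp exp_bound" .
qed

text \<open>The exponential bound is applied to \<open>y\<close> and to \<open>- y\<close>, since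
  \<open>exp \<bar>s\<bar> \<le> exp s + exp (- s)\<close>. The resulting constant is the same for
  all admissible \<open>y\<close>; this is the source of uniformity in \<open>t\<close>.\<close>

lemma normalized_sum_moment_bound:
  assumes y: "y \<in> borel_measurable borel" "\<And>z. \<bar>y z\<bar> \<le> (z\<^sup>2 + 1) / 8" "(\<integral>z. y z \<partial>std_normal_distribution) = 0"
    and n: "n \<ge> 1"
  shows "integrable M (\<lambda>x. \<bar>(\<Sum>k<n. y (Z k x)) / sqrt n\<bar> ^ p)"
    and "expectation (\<lambda>x. \<bar>(\<Sum>k<n. y (Z k x)) / sqrt n\<bar> ^ p) \<le> fact p * (2 * exp exp_bound)"
proof -
  let ?s = "\<lambda>x. (\<Sum>k<n. y (Z k x)) / sqrt n"
  note [measurable] = y(1)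
  note e1 = normalized_sum_exp_moment[OF y n]
  have e2: "integrable M (\<lambda>x. exp (- ?s x))" "expectation (\<lambda>x. exp (- ?s x)) \<le> exp exp_bound"
    using normalized_sum_exp_moment[of "\<lambda>z. - y z" n] y n by (auto simp: sum_negf)
  have pt: "\<bar>?s x\<bar> ^ p \<le> fact p * (exp (?s x) + exp (- ?s x))" for x
  proof -
    have "\<bar>?s x\<bar> ^ p \<le> fact p * exp \<bar>?s x\<bar>"
      by (rule power_le_fact_mult_exp) simp
    also have "\<dots> \<le> fact p * (exp (?s x) + exp (- ?s x))"
      by (intro mult_left_mono) (auto simp: abs_if)
    finally show ?thesis .
  qed
  have int2: "integrable M (\<lambda>x. fact p * (exp (?s x) + exp (- ?s x)))"
    using e1 e2 by auto
  show int: "integrable M (\<lambda>x. \<bar>?s x\<bar> ^ p)"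
    by (rule Bochner_Integration.integrable_bound[OF int2])
       (use pt in \<open>auto simp: abs_mult intro: order_trans[OF _ pt]\<close>)
  have "expectation (\<lambda>x. \<bar>?s x\<bar> ^ p) \<le> expectation (\<lambda>x. fact p * (exp (?s x) + exp (- ?s x)))"
    by (intro integral_mono int int2 pt)
  also have "\<dots> = fact p * (expectation (\<lambda>x. exp (?s x)) + expectation (\<lambda>x. exp (- ?s x)))"
    using e1(1) e2(1) by simp
  also have "\<dots> \<le> fact p * (2 * exp exp_bound)"
    using e1(2) e2(2) by (intro mult_left_mono) auto
  finally show "expectation (\<lambda>x. \<bar>?s x\<bar> ^ p) \<le> fact p * (2 * exp exp_bound)" .
qed

lemma process_bounded_avg_real:
  fixes y :: "real \<Rightarrow> real \<Rightarrow> real"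
  assumes meas: "\<And>t. y t \<in> borel_measurable borel" and le: "\<And>t z. \<bar>t\<bar> \<le> T \<Longrightarrow> \<bar>y t z\<bar> \<le> C * (z\<^sup>2 + 1)"
    and mean: "\<And>t. (\<integral>z. y t z \<partial>std_normal_distribution) = 0" and C: "C > 0"
  shows "process_bounded T (\<lambda>n t x. sqrt n * \<bar>(\<Sum>k<n. y t (Z k x)) / n\<bar>)"
proof -
  note [measurable] = meas
  \<comment> \<open>Rescaling to the growth bound \<open>(z\<^sup>2 + 1) / 8\<close> for which
    exponential moments are controlled; \<open>C\<close> is common to all \<open>t\<close> in the
    interval.\<close>
  let ?y = "\<lambda>t z. y t z / (8 * C)"
  let ?F = "\<lambda>n t x. (\<Sum>k<n. ?y t (Z k x)) / sqrt (real n)"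
  have y: "\<bar>?y t z\<bar> \<le> (z\<^sup>2 + 1) / 8" if "t \<in> {-T..T}" for t z
    using le[of t z] C that by (simp add: abs_le_iff field_simps)
  have mb: "process_bounded T ?F"
    unfolding moments_bounded_def
  proof (intro conjI ballI allI exI)
    fix j :: "nat \<times> real" and p assume "j \<in> {1..} \<times> {-T..T}"
    then have j: "fst j \<ge> 1" "snd j \<in> {-T..T}" by auto
    show "?F (fst j) (snd j) \<in> borel_measurable M" by measurable
    show "integrable M (\<lambda>x. \<bar>?F (fst j) (snd j) x\<bar> ^ p)"
      "expectation (\<lambda>x. \<bar>?F (fst j) (snd j) x\<bar> ^ p) \<le> fact p * (2 * exp exp_bound)"
      by (rule normalized_sum_moment_bound[OF _ y[OF j(2)] _ j(1)]; simp add: mean)+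
  qed
  show ?thesis
  proof (rule moments_bounded_dom[OF moments_bounded_cmult[OF mb, of "8 * C"]])
    fix j :: "nat \<times> real" and x assume "j \<in> {1..} \<times> {-T..T}"
    then have n: "real (fst j) > 0" by auto
    show "\<bar>sqrt (fst j) * \<bar>(\<Sum>k<fst j. y (snd j) (Z k x)) / fst j\<bar>\<bar> \<le> \<bar>8 * C * ?F (fst j) (snd j) x\<bar>"
      using n C by (simp add: abs_mult sum_divide_distrib [symmetric] field_simps) (simp flip: mult.assoc)
  qed measurable
qed

lemma process_bounded_avg:
  fixes y :: "real \<Rightarrow> real \<Rightarrow> complex"
  assumes meas: "\<And>t. y t \<in> borel_measurable borel" and le: "\<And>t z. \<bar>t\<bar> \<le> T \<Longrightarrow> cmod (y t z) \<le> C * (z\<^sup>2 + 1)"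
    and mean: "\<And>t. has_bochner_integral std_normal_distribution (y t) 0" and C: "C > 0"
  shows "process_bounded T (\<lambda>n t x. sqrt n * cmod ((\<Sum>k<n. y t (Z k x)) / n))"
proof -
  note [measurable] = meas
  have R: "process_bounded T (\<lambda>n t x. sqrt n * \<bar>(\<Sum>k<n. Re (y t (Z k x))) / n\<bar>)"
    by (rule process_bounded_avg_real[where C = C])
       (use order_trans[OF abs_Re_le_cmod le] C has_bochner_integral_integral_eq[OF has_bochner_integral_Re[OF mean]] in auto)
  have I: "process_bounded T (\<lambda>n t x. sqrt n * \<bar>(\<Sum>k<n. Im (y t (Z k x))) / n\<bar>)"
    by (rule process_bounded_avg_real[where C = C])
       (use order_trans[OF abs_Im_le_cmod le] C has_bochner_integral_integral_eq[OF has_bochner_integral_Im[OF mean]] in auto)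
  show ?thesis
  proof (rule process_bounded_dom[OF moments_bounded_add[OF R I]])
    fix n t x
    let ?S = "\<Sum>k<n. y t (Z k x)"
    have "sqrt n * cmod (?S / n) \<le> sqrt n * (\<bar>Re (?S / n)\<bar> + \<bar>Im (?S / n)\<bar>)"
      by (intro mult_left_mono cmod_le) simp
    then show "sqrt n * cmod (?S / n) \<le> sqrt n * \<bar>(\<Sum>k<n. Re (y t (Z k x))) / n\<bar> + sqrt n * \<bar>(\<Sum>k<n. Im (y t (Z k x))) / n\<bar>"
      by (simp add: distrib_left)
  qed auto
qed

end

subsection \<open>Linearization of the standardized empirical characteristic function\<close>

lemma norm_iexp_diff_le: "cmod (iexp a - iexp b) \<le> \<bar>a - b\<bar>"
proof -
  have "iexp a - iexp b = iexp b * (iexp (a - b) - 1)"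
    by (simp add: algebra_simps exp_add [symmetric])
  then have "cmod (iexp a - iexp b) = cmod (iexp (a - b) - 1)"
    by (simp add: norm_mult)
  also have "\<dots> \<le> \<bar>a - b\<bar>"
    using iexp_approx1[of "a - b" 0] by simp
  finally show ?thesis .
qed

lemma norm_iexp_taylor1_le: "cmod (iexp (a + b) - iexp a - \<i> * complex_of_real b * iexp a) \<le> b\<^sup>2 / 2"
proof -
  have "iexp (a + b) - iexp a - \<i> * complex_of_real b * iexp a = iexp a * (iexp b - (1 + \<i> * complex_of_real b))"
    by (simp add: algebra_simps exp_add [symmetric])
  then have "cmod (iexp (a + b) - iexp a - \<i> * complex_of_real b * iexp a) = cmod (iexp b - (1 + \<i> * complex_of_real b))"
    by (simp add: norm_mult)
  also have "\<dots> \<le> b\<^sup>2 / 2"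
    using iexp_approx1[of b 1] by (simp add: fact_numeral numeral_2_eq_2)
  finally show ?thesis .
qed

section \<open>Deterministic estimates for standardized observations\<close>

lemma ssd_nonneg: "0 \<le> ssd n xs"
  by (simp add: ssd_def sum_nonneg)

lemma ssd_power2: "(ssd n xs)\<^sup>2 = (\<Sum>k<n. (xs k - smean n xs)\<^sup>2) / n"
  by (simp add: ssd_def sum_nonneg)

lemma ssd_power2_eq:
  assumes "n \<ge> 1"
  shows "(ssd n xs)\<^sup>2 = (\<Sum>k<n. (xs k)\<^sup>2) / n - (smean n xs)\<^sup>2"
proof -
  define a where "a = smean n xs"
  have a: "(\<Sum>k<n. xs k) = n * a"
    using assms by (simp add: a_def smean_def)
  have "(\<Sum>k<n. (xs k - a)\<^sup>2) = (\<Sum>k<n. (xs k)\<^sup>2) - 2 * a * (\<Sum>k<n. xs k) + n * a\<^sup>2"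
    by (simp add: power2_diff sum.distrib sum_subtractf sum_distrib_left mult_ac)
  also have "\<dots> = (\<Sum>k<n. (xs k)\<^sup>2) - n * a\<^sup>2"
    unfolding a by (simp add: power2_eq_square)
  finally show ?thesis
    using assms by (simp add: ssd_power2 a_def [symmetric] diff_divide_distrib)
qed

text \<open>Since \<open>ssd n xs + 1 \<ge> 1\<close>, the square root can be replaced by its
  square; what remains are plain averages, to which the bounds for i.i.d. sums apply.\<close>

lemma abs_ssd_minus_one_le:
  assumes "n \<ge> 1"
  shows "\<bar>ssd n xs - 1\<bar> \<le> \<bar>(\<Sum>k<n. (xs k)\<^sup>2 - 1) / n\<bar> + (smean n xs)\<^sup>2"
proof -
  let ?s = "ssd n xs"
  have "\<bar>?s - 1\<bar> \<le> \<bar>?s - 1\<bar> * \<bar>?s + 1\<bar>"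
    using ssd_nonneg[of n xs] mult_left_mono[of 1 "\<bar>?s + 1\<bar>" "\<bar>?s - 1\<bar>"] by simp
  also have "\<dots> = \<bar>?s\<^sup>2 - 1\<bar>"
    by (simp add: abs_mult [symmetric] power2_eq_square algebra_simps)
  also have "?s\<^sup>2 - 1 = (\<Sum>k<n. (xs k)\<^sup>2 - 1) / n - (smean n xs)\<^sup>2"
    using assms by (simp add: ssd_power2_eq sum_subtractf diff_divide_distrib)
  finally show ?thesis
    by (smt (verit) zero_le_power2)
qed

definition std_obs :: "nat \<Rightarrow> (nat \<Rightarrow> real) \<Rightarrow> nat \<Rightarrow> real" where
  "std_obs n xs k = (xs k - smean n xs) / ssd n xs"

text \<open>Standardizing each observation absorbs the phase factor and the rescaled argument,
  leaving an average of numbers of modulus 1. With \<open>ssd n xs = 0\<close> both sides follow the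
  convention \<open>x / 0 = 0\<close> and still agree.\<close>

lemma ecf_std_eq: "ecf_std n xs t = (\<Sum>k<n. iexp (t * std_obs n xs k)) / of_nat n"
proof -
  have "exp (- \<i> * complex_of_real (t * smean n xs / ssd n xs)) * iexp (t / ssd n xs * xs k) = iexp (t * std_obs n xs k)" for k
    by (simp add: std_obs_def exp_add [symmetric] algebra_simps diff_divide_distrib)
  then show ?thesis
    by (simp add: ecf_std_def ecf_def sum_distrib_left)
qed

text \<open>The average is 1 for non-degenerate samples and, by \<open>x / 0 = 0\<close>, it is 0
  for constant ones; the inequality covers both. This deterministic bound takes the place of any
  control of \<open>1 / ssd\<close>.\<close>

lemma sum_std_obs_power2_le:
  assumes "n \<ge> 1"
  shows "(\<Sum>k<n. (std_obs n xs k)\<^sup>2) / n \<le> 1"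
proof -
  have "(\<Sum>k<n. (std_obs n xs k)\<^sup>2) / n = (ssd n xs)\<^sup>2 / (ssd n xs)\<^sup>2"
    using assms by (simp add: std_obs_def power_divide flip: sum_divide_distrib) (simp add: ssd_power2 flip: sum_divide_distrib)
  then show ?thesis by simp
qed

lemma sum_abs_std_obs_le:
  assumes "n \<ge> 1"
  shows "(\<Sum>k<n. \<bar>std_obs n xs k\<bar>) / n \<le> 1"
proof -
  have le: "\<bar>w\<bar> \<le> (1 + w\<^sup>2) / 2" for w :: real
  proof -
    have "0 \<le> (\<bar>w\<bar> - 1)\<^sup>2" by simp
    then show ?thesis unfolding power2_diff by simp
  qed
  have "(\<Sum>k<n. \<bar>std_obs n xs k\<bar>) / n \<le> (\<Sum>k<n. (1 + (std_obs n xs k)\<^sup>2) / 2) / n"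
    by (intro divide_right_mono sum_mono le) simp
  also have "\<dots> = (1 + (\<Sum>k<n. (std_obs n xs k)\<^sup>2) / n) / 2"
    using assms by (simp add: sum.distrib sum_divide_distrib [symmetric] field_simps)
  also have "\<dots> \<le> 1"
    using sum_std_obs_power2_le[OF assms, of xs] by simp
  finally show ?thesis .
qed

text \<open>Measures how far standardization is from the identity when the true mean is 0 and the
  true standard deviation is 1. For a standard normal sample it is of order
  \<open>1 / sqrt n\<close>.\<close>

definition std_defect :: "nat \<Rightarrow> (nat \<Rightarrow> real) \<Rightarrow> real" where
  "std_defect n xs = \<bar>ssd n xs - 1\<bar> + \<bar>smean n xs\<bar>"

lemma std_defect_nonneg: "0 \<le> std_defect n xs"
  by (simp add: std_defect_def)

text \<open>Writing the observation in terms of its standardization, rather than conversely, keeps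
  \<open>1 / ssd\<close> out of all the estimates below; the identity also holds in the degenerate case
  \<open>ssd = 0\<close>, where \<open>std_obs\<close> vanishes.\<close>
lemma std_obs_decomp:
  assumes "k < n"
  shows "xs k - std_obs n xs k = (ssd n xs - 1) * std_obs n xs k + smean n xs"
proof (cases "ssd n xs = 0")
  case True
  then have "(\<Sum>k<n. (xs k - smean n xs)\<^sup>2) = 0"
    using assms by (simp add: ssd_def)
  then have "\<forall>k\<in>{..<n}. (xs k - smean n xs)\<^sup>2 = 0"
    by (subst (asm) sum_nonneg_eq_0_iff) auto
  with assms True show ?thesis
    by (auto simp: std_obs_def)
qed (simp add: std_obs_def field_simps)

lemma abs_obs_minus_std_obs_le:
  assumes "k < n"
  shows "\<bar>xs k - std_obs n xs k\<bar> \<le> \<bar>ssd n xs - 1\<bar> * \<bar>std_obs n xs k\<bar> + \<bar>smean n xs\<bar>"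
  unfolding std_obs_decomp[OF assms] abs_mult [symmetric] by (rule abs_triangle_ineq)

text \<open>By \<open>std_obs_decomp\<close> the displacement is affine in the standardized
  observation, with coefficients \<open>ssd - 1\<close> and the mean, while the averages of the
  standardized observations are at most 1. The weighted and the squared version below have the same
  reason.\<close>

lemma avg_abs_diff_le:
  assumes "n \<ge> 1"
  shows "(\<Sum>k<n. \<bar>xs k - std_obs n xs k\<bar>) / n \<le> std_defect n xs"
proof -
  let ?s = "\<bar>ssd n xs - 1\<bar>" and ?a = "\<bar>smean n xs\<bar>"
  have "(\<Sum>k<n. \<bar>xs k - std_obs n xs k\<bar>) / n \<le> (\<Sum>k<n. ?s * \<bar>std_obs n xs k\<bar> + ?a) / n"
    by (intro divide_right_mono sum_mono abs_obs_minus_std_obs_le) auto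
  also have "\<dots> = ?s * ((\<Sum>k<n. \<bar>std_obs n xs k\<bar>) / n) + ?a"
    using assms by (simp add: sum.distrib sum_distrib_left [symmetric] add_divide_distrib)
  also have "\<dots> \<le> ?s * 1 + ?a"
    by (intro add_right_mono mult_left_mono sum_abs_std_obs_le assms) auto
  finally show ?thesis by (simp add: std_defect_def)
qed

lemma avg_abs_mult_diff_le:
  assumes "n \<ge> 1"
  shows "(\<Sum>k<n. \<bar>std_obs n xs k\<bar> * \<bar>xs k - std_obs n xs k\<bar>) / n \<le> std_defect n xs"
proof -
  let ?s = "\<bar>ssd n xs - 1\<bar>" and ?a = "\<bar>smean n xs\<bar>"
  have "(\<Sum>k<n. \<bar>std_obs n xs k\<bar> * \<bar>xs k - std_obs n xs k\<bar>) / n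
      \<le> (\<Sum>k<n. \<bar>std_obs n xs k\<bar> * (?s * \<bar>std_obs n xs k\<bar> + ?a)) / n"
    by (intro divide_right_mono sum_mono mult_left_mono abs_obs_minus_std_obs_le) auto
  also have "\<dots> = ?s * ((\<Sum>k<n. (std_obs n xs k)\<^sup>2) / n) + ?a * ((\<Sum>k<n. \<bar>std_obs n xs k\<bar>) / n)"
  proof -
    have "(\<Sum>k<n. \<bar>std_obs n xs k\<bar> * (?s * \<bar>std_obs n xs k\<bar> + ?a)) = (\<Sum>k<n. ?s * (std_obs n xs k)\<^sup>2 + ?a * \<bar>std_obs n xs k\<bar>)"
    proof (intro sum.cong refl)
      show "\<bar>w\<bar> * (c * \<bar>w\<bar> + d) = c * w\<^sup>2 + d * \<bar>w\<bar>" for w c d :: real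
        by (cases "w \<ge> 0") (simp_all add: power2_eq_square algebra_simps)
    qed
    then show ?thesis
      by (simp add: sum.distrib sum_distrib_left [symmetric] add_divide_distrib)
  qed
  also have "\<dots> \<le> ?s * 1 + ?a * 1"
    by (intro add_mono mult_left_mono sum_std_obs_power2_le sum_abs_std_obs_le assms) auto
  finally show ?thesis by (simp add: std_defect_def)
qed

lemma avg_diff_power2_le:
  assumes "n \<ge> 1"
  shows "(\<Sum>k<n. (xs k - std_obs n xs k)\<^sup>2) / n \<le> 2 * (std_defect n xs)\<^sup>2"
proof -
  let ?s = "\<bar>ssd n xs - 1\<bar>" and ?a = "\<bar>smean n xs\<bar>"
  have "(\<Sum>k<n. (xs k - std_obs n xs k)\<^sup>2) / n \<le> (\<Sum>k<n. 2 * ?s\<^sup>2 * (std_obs n xs k)\<^sup>2 + 2 * ?a\<^sup>2) / n"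
  proof (intro divide_right_mono sum_mono)
    fix k assume "k \<in> {..<n}"
    then have "(xs k - std_obs n xs k)\<^sup>2 \<le> (?s * \<bar>std_obs n xs k\<bar> + ?a)\<^sup>2"
      using abs_obs_minus_std_obs_le[of k n xs] by (intro power2_le_iff_abs_le[THEN iffD2]) auto
    also have "\<dots> \<le> 2 * (?s * \<bar>std_obs n xs k\<bar>)\<^sup>2 + 2 * ?a\<^sup>2"
      using zero_le_power2[of "?s * \<bar>std_obs n xs k\<bar> - ?a"] unfolding power2_sum power2_diff by linarith
    finally show "(xs k - std_obs n xs k)\<^sup>2 \<le> 2 * ?s\<^sup>2 * (std_obs n xs k)\<^sup>2 + 2 * ?a\<^sup>2"
      by (simp add: power_mult_distrib)
  qed simp
  also have "\<dots> = 2 * ?s\<^sup>2 * ((\<Sum>k<n. (std_obs n xs k)\<^sup>2) / n) + 2 * ?a\<^sup>2"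
    using assms by (simp add: sum.distrib sum_distrib_left [symmetric] add_divide_distrib)
  also have "\<dots> \<le> 2 * ?s\<^sup>2 * 1 + 2 * ?a\<^sup>2"
    by (intro add_right_mono mult_left_mono sum_std_obs_power2_le assms) auto
  also have "\<dots> \<le> 2 * (std_defect n xs)\<^sup>2"
    unfolding std_defect_def power2_sum by simp
  finally show ?thesis .
qed

lemma norm_avg_le:
  fixes f :: "nat \<Rightarrow> complex"
  assumes "\<And>k. k < n \<Longrightarrow> cmod (f k) \<le> g k"
  shows "cmod ((\<Sum>k<n. f k) / of_nat n) \<le> (\<Sum>k<n. g k) / n"
  unfolding norm_divide norm_of_nat
  by (intro divide_right_mono order_trans[OF norm_sum] sum_mono) (use assms in auto)

lemma norm_ecf_std_le: "n \<ge> 1 \<Longrightarrow> cmod (ecf_std n xs t) \<le> 1"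
  unfolding ecf_std_eq by (rule order_trans[OF norm_avg_le[where g = "\<lambda>_. 1"]]) auto

lemma ecf_std_minus_ecf_le:
  assumes "n \<ge> 1"
  shows "cmod (ecf_std n xs t - ecf n xs t) \<le> \<bar>t\<bar> * std_defect n xs"
proof -
  have "cmod (ecf_std n xs t - ecf n xs t) = cmod ((\<Sum>k<n. iexp (t * std_obs n xs k) - iexp (t * xs k)) / of_nat n)"
    by (simp add: ecf_std_eq ecf_def sum_subtractf diff_divide_distrib)
  also have "\<dots> \<le> (\<Sum>k<n. \<bar>t\<bar> * \<bar>xs k - std_obs n xs k\<bar>) / n"
  proof (rule norm_avg_le)
    show "cmod (iexp (t * std_obs n xs k) - iexp (t * xs k)) \<le> \<bar>t\<bar> * \<bar>xs k - std_obs n xs k\<bar>" for k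
      using norm_iexp_diff_le[of "t * std_obs n xs k" "t * xs k"]
      by (simp add: right_diff_distrib [symmetric] abs_mult abs_minus_commute)
  qed
  also have "\<dots> = \<bar>t\<bar> * ((\<Sum>k<n. \<bar>xs k - std_obs n xs k\<bar>) / n)"
    by (simp add: sum_distrib_left)
  also have "\<dots> \<le> \<bar>t\<bar> * std_defect n xs"
    by (intro mult_left_mono avg_abs_diff_le assms) simp
  finally show ?thesis .
qed

text \<open>The average of \<open>x * iexp (t * x)\<close> is, up to the factor \<open>\<i>\<close>,
  the derivative of the empirical characteristic function. The expansion produces it at the
  standardized observations, whereas moment bounds are available at the original, independent
  ones.\<close>

lemma avg_std_obs_iexp_diff_le:
  assumes "n \<ge> 1"
  shows "cmod ((\<Sum>k<n. complex_of_real (std_obs n xs k) * iexp (t * std_obs n xs k)) / of_nat n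
      - (\<Sum>k<n. complex_of_real (xs k) * iexp (t * xs k)) / of_nat n) \<le> (\<bar>t\<bar> + 1) * std_defect n xs"
proof -
  let ?w = "std_obs n xs"
  have "cmod ((\<Sum>k<n. complex_of_real (?w k) * iexp (t * ?w k)) / of_nat n
      - (\<Sum>k<n. complex_of_real (xs k) * iexp (t * xs k)) / of_nat n) =
    cmod ((\<Sum>k<n. complex_of_real (?w k) * iexp (t * ?w k) - complex_of_real (xs k) * iexp (t * xs k)) / of_nat n)"
    by (simp add: sum_subtractf diff_divide_distrib)
  also have "\<dots> \<le> (\<Sum>k<n. \<bar>t\<bar> * (\<bar>?w k\<bar> * \<bar>xs k - ?w k\<bar>) + \<bar>xs k - ?w k\<bar>) / n"
  proof (rule norm_avg_le)
    fix k
    have "complex_of_real (?w k) * iexp (t * ?w k) - complex_of_real (xs k) * iexp (t * xs k) =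
        complex_of_real (?w k) * (iexp (t * ?w k) - iexp (t * xs k)) - complex_of_real (xs k - ?w k) * iexp (t * xs k)"
      by (simp add: algebra_simps)
    also have "cmod \<dots> \<le> \<bar>?w k\<bar> * cmod (iexp (t * ?w k) - iexp (t * xs k)) + \<bar>xs k - ?w k\<bar>"
      by (rule order_trans[OF norm_triangle_ineq4]) (simp add: norm_mult del: of_real_diff)
    also have "\<dots> \<le> \<bar>?w k\<bar> * (\<bar>t\<bar> * \<bar>xs k - ?w k\<bar>) + \<bar>xs k - ?w k\<bar>"
      using norm_iexp_diff_le[of "t * ?w k" "t * xs k"]
      by (intro add_right_mono mult_left_mono) (auto simp: right_diff_distrib [symmetric] abs_mult abs_minus_commute)
    finally show "cmod (complex_of_real (?w k) * iexp (t * ?w k) - complex_of_real (xs k) * iexp (t * xs k))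
        \<le> \<bar>t\<bar> * (\<bar>?w k\<bar> * \<bar>xs k - ?w k\<bar>) + \<bar>xs k - ?w k\<bar>"
      by (simp add: mult_ac)
  qed
  also have "\<dots> = \<bar>t\<bar> * ((\<Sum>k<n. \<bar>?w k\<bar> * \<bar>xs k - ?w k\<bar>) / n) + (\<Sum>k<n. \<bar>xs k - ?w k\<bar>) / n"
    by (simp add: sum_distrib_left sum.distrib add_divide_distrib)
  also have "\<dots> \<le> \<bar>t\<bar> * std_defect n xs + std_defect n xs"
    by (intro add_mono mult_left_mono avg_abs_diff_le avg_abs_mult_diff_le assms) simp
  finally show ?thesis by (simp add: algebra_simps)
qed

text \<open>Each term is expanded to first order at its standardized observation. The mean and
  \<open>ssd - 1\<close> then multiply averages, which are replaced by the standard normal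
  expectations \<open>psi0 t\<close> and \<open>\<i> * t * psi0 t\<close>. Every error is
  \<open>std_defect\<close> times another small quantity, hence quadratically small.\<close>

lemma ecf_std_linearization:
  assumes n: "n \<ge> 1"
  shows "cmod (ecf_std n xs t - ecf n xs t + \<i> * complex_of_real (t * psi0 t * smean n xs)
        - complex_of_real (t\<^sup>2 * psi0 t * (ssd n xs - 1)))
     \<le> 3 * (1 + \<bar>t\<bar>)\<^sup>2 * (std_defect n xs * (std_defect n xs + cmod (ecf n xs t - complex_of_real (psi0 t))
        + cmod ((\<Sum>k<n. complex_of_real (xs k) * iexp (t * xs k)) / of_nat n - \<i> * complex_of_real (t * psi0 t))))"
proof -
  let ?w = "std_obs n xs" and ?D = "std_defect n xs"
  define a where "a = smean n xs"
  define s where "s = ssd n xs - 1"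
  define A where "A = (\<Sum>k<n. complex_of_real (?w k) * iexp (t * ?w k)) / of_nat n"
  define B where "B = (\<Sum>k<n. complex_of_real (xs k) * iexp (t * xs k)) / of_nat n"
  define E0 where "E0 = cmod (ecf n xs t - complex_of_real (psi0 t))"
  define E1 where "E1 = cmod (B - \<i> * complex_of_real (t * psi0 t))"
  have D: "\<bar>a\<bar> \<le> ?D" "\<bar>s\<bar> \<le> ?D" "0 \<le> ?D"
    by (auto simp: std_defect_def a_def s_def)
  \<comment> \<open>The averaged remainder of the first-order expansion of
    \<open>iexp (t * x)\<close>, with the displacement already written as
    \<open>s * w + a\<close>.\<close>
  define R where "R = ecf n xs t - ecf_std n xs t - \<i> * complex_of_real t * (complex_of_real s * A + complex_of_real a * ecf_std n xs t)"
  have R_eq: "R = (\<Sum>k<n. iexp (t * xs k) - iexp (t * ?w k) - \<i> * complex_of_real (t * (xs k - ?w k)) * iexp (t * ?w k)) / of_nat n"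
  proof -
    have "(\<Sum>k<n. \<i> * complex_of_real (t * (xs k - ?w k)) * iexp (t * ?w k))
        = (\<Sum>k<n. \<i> * complex_of_real t * (complex_of_real s * (complex_of_real (?w k) * iexp (t * ?w k)) + complex_of_real a * iexp (t * ?w k)))"
    proof (intro sum.cong refl)
      fix k assume "k \<in> {..<n}"
      then have "xs k - ?w k = s * ?w k + a"
        using std_obs_decomp[of k n xs] by (simp add: s_def a_def)
      then show "\<i> * complex_of_real (t * (xs k - ?w k)) * iexp (t * ?w k)
         = \<i> * complex_of_real t * (complex_of_real s * (complex_of_real (?w k) * iexp (t * ?w k)) + complex_of_real a * iexp (t * ?w k))"
        by (simp only:) (simp add: algebra_simps)
    qed
    then show ?thesis
      by (simp add: R_def A_def ecf_std_eq ecf_def sum_subtractf diff_divide_distrib sum.distrib add_divide_distrib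
          sum_distrib_left [symmetric] ring_distribs)
  qed
  have "cmod R \<le> (\<Sum>k<n. t\<^sup>2 * (xs k - ?w k)\<^sup>2 / 2) / n"
    unfolding R_eq
  proof (rule norm_avg_le)
    fix k
    show "cmod (iexp (t * xs k) - iexp (t * ?w k) - \<i> * complex_of_real (t * (xs k - ?w k)) * iexp (t * ?w k)) \<le> t\<^sup>2 * (xs k - ?w k)\<^sup>2 / 2"
    proof -
      have "t * ?w k + t * (xs k - ?w k) = t * xs k" by (simp add: algebra_simps)
      then show ?thesis
        using norm_iexp_taylor1_le[of "t * ?w k" "t * (xs k - ?w k)"] by (simp only: power_mult_distrib)
    qed
  qed
  also have "(\<Sum>k<n. t\<^sup>2 * (xs k - ?w k)\<^sup>2 / 2) / n = t\<^sup>2 / 2 * ((\<Sum>k<n. (xs k - ?w k)\<^sup>2) / n)"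
    unfolding sum_distrib_left sum_divide_distrib by (intro sum.cong refl) simp
  also have "\<dots> \<le> t\<^sup>2 / 2 * (2 * ?D\<^sup>2)"
    by (intro mult_left_mono avg_diff_power2_le n) simp
  finally have R: "cmod R \<le> t\<^sup>2 * ?D\<^sup>2" by simp
  have A: "cmod (A - \<i> * complex_of_real (t * psi0 t)) \<le> (\<bar>t\<bar> + 1) * ?D + E1"
  proof -
    have "cmod (A - B) \<le> (\<bar>t\<bar> + 1) * ?D"
      unfolding A_def B_def by (rule avg_std_obs_iexp_diff_le[OF n])
    then show ?thesis
      using norm_triangle_ineq[of "A - B" "B - \<i> * complex_of_real (t * psi0 t)"] by (simp add: E1_def)
  qed
  have E: "cmod (ecf_std n xs t - complex_of_real (psi0 t)) \<le> \<bar>t\<bar> * ?D + E0"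
    using ecf_std_minus_ecf_le[OF n, of xs t] norm_triangle_ineq[of "ecf_std n xs t - ecf n xs t" "ecf n xs t - complex_of_real (psi0 t)"]
    by (simp add: E0_def)
  have tri: "cmod (- r - (u + v)) \<le> cmod r + (cmod u + cmod v)" for r u v
    using norm_triangle_ineq4[of "- r" "u + v"] norm_triangle_ineq[of u v] by simp
  \<comment> \<open>In the term with \<open>s\<close> the factor \<open>\<i> * t\<close> of the
    expansion meets the \<open>\<i> * t\<close> of the expectation; the product
    \<open>- t\<^sup>2\<close> makes this correction real and reverses its sign.\<close>
  have eq: "ecf_std n xs t - ecf n xs t + \<i> * complex_of_real (t * psi0 t * a) - complex_of_real (t\<^sup>2 * psi0 t * s)
     = - R - (\<i> * complex_of_real (t * s) * (A - \<i> * complex_of_real (t * psi0 t)) + \<i> * complex_of_real (t * a) * (ecf_std n xs t - complex_of_real (psi0 t)))"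
    by (simp add: R_def algebra_simps power2_eq_square)
  have "cmod (ecf_std n xs t - ecf n xs t + \<i> * complex_of_real (t * psi0 t * a) - complex_of_real (t\<^sup>2 * psi0 t * s)) \<le> cmod R + (cmod (\<i> * complex_of_real (t * s) * (A - \<i> * complex_of_real (t * psi0 t))) + cmod (\<i> * complex_of_real (t * a) * (ecf_std n xs t - complex_of_real (psi0 t))))"
    unfolding eq by (rule tri)
  also have "\<dots> = cmod R + (\<bar>t\<bar> * \<bar>s\<bar> * cmod (A - \<i> * complex_of_real (t * psi0 t)) + \<bar>t\<bar> * \<bar>a\<bar> * cmod (ecf_std n xs t - complex_of_real (psi0 t)))"
    unfolding norm_mult norm_ii norm_of_real abs_mult by simp
  also have "\<dots> \<le> t\<^sup>2 * ?D\<^sup>2 + (\<bar>t\<bar> * ?D * ((\<bar>t\<bar> + 1) * ?D + E1) + \<bar>t\<bar> * ?D * (\<bar>t\<bar> * ?D + E0))"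
    using D by (intro add_mono R mult_mono[OF _ A] mult_mono[OF _ E] mult_left_mono) auto
  also have "\<dots> \<le> 3 * (1 + \<bar>t\<bar>)\<^sup>2 * (?D * (?D + E0 + E1))"
  proof -
    have t2: "t\<^sup>2 = \<bar>t\<bar> * \<bar>t\<bar>" by (simp add: power2_eq_square)
    have nn: "0 \<le> E0" "0 \<le> E1" by (simp_all add: E0_def E1_def)
    \<comment> \<open>Expanded, the gap between the two bounds is a polynomial with nonnegative
      coefficients; the crude factor \<open>3 * (1 + \<bar>t\<bar>)\<^sup>2\<close> ensures
      this.\<close>
    have "3 * (1 + \<bar>t\<bar>)\<^sup>2 * (?D * (?D + E0 + E1)) - (t\<^sup>2 * ?D\<^sup>2 + (\<bar>t\<bar> * ?D * ((\<bar>t\<bar> + 1) * ?D + E1) + \<bar>t\<bar> * ?D * (\<bar>t\<bar> * ?D + E0)))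
      = (3 + 5 * \<bar>t\<bar>) * (?D * ?D) + (3 + 5 * \<bar>t\<bar> + 3 * (\<bar>t\<bar> * \<bar>t\<bar>)) * (?D * E0) + (3 + 5 * \<bar>t\<bar> + 3 * (\<bar>t\<bar> * \<bar>t\<bar>)) * (?D * E1)"
      unfolding t2 power2_eq_square by (simp add: algebra_simps)
    also have "\<dots> \<ge> 0"
      using nn D by (intro add_nonneg_nonneg mult_nonneg_nonneg) auto
    finally show ?thesis by linarith
  qed
  finally show ?thesis
    by (simp add: a_def s_def E0_def E1_def B_def)
qed

section \<open>Affine invariance, continuity and measurability of the basic statistics\<close>

lemma smean_affine: "n \<ge> 1 \<Longrightarrow> smean n (\<lambda>k. \<mu> + \<sigma> * zs k) = \<mu> + \<sigma> * smean n zs"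
  by (simp add: smean_def sum.distrib sum_distrib_left [symmetric] add_divide_distrib)

lemma ssd_affine:
  assumes "n \<ge> 1" "\<sigma> > 0"
  shows "ssd n (\<lambda>k. \<mu> + \<sigma> * zs k) = \<sigma> * ssd n zs"
proof -
  have "(\<Sum>k<n. (\<mu> + \<sigma> * zs k - (\<mu> + \<sigma> * smean n zs))\<^sup>2) / n = \<sigma>\<^sup>2 * ((\<Sum>k<n. (zs k - smean n zs)\<^sup>2) / n)"
    by (simp add: sum_distrib_left power2_eq_square algebra_simps)
  then show ?thesis
    using assms unfolding ssd_def smean_affine[OF assms(1)] by (simp only: real_sqrt_mult) simp
qed

lemma ecf_std_affine:
  assumes "n \<ge> 1" "\<sigma> > 0"
  shows "ecf_std n (\<lambda>k. \<mu> + \<sigma> * zs k) t = ecf_std n zs t"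
proof -
  have "std_obs n (\<lambda>k. \<mu> + \<sigma> * zs k) k = std_obs n zs k" for k
    using assms by (simp add: std_obs_def smean_affine ssd_affine right_diff_distrib [symmetric])
  then show ?thesis
    by (simp add: ecf_std_eq)
qed

lemma psi0_pos: "0 < psi0 t" and psi0_le_1: "psi0 t \<le> 1"
  by (simp_all add: psi0_def)

lemma continuous_psi0[continuous_intros]: "continuous_on S f \<Longrightarrow> continuous_on S (\<lambda>x. psi0 (f x))"
  unfolding psi0_def by (intro continuous_intros) auto

lemma continuous_wt[continuous_intros]: "continuous_on S f \<Longrightarrow> continuous_on S (\<lambda>x. wt \<beta> (f x))"
  unfolding wt_def by (intro continuous_intros)

lemma continuous_ecf[continuous_intros]: "continuous_on S f \<Longrightarrow> continuous_on S (\<lambda>x. ecf n xs (f x))"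
  unfolding ecf_def divide_inverse by (intro continuous_intros)

lemma continuous_ecf_std[continuous_intros]: "continuous_on S f \<Longrightarrow> continuous_on S (\<lambda>x. ecf_std n xs (f x))"
  unfolding ecf_std_eq divide_inverse by (intro continuous_intros)

lemma continuous_Uproc[continuous_intros]: "continuous_on S f \<Longrightarrow> continuous_on S (\<lambda>x. Uproc n xs (f x))"
  unfolding Uproc_def by (intro continuous_intros) auto

lemma measurable_psi0[measurable]: "psi0 \<in> borel_measurable borel"
  unfolding psi0_def by measurable

lemma measurable_wt[measurable]: "wt \<beta> \<in> borel_measurable borel"
  unfolding wt_def by measurable

context
  fixes N :: "'n measure" and f :: "nat \<Rightarrow> 'n \<Rightarrow> real"
  assumes f[measurable]: "\<And>k. f k \<in> borel_measurable N"
begin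

lemma measurable_smean: "(\<lambda>x. smean n (\<lambda>k. f k x)) \<in> borel_measurable N"
  unfolding smean_def by measurable

lemma measurable_ssd: "(\<lambda>x. ssd n (\<lambda>k. f k x)) \<in> borel_measurable N"
  unfolding ssd_def using measurable_smean[measurable] by measurable

context
  fixes t :: "'n \<Rightarrow> real" assumes t[measurable]: "t \<in> borel_measurable N"
begin

lemma measurable_ecf: "(\<lambda>x. ecf n (\<lambda>k. f k x) (t x)) \<in> borel_measurable N"
  unfolding ecf_def by measurable

lemma measurable_ecf_std: "(\<lambda>x. ecf_std n (\<lambda>k. f k x) (t x)) \<in> borel_measurable N"
  unfolding ecf_std_eq std_obs_def using measurable_ssd[measurable] measurable_smean[measurable] by measurable

lemma measurable_Uproc: "(\<lambda>x. Uproc n (\<lambda>k. f k x) (t x)) \<in> borel_measurable N"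
  unfolding Uproc_def using measurable_ecf_std[measurable] by measurable

end

end

text \<open>The delta-method linearization of \<^const>\<open>Uproc\<close>; it is what \<^const>\<open>G0\<close> returns when the limit triple
  is replaced by its empirical counterpart.\<close>
definition lin_proc :: "nat \<Rightarrow> (nat \<Rightarrow> real) \<Rightarrow> real \<Rightarrow> complex" where
  "lin_proc n zs t = complex_of_real (sqrt n) * (ecf n zs t - complex_of_real (psi0 t)
     - \<i> * complex_of_real (t * psi0 t * smean n zs) + complex_of_real (t\<^sup>2 * psi0 t * (ssd n zs - 1)))"

lemma continuous_lin_proc[continuous_intros]: "continuous_on S f \<Longrightarrow> continuous_on S (\<lambda>x. lin_proc n xs (f x))"
  unfolding lin_proc_def by (intro continuous_intros) auto

lemma measurable_lin_proc:
  assumes [measurable]: "\<And>k. f k \<in> borel_measurable N" "t \<in> borel_measurable N"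
  shows "(\<lambda>x. lin_proc n (\<lambda>k. f k x) (t x)) \<in> borel_measurable N"
proof -
  note [measurable] = measurable_ecf[of f N t n] measurable_ssd[of f N n] measurable_smean[of f N n]
  show ?thesis unfolding lin_proc_def by measurable
qed

section \<open>Moment bounds for the empirical processes of a normal sample\<close>

context std_normal_sample
begin

abbreviation Zs :: "'a \<Rightarrow> nat \<Rightarrow> real" where
  "Zs x \<equiv> \<lambda>k. Z k x"

lemma measurable_sample[measurable]:
  "(\<lambda>x. smean n (Zs x)) \<in> borel_measurable M"
  "(\<lambda>x. ssd n (Zs x)) \<in> borel_measurable M"
  "(\<lambda>x. std_defect n (Zs x)) \<in> borel_measurable M"
  "(\<lambda>x. ecf n (Zs x) t) \<in> borel_measurable M"
  "(\<lambda>x. ecf_std n (Zs x) t) \<in> borel_measurable M"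
  "(\<lambda>x. Uproc n (Zs x) t) \<in> borel_measurable M"
  "(\<lambda>x. lin_proc n (Zs x) t) \<in> borel_measurable M"
proof -
  show [measurable]: "(\<lambda>x. smean n (Zs x)) \<in> borel_measurable M" "(\<lambda>x. ssd n (Zs x)) \<in> borel_measurable M"
    by (intro measurable_smean measurable_ssd measurable_Z)+
  show "(\<lambda>x. std_defect n (Zs x)) \<in> borel_measurable M"
    unfolding std_defect_def by measurable
qed (intro measurable_ecf measurable_ecf_std measurable_Uproc measurable_lin_proc measurable_Z measurable_const; simp)+

lemma process_bounded_ecf:
  "process_bounded T (\<lambda>n t x. sqrt n * cmod (ecf n (Zs x) t - complex_of_real (psi0 t)))"
proof (rule process_bounded_dom[OF process_bounded_avg[where C = 2, OF _ _ has_bochner_integral_iexp_minus_psi0]])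
  show "cmod (iexp (t * z) - complex_of_real (psi0 t)) \<le> 2 * (z\<^sup>2 + 1)" for t z
  proof -
    have "cmod (iexp (t * z) - complex_of_real (psi0 t)) \<le> 2"
      using norm_triangle_ineq4[of "iexp (t * z)" "complex_of_real (psi0 t)"] psi0_le_1[of t] psi0_pos[of t] by simp
    then show ?thesis using zero_le_power2[of z] unfolding distrib_left by linarith
  qed
  show "sqrt n * cmod (ecf n (Zs x) t - complex_of_real (psi0 t)) \<le> sqrt n * cmod ((\<Sum>k<n. iexp (t * Z k x) - complex_of_real (psi0 t)) / n)"
    if "n \<ge> 1" for n t x
    using that by (simp add: ecf_def sum_subtractf diff_divide_distrib)
qed auto

lemma process_bounded_decf:
  assumes T: "T > 0"
  shows "process_bounded T (\<lambda>n t x. sqrt n * cmod ((\<Sum>k<n. complex_of_real (Z k x) * iexp (t * Z k x)) / of_nat n - \<i> * complex_of_real (t * psi0 t)))"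
proof (rule process_bounded_dom[OF process_bounded_avg[where C = "1 + T", OF _ _ has_bochner_integral_id_iexp]])
  fix t z :: real assume t: "\<bar>t\<bar> \<le> T"
  have "\<bar>t * psi0 t\<bar> \<le> T * (z\<^sup>2 + 1)"
    unfolding abs_mult using psi0_le_1[of t] psi0_pos[of t] t T by (intro mult_mono) (auto intro: order_trans[of _ 1])
  moreover have "cmod (complex_of_real z * iexp (t * z) - \<i> * complex_of_real (t * psi0 t)) \<le> \<bar>z\<bar> + \<bar>t * psi0 t\<bar>"
    by (rule order_trans[OF norm_triangle_ineq4]) (simp add: norm_mult)
  ultimately have "cmod (complex_of_real z * iexp (t * z) - \<i> * complex_of_real (t * psi0 t)) \<le> (z\<^sup>2 + 1) + T * (z\<^sup>2 + 1)"
    using abs_le_square_plus_one[of z] by (meson add_mono order_trans)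
  then show "cmod (complex_of_real z * iexp (t * z) - \<i> * complex_of_real (t * psi0 t)) \<le> (1 + T) * (z\<^sup>2 + 1)"
    by (simp add: distrib_right)
next
  fix n :: nat and t x assume "n \<ge> 1"
  then show "sqrt n * cmod ((\<Sum>k<n. complex_of_real (Z k x) * iexp (t * Z k x)) / of_nat n - \<i> * complex_of_real (t * psi0 t))
    \<le> sqrt n * cmod ((\<Sum>k<n. complex_of_real (Z k x) * iexp (t * Z k x) - \<i> * complex_of_real (t * psi0 t)) / n)"
    by (simp add: sum_subtractf diff_divide_distrib)
qed (use T in auto)

text \<open>The index \<open>t\<close> is a dummy that lets this quantity be multiplied with genuine
  processes. The standard deviation is reduced to the averages of \<open>z\<^sup>2 - 1\<close> and
  of \<open>z\<close>, both centred.\<close>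

lemma process_bounded_std_defect: "process_bounded T (\<lambda>n t x. sqrt n * std_defect n (Zs x))"
proof -
  have q: "process_bounded T (\<lambda>n t x. sqrt n * \<bar>(\<Sum>k<n. (Z k x)\<^sup>2 - 1) / n\<bar>)"
  proof (rule process_bounded_avg_real[where y = "\<lambda>t z. z\<^sup>2 - 1" and C = 1])
    show "(\<integral>z. z\<^sup>2 - 1 \<partial>std_normal_distribution) = 0"
      using std_normal_distribution_even_moments(1)[of 1] integrable_std_normal_distribution_moment[of 2]
      by (subst Bochner_Integration.integral_diff) (simp_all only: integrable_const_std_normal, simp)
  qed (auto simp: abs_le_iff)
  have a: "process_bounded T (\<lambda>n t x. sqrt n * \<bar>smean n (Zs x)\<bar>)"
    unfolding smean_def
  proof (rule process_bounded_avg_real[where y = "\<lambda>t z. z" and C = 1])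
    show "(\<integral>z. z \<partial>std_normal_distribution) = 0"
      using integral_std_normal_distribution_moment_odd[of 1] by simp
  qed (auto simp: abs_le_square_plus_one)
  show ?thesis
  proof (rule process_bounded_dom[OF moments_bounded_add[OF moments_bounded_add[OF q moments_bounded_mult[OF a a]] a]])
    fix n :: nat and x assume n: "n \<ge> 1"
    let ?a = "smean n (Zs x)" and ?q = "\<bar>(\<Sum>k<n. (Z k x)\<^sup>2 - 1) / n\<bar>"
    have "sqrt n * std_defect n (Zs x) \<le> sqrt n * (?q + ?a\<^sup>2 + \<bar>?a\<bar>)"
      using abs_ssd_minus_one_le[OF n, of "Zs x"] by (intro mult_left_mono) (auto simp: std_defect_def)
    \<comment> \<open>The left side is in fact of order \<open>1 / sqrt n\<close>; the larger
      product is already known to have bounded moments.\<close>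
    moreover have "sqrt n * ?a\<^sup>2 \<le> (sqrt n * \<bar>?a\<bar>) * (sqrt n * \<bar>?a\<bar>)"
    proof -
      have "sqrt n * 1 \<le> sqrt n * sqrt n" using n by (intro mult_left_mono) auto
      then have "(sqrt n * 1) * (\<bar>?a\<bar> * \<bar>?a\<bar>) \<le> (sqrt n * sqrt n) * (\<bar>?a\<bar> * \<bar>?a\<bar>)" by (intro mult_right_mono) auto
      then show ?thesis by (simp only: power2_eq_square abs_mult_self_eq mult_ac mult_1_right)
    qed
    ultimately show "sqrt n * std_defect n (Zs x) \<le> sqrt n * ?q + (sqrt n * \<bar>?a\<bar>) * (sqrt n * \<bar>?a\<bar>) + sqrt n * \<bar>?a\<bar>"
      unfolding distrib_left by linarith
  qed (auto simp: std_defect_nonneg)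
qed

lemma process_bounded_Uproc:
  assumes T: "T > 0"
  shows "process_bounded T (\<lambda>n t x. cmod (Uproc n (Zs x) t))"
proof (rule process_bounded_dom[OF moments_bounded_add[OF process_bounded_ecf moments_bounded_cmult[OF process_bounded_std_defect, of T T]]])
  fix n t x assume n: "(n::nat) \<ge> 1" and t: "\<bar>t\<bar> \<le> T"
  have "cmod (ecf_std n (Zs x) t - complex_of_real (psi0 t)) \<le> cmod (ecf n (Zs x) t - complex_of_real (psi0 t)) + T * std_defect n (Zs x)"
    using ecf_std_minus_ecf_le[OF n, of "Zs x" t] mult_right_mono[OF t std_defect_nonneg[of n "Zs x"]]
      norm_triangle_ineq[of "ecf_std n (Zs x) t - ecf n (Zs x) t" "ecf n (Zs x) t - complex_of_real (psi0 t)"] by simp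
  from mult_left_mono[OF this, of "sqrt n"]
  show "cmod (Uproc n (Zs x) t) \<le> sqrt n * cmod (ecf n (Zs x) t - complex_of_real (psi0 t)) + T * (sqrt n * std_defect n (Zs x))"
    by (simp add: Uproc_def norm_mult distrib_left mult_ac)
qed auto

text \<open>The error in \<open>Uproc\<close> is \<open>sqrt n\<close> times a product of two
  quantities of order \<open>1 / sqrt n\<close>. One more factor \<open>sqrt n\<close> gives each of
  the two its own normalization.\<close>

lemma process_bounded_linearization:
  assumes T: "T > 0"
  shows "process_bounded T (\<lambda>n t x. sqrt n * cmod (Uproc n (Zs x) t - lin_proc n (Zs x) t))"
proof (rule process_bounded_dom[OF moments_bounded_cmult[OF moments_bounded_mult[OF process_bounded_std_defect
    moments_bounded_add[OF moments_bounded_add[OF process_bounded_std_defect process_bounded_ecf] process_bounded_decf[OF T]]], of "3 * (1 + T)\<^sup>2"]])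
  fix n t x assume n: "(n::nat) \<ge> 1" and t: "\<bar>t\<bar> \<le> T"
  let ?D = "std_defect n (Zs x)" and ?E0 = "cmod (ecf n (Zs x) t - complex_of_real (psi0 t))"
    and ?E1 = "cmod ((\<Sum>k<n. complex_of_real (Z k x) * iexp (t * Z k x)) / of_nat n - \<i> * complex_of_real (t * psi0 t))"
  let ?R = "ecf_std n (Zs x) t - ecf n (Zs x) t + \<i> * complex_of_real (t * psi0 t * smean n (Zs x)) - complex_of_real (t\<^sup>2 * psi0 t * (ssd n (Zs x) - 1))"
  have "Uproc n (Zs x) t - lin_proc n (Zs x) t = complex_of_real (sqrt n) * ?R"
    by (simp add: Uproc_def lin_proc_def algebra_simps)
  then have "sqrt n * cmod (Uproc n (Zs x) t - lin_proc n (Zs x) t) = n * cmod ?R"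
    by (simp only: norm_mult) simp
  also have "\<dots> \<le> n * (3 * (1 + \<bar>t\<bar>)\<^sup>2 * (?D * (?D + ?E0 + ?E1)))"
    by (intro mult_left_mono ecf_std_linearization n) simp
  also have "\<dots> \<le> n * (3 * (1 + T)\<^sup>2 * (?D * (?D + ?E0 + ?E1)))"
    using t std_defect_nonneg[of n "Zs x"] by (intro mult_left_mono mult_right_mono power_mono) auto
  also have "\<dots> = 3 * (1 + T)\<^sup>2 * ((sqrt n * ?D) * (sqrt n * ?D + sqrt n * ?E0 + sqrt n * ?E1))"
  proof -
    have "real n * (C * (D * (D + E0 + E1))) = C * ((sqrt n * D) * (sqrt n * D + sqrt n * E0 + sqrt n * E1))" for C D E0 E1
      by (simp add: algebra_simps flip: real_sqrt_mult_self[of n])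
    then show ?thesis .
  qed
  finally show "sqrt n * cmod (Uproc n (Zs x) t - lin_proc n (Zs x) t) \<le> 3 * (1 + T)\<^sup>2 * ((sqrt n * ?D) * (sqrt n * ?D + sqrt n * ?E0 + sqrt n * ?E1))" .
qed auto

lemma process_bounded_lin_proc:
  assumes T: "T > 0"
  shows "process_bounded T (\<lambda>n t x. cmod (lin_proc n (Zs x) t))"
proof (rule process_bounded_dom[OF moments_bounded_add[OF process_bounded_Uproc[OF T] process_bounded_linearization[OF T]]])
  fix n t x assume n: "(n::nat) \<ge> 1"
  let ?U = "Uproc n (Zs x) t" and ?G = "lin_proc n (Zs x) t"
  have "cmod ?G \<le> cmod ?U + 1 * cmod (?U - ?G)"
    using norm_triangle_ineq4[of ?U "?U - ?G"] by simp
  also have "\<dots> \<le> cmod ?U + sqrt n * cmod (?U - ?G)"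
    using n by (intro add_left_mono mult_right_mono) auto
  finally show "cmod ?G \<le> cmod ?U + sqrt n * cmod (?U - ?G)" .
qed auto

end

subsection \<open>Weighted quadratic functionals\<close>

text \<open>A weighted squared \<open>L^2\<close> norm. Both \<open>Qgen\<close> and
  \<open>n * Deltam\<close> have this form, so comparing the statistics reduces to comparing the
  functions under the norm.\<close>

definition wint :: "real \<Rightarrow> real \<Rightarrow> (real \<Rightarrow> complex) \<Rightarrow> real" where
  "wint T \<beta> a = integral {-T..T} (\<lambda>t. wt \<beta> t * (cmod (a t))\<^sup>2)"

lemma Qgen_eq_wint: "Qgen T \<beta> V m = wint T \<beta> (\<lambda>t. complex_of_real (psi0 t) * Hgen V m t)"
  by (simp add: Qgen_def wint_def norm_mult power_mult_distrib mult.assoc)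

lemma Deltam_eq_wint: "real n * Deltam T \<beta> n xs m = wint T \<beta> (\<lambda>t. complex_of_real (sqrt n) * Dm n xs m t)"
proof -
  have "real n * Deltam T \<beta> n xs m = integral {-T..T} (\<lambda>t. real n * (wt \<beta> t * (cmod (Dm n xs m t))\<^sup>2))"
    by (simp add: Deltam_def)
  also have "\<dots> = wint T \<beta> (\<lambda>t. complex_of_real (sqrt n) * Dm n xs m t)"
    by (simp add: wint_def norm_mult power_mult_distrib mult_ac)
  finally show ?thesis .
qed

text \<open>The gauge integrals in the definitions are transferred to this finite measure, where
  Jensen's inequality and Fubini's theorem are at hand.\<close>

abbreviation Leb :: "real \<Rightarrow> real measure" where
  "Leb T \<equiv> restrict_space lborel {-T..T}"

lemma finite_measure_Leb: "finite_measure (Leb T)"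
  by (rule finite_measureI) (simp add: emeasure_restrict_space space_restrict_space emeasure_lborel_Icc_eq)

lemma integrable_Leb:
  fixes f :: "real \<Rightarrow> 'c::{banach, second_countable_topology}"
  shows "continuous_on {-T..T} f \<Longrightarrow> integrable (Leb T) f"
  using borel_integrable_atLeastAtMost'[of "-T" T f] by (simp add: integrable_restrict_space set_integrable_def)

lemma integral_Leb:
  fixes f :: "real \<Rightarrow> 'c::euclidean_space"
  shows "continuous_on {-T..T} f \<Longrightarrow> integral {-T..T} f = (\<integral>t. f t \<partial>Leb T)"
  using set_borel_integral_eq_integral(2)[OF borel_integrable_atLeastAtMost'[of "-T" T f]]
  by (simp add: integral_restrict_space set_lebesgue_integral_def)

lemma wint_eq_Leb: "continuous_on {-T..T} a \<Longrightarrow> wint T \<beta> a = (\<integral>t. wt \<beta> t * (cmod (a t))\<^sup>2 \<partial>Leb T)"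
  unfolding wint_def by (rule integral_Leb) (intro continuous_intros)

lemma wint_nonneg: "0 \<le> wint T \<beta> a"
proof -
  have "0 \<le> integral {-T..T} (\<lambda>t. wt \<beta> t * (cmod (a t))\<^sup>2)"
  proof (cases "(\<lambda>t. wt \<beta> t * (cmod (a t))\<^sup>2) integrable_on {-T..T}")
    case True
    then show ?thesis by (rule integral_nonneg) (simp add: wt_def)
  qed (simp add: not_integrable_integral)
  then show ?thesis by (simp add: wint_def)
qed

lemma wt_bounds: "\<beta> \<ge> 0 \<Longrightarrow> 0 \<le> wt \<beta> t \<and> wt \<beta> t \<le> 1"
  by (simp add: wt_def)

text \<open>A difference of squares is a difference times a sum, and the weight is at most 1.
  Closeness of order \<open>1 / sqrt n\<close> of the functions is therefore inherited by the
  statistics.\<close>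

lemma wint_diff_le_integral:
  assumes \<beta>: "\<beta> \<ge> 0" and a: "continuous_on {-T..T} a" and b: "continuous_on {-T..T} b"
  shows "\<bar>wint T \<beta> b - wint T \<beta> a\<bar> \<le> (\<integral>t. cmod (b t - a t) * (cmod (a t) + cmod (b t)) \<partial>Leb T)"
proof -
  have c: "continuous_on {-T..T} (\<lambda>t. wt \<beta> t * (cmod (a t))\<^sup>2)" "continuous_on {-T..T} (\<lambda>t. wt \<beta> t * (cmod (b t))\<^sup>2)"
    by (intro continuous_intros a b)+
  have "wint T \<beta> b - wint T \<beta> a = (\<integral>t. wt \<beta> t * (cmod (b t))\<^sup>2 - wt \<beta> t * (cmod (a t))\<^sup>2 \<partial>Leb T)"
    unfolding wint_eq_Leb[OF a] wint_eq_Leb[OF b]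
    by (intro Bochner_Integration.integral_diff[symmetric] integrable_Leb c)
  then have "\<bar>wint T \<beta> b - wint T \<beta> a\<bar> \<le> (\<integral>t. \<bar>wt \<beta> t * (cmod (b t))\<^sup>2 - wt \<beta> t * (cmod (a t))\<^sup>2\<bar> \<partial>Leb T)"
    by (simp only: integral_abs_bound)
  also have "\<dots> \<le> (\<integral>t. cmod (b t - a t) * (cmod (a t) + cmod (b t)) \<partial>Leb T)"
  proof (rule integral_mono)
    show "integrable (Leb T) (\<lambda>t. \<bar>wt \<beta> t * (cmod (b t))\<^sup>2 - wt \<beta> t * (cmod (a t))\<^sup>2\<bar>)"
      by (intro integrable_abs Bochner_Integration.integrable_diff integrable_Leb c)
    show "integrable (Leb T) (\<lambda>t. cmod (b t - a t) * (cmod (a t) + cmod (b t)))"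
      by (intro integrable_Leb continuous_intros a b)
    fix t
    have "wt \<beta> t * (cmod (b t))\<^sup>2 - wt \<beta> t * (cmod (a t))\<^sup>2 = wt \<beta> t * ((cmod (b t) - cmod (a t)) * (cmod (a t) + cmod (b t)))"
      by (simp add: power2_eq_square algebra_simps)
    then have "\<bar>wt \<beta> t * (cmod (b t))\<^sup>2 - wt \<beta> t * (cmod (a t))\<^sup>2\<bar> = wt \<beta> t * (\<bar>cmod (b t) - cmod (a t)\<bar> * (cmod (a t) + cmod (b t)))"
      using wt_bounds[OF \<beta>, of t] by (simp add: abs_mult)
    also have "\<dots> \<le> 1 * (cmod (b t - a t) * (cmod (a t) + cmod (b t)))"
      using wt_bounds[OF \<beta>, of t] norm_triangle_ineq3[of "b t" "a t"] by (intro mult_mono) auto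
    finally show "\<bar>wt \<beta> t * (cmod (b t))\<^sup>2 - wt \<beta> t * (cmod (a t))\<^sup>2\<bar> \<le> cmod (b t - a t) * (cmod (a t) + cmod (b t))"
      by simp
  qed
  finally show ?thesis .
qed

lemma measurable_pair_Leb:
  "f \<in> borel_measurable (M \<Otimes>\<^sub>M lborel) \<Longrightarrow> f \<in> borel_measurable (M \<Otimes>\<^sub>M Leb T)"
proof -
  assume f: "f \<in> borel_measurable (M \<Otimes>\<^sub>M lborel)"
  have "(\<lambda>p. (fst p, snd p)) \<in> measurable (M \<Otimes>\<^sub>M Leb T) (M \<Otimes>\<^sub>M lborel)"
    by (intro measurable_Pair measurable_fst measurable_compose[OF measurable_snd] measurable_restrict_space1) simp
  from measurable_compose[OF this f] show ?thesis by simp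
qed

context prob_space
begin

lemma measurable_wint:
  assumes meas: "(\<lambda>p. a (fst p) (snd p)) \<in> borel_measurable (M \<Otimes>\<^sub>M lborel)"
    and cont: "\<And>x. continuous_on {-T..T} (a x)"
  shows "(\<lambda>x. wint T \<beta> (a x)) \<in> borel_measurable M"
proof -
  interpret L: finite_measure "Leb T" by (rule finite_measure_Leb)
  have [measurable]: "(\<lambda>p. a (fst p) (snd p)) \<in> borel_measurable (M \<Otimes>\<^sub>M Leb T)"
    by (rule measurable_pair_Leb) fact
  have [measurable]: "wt \<beta> \<in> borel_measurable (Leb T)"
    by (rule measurable_restrict_space1) simp
  have "(\<lambda>p. wt \<beta> (snd p) * (cmod (a (fst p) (snd p)))\<^sup>2) \<in> borel_measurable (M \<Otimes>\<^sub>M Leb T)"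
    by measurable
  then have "(\<lambda>x. \<integral>t. wt \<beta> t * (cmod (a x t))\<^sup>2 \<partial>Leb T) \<in> borel_measurable M"
    by (intro L.borel_measurable_lebesgue_integral) (simp add: split_beta')
  then show ?thesis
    by (simp add: wint_eq_Leb[OF cont])
qed

lemma moments_bounded_Leb_integral:
  assumes mb: "process_bounded T F"
    and meas: "\<And>n. (\<lambda>p. F n (snd p) (fst p)) \<in> borel_measurable (M \<Otimes>\<^sub>M lborel)"
    and cont: "\<And>n x. continuous_on {-T..T} (\<lambda>t. F n t x)"
    and nn: "\<And>n t x. 0 \<le> F n t x"
  shows "moments_bounded {1..} (\<lambda>n x. \<integral>t. F n t x \<partial>Leb T)"
proof -
  have "moments_bounded {1..} (\<lambda>n x. \<integral>t. F (fst (n, t)) (snd (n, t)) x \<partial>Leb T)"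
  proof (rule moments_bounded_integral[OF finite_measure_Leb])
    show "moments_bounded ({1..} \<times> space (Leb T)) (\<lambda>j. F (fst j) (snd j))"
      using mb by (simp add: space_restrict_space)
    show "(\<lambda>(x, t). F (fst (n, t)) (snd (n, t)) x) \<in> borel_measurable (M \<Otimes>\<^sub>M Leb T)" for n
      using measurable_pair_Leb[OF meas] by (simp add: split_beta')
    show "integrable (Leb T) (\<lambda>t. F (fst (n, t)) (snd (n, t)) x ^ p)" for n x p
      by (simp, intro integrable_Leb continuous_intros cont)
  qed (use nn in auto)
  then show ?thesis by simp
qed

lemma moments_bounded_wint:
  assumes \<beta>: "\<beta> \<ge> 0" and mb: "process_bounded T (\<lambda>n t x. cmod (a n x t))"
    and meas: "\<And>n. (\<lambda>p. a n (fst p) (snd p)) \<in> borel_measurable (M \<Otimes>\<^sub>M lborel)"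
    and cont: "\<And>n x. continuous_on {-T..T} (a n x)"
  shows "moments_bounded {1..} (\<lambda>n x. wint T \<beta> (a n x))"
proof -
  note [measurable] = meas
  have "(\<lambda>x. a n x t) \<in> borel_measurable M" for n t
    using measurable_compose[OF measurable_Pair2'[of t lborel M] meas[of n]] by simp
  then have "process_bounded T (\<lambda>n t x. wt \<beta> t * (cmod (a n x t))\<^sup>2)"
    using wt_bounds[OF \<beta>]
    by (intro process_bounded_dom[OF moments_bounded_mult[OF mb mb]])
       (auto simp: power2_eq_square intro!: mult_left_le_one_le)
  then have "moments_bounded {1..} (\<lambda>n x. \<integral>t. wt \<beta> t * (cmod (a n x t))\<^sup>2 \<partial>Leb T)"
    using wt_bounds[OF \<beta>] by (intro moments_bounded_Leb_integral) (auto intro!: continuous_intros cont)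
  then show ?thesis
    by (simp add: wint_eq_Leb[OF cont])
qed

lemma moments_bounded_wint_diff:
  assumes \<beta>: "\<beta> \<ge> 0" and T: "T > 0"
    and mba: "process_bounded T (\<lambda>n t x. cmod (a n x t))" and mbb: "process_bounded T (\<lambda>n t x. cmod (b n x t))"
    and mbd: "process_bounded T (\<lambda>n t x. sqrt n * cmod (b n x t - a n x t))"
    and meas: "\<And>n. (\<lambda>p. a n (fst p) (snd p)) \<in> borel_measurable (M \<Otimes>\<^sub>M lborel)"
      "\<And>n. (\<lambda>p. b n (fst p) (snd p)) \<in> borel_measurable (M \<Otimes>\<^sub>M lborel)"
    and cont: "\<And>n x. continuous_on {-T..T} (a n x)" "\<And>n x. continuous_on {-T..T} (b n x)"
  shows "moments_bounded {1..} (\<lambda>n x. sqrt n * (wint T \<beta> (b n x) - wint T \<beta> (a n x)))"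
proof -
  note [measurable] = meas
  let ?F = "\<lambda>n t x. sqrt (real n) * cmod (b n x t - a n x t) * (cmod (a n x t) + cmod (b n x t))"
  have contF: "continuous_on {-T..T} (\<lambda>t. ?F n t x)" for n x
    by (intro continuous_intros cont)
  have "moments_bounded {1..} (\<lambda>n x. \<integral>t. ?F n t x \<partial>Leb T)"
    by (rule moments_bounded_Leb_integral[OF moments_bounded_mult[OF mbd moments_bounded_add[OF mba mbb]] _ contF]) auto
  then show ?thesis
  proof (rule moments_bounded_dom)
    fix n x
    note [measurable] = measurable_wint[OF meas(1)[of n] cont(1)[of n], of \<beta>] measurable_wint[OF meas(2)[of n] cont(2)[of n], of \<beta>]
    show "(\<lambda>x. sqrt n * (wint T \<beta> (b n x) - wint T \<beta> (a n x))) \<in> borel_measurable M" by measurable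
    have "\<bar>wint T \<beta> (b n x) - wint T \<beta> (a n x)\<bar> \<le> (\<integral>t. cmod (b n x t - a n x t) * (cmod (a n x t) + cmod (b n x t)) \<partial>Leb T)"
      by (rule wint_diff_le_integral[OF \<beta> cont(1,2)])
    from mult_left_mono[OF this, of "sqrt n"]
    have "\<bar>sqrt n * (wint T \<beta> (b n x) - wint T \<beta> (a n x))\<bar> \<le> (\<integral>t. ?F n t x \<partial>Leb T)"
      by (simp add: abs_mult mult.assoc)
    then show "\<bar>sqrt n * (wint T \<beta> (b n x) - wint T \<beta> (a n x))\<bar> \<le> \<bar>\<integral>t. ?F n t x \<partial>Leb T\<bar>"
      by (rule order_trans[OF _ abs_ge_self])
  qed
qed

end

section \<open>Rescaled arguments and expansion of powers\<close>

lemma scale_mem: "m \<ge> 1 \<Longrightarrow> t \<in> {-T..T} \<Longrightarrow> t / sqrt (real m) \<in> {-T..T::real}"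
proof -
  assume m: "m \<ge> 1" and t: "t \<in> {-T..T}"
  have "\<bar>t / sqrt (real m)\<bar> \<le> \<bar>t\<bar>"
    using m mult_left_mono[of 1 "sqrt (real m)" "\<bar>t\<bar>"] by (simp add: abs_divide divide_le_eq)
  also have "\<bar>t\<bar> \<le> T"
    using t by (simp add: abs_le_iff)
  finally have "\<bar>t / sqrt (real m)\<bar> \<le> T" .
  then have "t / sqrt (real m) \<le> T" "- (t / sqrt (real m)) \<le> T"
    by (simp_all only: abs_le_iff)
  then show ?thesis
    unfolding atLeastAtMost_iff by (intro conjI) linarith+
qed

text \<open>Stability of the normal law under normalized sums: all \<open>Sm\<close> have the same
  limit \<open>psi0 t\<close>, so the leading terms cancel in \<open>Dm\<close>.\<close>

lemma psi0_scale: "m \<ge> 1 \<Longrightarrow> psi0 (t / sqrt (real m)) ^ m = psi0 t"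
  by (simp add: psi0_def power_divide field_simps flip: exp_of_nat_mult)

lemma psi0_le_scale: "m \<ge> 1 \<Longrightarrow> psi0 t \<le> psi0 (t / sqrt (real m))"
  using mult_left_mono[of 1 "real m" "t\<^sup>2"] by (simp add: psi0_def power_divide divide_le_eq)

lemma Hgen_diff: "Hgen V m t - Hgen V' m t = Hgen (\<lambda>s. V s - V' s) m t"
  by (simp add: Hgen_def algebra_simps diff_divide_distrib)

text \<open>The quotients in \<open>Hgen\<close> are harmless once multiplied by
  \<open>psi0 t\<close>: \<open>psi0\<close> decreases away from 0, and both scaled arguments are at
  most as far from 0 as \<open>t\<close>.\<close>

lemma psi0_Hgen_le:
  assumes "m \<ge> 1"
  shows "cmod (complex_of_real (psi0 t) * Hgen V m t) \<le> real (m + 1) * (cmod (V (t / sqrt (real (m + 1)))) + cmod (V (t / sqrt (real m))))"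
proof -
  have r: "psi0 t * (real k * c / psi0 (t / sqrt (real k))) \<le> real (m + 1) * c" if "k \<ge> 1" "k \<le> m + 1" "c \<ge> 0" for k :: nat and c :: real
  proof -
    have "psi0 t / psi0 (t / sqrt (real k)) \<le> 1"
      using psi0_le_scale[OF that(1), of t] psi0_pos[of "t / sqrt (real k)"] by simp
    then have "(psi0 t / psi0 (t / sqrt (real k))) * (real k * c) \<le> 1 * (real (m + 1) * c)"
      using that psi0_pos[of t] psi0_pos[of "t / sqrt (real k)"] by (intro mult_mono) (auto intro!: mult_right_mono)
    then show ?thesis by simp
  qed
  have "cmod (Hgen V m t) \<le> real (m + 1) * cmod (V (t / sqrt (real (m + 1)))) / psi0 (t / sqrt (real (m + 1)))
     + real m * cmod (V (t / sqrt (real m))) / psi0 (t / sqrt (real m))"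
    unfolding Hgen_def using psi0_pos
    by (intro order_trans[OF norm_triangle_ineq4]) (simp add: norm_mult norm_divide abs_of_pos del: of_nat_add of_nat_Suc)
  then have "cmod (complex_of_real (psi0 t) * Hgen V m t) \<le> psi0 t * (real (m + 1) * cmod (V (t / sqrt (real (m + 1)))) / psi0 (t / sqrt (real (m + 1)))
     + real m * cmod (V (t / sqrt (real m))) / psi0 (t / sqrt (real m)))"
    using psi0_pos[of t] by (simp add: norm_mult abs_of_pos)
  also have "\<dots> \<le> real (m + 1) * cmod (V (t / sqrt (real (m + 1)))) + real (m + 1) * cmod (V (t / sqrt (real m)))"
    unfolding distrib_left using assms by (intro add_mono r) auto
  finally show ?thesis unfolding distrib_left .
qed

text \<open>The remainders satisfy
  \<open>r (Suc m) = a * r m + Suc m * b ^ m * (a - b)\<^sup>2\<close>. As \<open>a\<close> and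
  \<open>b\<close> lie in the unit disc, the coefficients merely add up and stay below the stated
  square.\<close>

lemma norm_power_taylor1_le:
  fixes a b :: complex
  assumes "cmod a \<le> 1" "cmod b \<le> 1"
  shows "cmod (a ^ Suc m - b ^ Suc m - of_nat (Suc m) * b ^ m * (a - b)) \<le> (real (Suc m))\<^sup>2 * (cmod (a - b))\<^sup>2"
proof (induction m)
  case (Suc m)
  let ?r = "\<lambda>m. a ^ Suc m - b ^ Suc m - of_nat (Suc m) * b ^ m * (a - b)"
  have "?r (Suc m) = a * ?r m + of_nat (Suc m) * b ^ m * (a - b)\<^sup>2"
    by (simp add: algebra_simps power2_eq_square)
  also have "cmod \<dots> \<le> cmod a * cmod (?r m) + real (Suc m) * cmod b ^ m * (cmod (a - b))\<^sup>2"
    by (rule order_trans[OF norm_triangle_ineq]) (simp add: norm_mult norm_power del: of_nat_Suc)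
  also have "\<dots> \<le> 1 * ((real (Suc m))\<^sup>2 * (cmod (a - b))\<^sup>2) + real (Suc m) * 1 * (cmod (a - b))\<^sup>2"
    using assms by (intro add_mono mult_mono Suc.IH mult_left_mono mult_right_mono power_le_one) auto
  also have "\<dots> = ((real (Suc m))\<^sup>2 + real (Suc m)) * (cmod (a - b))\<^sup>2"
    by (simp add: algebra_simps)
  also have "\<dots> \<le> (real (Suc (Suc m)))\<^sup>2 * (cmod (a - b))\<^sup>2"
    by (intro mult_right_mono) (simp_all add: power2_eq_square algebra_simps)
  finally show ?case .
qed simp

text \<open>The derivative of the power contributes \<open>m * psi0 s ^ (m - 1)\<close>, which is
  \<open>m * psi0 t / psi0 s\<close> because \<open>psi0 s ^ m = psi0 t\<close>; this is the origin
  of the quotients in \<open>Hgen\<close>. The quadratic remainder is \<open>sqrt n\<close> times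
  the square of \<open>Uproc / sqrt n\<close>, so a further \<open>sqrt n\<close> leaves the square
  of \<open>Uproc\<close>.\<close>

lemma Sm_linearization:
  fixes t :: real
  assumes n: "n \<ge> 1" and m: "m \<ge> 1"
  defines "s \<equiv> t / sqrt (real m)"
  shows "sqrt n * cmod (complex_of_real (sqrt n) * (Sm n xs m t - complex_of_real (psi0 t))
     - complex_of_real (psi0 t) * (of_nat m * Uproc n xs s / complex_of_real (psi0 s))) \<le> (real m)\<^sup>2 * (cmod (Uproc n xs s))\<^sup>2"
proof -
  obtain k where k: "m = Suc k" using m by (cases m) auto
  define a where "a = ecf_std n xs s"
  define b where "b = complex_of_real (psi0 s)"
  have U: "Uproc n xs s = complex_of_real (sqrt n) * (a - b)"
    by (simp add: Uproc_def a_def b_def)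
  have b0: "b \<noteq> 0" using psi0_pos[of s] by (simp add: b_def)
  have bm: "complex_of_real (psi0 t) = b ^ Suc k"
    using psi0_scale[OF m, of t] unfolding b_def s_def k by (metis of_real_power)
  have "complex_of_real (sqrt n) * (Sm n xs m t - complex_of_real (psi0 t)) - complex_of_real (psi0 t) * (of_nat m * Uproc n xs s / b)
     = complex_of_real (sqrt n) * (a ^ Suc k - b ^ Suc k - of_nat (Suc k) * b ^ k * (a - b))"
  proof -
    have "Sm n xs m t = a ^ Suc k"
      by (simp add: Sm_def a_def s_def k)
    then show ?thesis
      unfolding U bm using b0 by (simp add: k field_simps)
  qed
  then have "cmod (complex_of_real (sqrt n) * (Sm n xs m t - complex_of_real (psi0 t)) - complex_of_real (psi0 t) * (of_nat m * Uproc n xs s / b))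
     \<le> sqrt n * ((real (Suc k))\<^sup>2 * (cmod (a - b))\<^sup>2)"
    using norm_power_taylor1_le[of a b k] norm_ecf_std_le[OF n, of xs s] psi0_le_1[of s] psi0_pos[of s]
    by (simp add: norm_mult a_def [symmetric] b_def mult_left_mono del: of_nat_Suc)
  then have "sqrt n * cmod (complex_of_real (sqrt n) * (Sm n xs m t - complex_of_real (psi0 t)) - complex_of_real (psi0 t) * (of_nat m * Uproc n xs s / b))
     \<le> sqrt n * (sqrt n * ((real (Suc k))\<^sup>2 * (cmod (a - b))\<^sup>2))"
    by (rule mult_left_mono) simp
  also have "\<dots> = (real m)\<^sup>2 * (cmod (Uproc n xs s))\<^sup>2"
    by (simp add: U norm_mult power_mult_distrib k)
  finally show ?thesis by (simp add: b_def)
qed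

lemma sqrt_Dm_linearization:
  assumes n: "n \<ge> 1" and m: "m \<ge> 1"
  shows "sqrt n * cmod (complex_of_real (sqrt n) * Dm n xs m t - complex_of_real (psi0 t) * Hgen (Uproc n xs) m t)
    \<le> (real (m + 1))\<^sup>2 * ((cmod (Uproc n xs (t / sqrt (real (m + 1)))))\<^sup>2 + (cmod (Uproc n xs (t / sqrt (real m))))\<^sup>2)"
proof -
  define A where "A k = complex_of_real (sqrt n) * (Sm n xs k t - complex_of_real (psi0 t))
     - complex_of_real (psi0 t) * (of_nat k * Uproc n xs (t / sqrt (real k)) / complex_of_real (psi0 (t / sqrt (real k))))" for k
  have A: "sqrt n * cmod (A k) \<le> (real k)\<^sup>2 * (cmod (Uproc n xs (t / sqrt (real k))))\<^sup>2" if "k \<ge> 1" for k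
    unfolding A_def by (rule Sm_linearization[OF n that])
  have "complex_of_real (sqrt n) * Dm n xs m t - complex_of_real (psi0 t) * Hgen (Uproc n xs) m t = A (m + 1) - A m"
    by (simp add: A_def Dm_def Hgen_def right_diff_distrib del: of_nat_add of_nat_Suc)
  then have "sqrt n * cmod (complex_of_real (sqrt n) * Dm n xs m t - complex_of_real (psi0 t) * Hgen (Uproc n xs) m t) \<le> sqrt n * (cmod (A (m + 1)) + cmod (A m))"
    using norm_triangle_ineq4[of "A (m + 1)" "A m"] by (simp add: mult_left_mono)
  also have "\<dots> \<le> (real (m + 1))\<^sup>2 * (cmod (Uproc n xs (t / sqrt (real (m + 1)))))\<^sup>2 + (real m)\<^sup>2 * (cmod (Uproc n xs (t / sqrt (real m))))\<^sup>2"
    unfolding distrib_left using m by (intro add_mono A) auto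
  also have "\<dots> \<le> (real (m + 1))\<^sup>2 * (cmod (Uproc n xs (t / sqrt (real (m + 1)))))\<^sup>2 + (real (m + 1))\<^sup>2 * (cmod (Uproc n xs (t / sqrt (real m))))\<^sup>2"
    by (intro add_mono mult_right_mono power_mono) auto
  finally show ?thesis by (simp only: distrib_left)
qed

lemma continuous_Hgen:
  assumes "continuous_on UNIV V"
  shows "continuous_on S (\<lambda>t. Hgen V m t)"
proof -
  have V: "continuous_on S (\<lambda>t. V (t / c))" for c
    unfolding divide_inverse by (rule continuous_on_compose2[OF assms]) (auto intro!: continuous_intros)
  have psi: "continuous_on S (\<lambda>t. complex_of_real (psi0 (t / c)))" for c
    unfolding divide_inverse by (intro continuous_intros)
  have "complex_of_real (psi0 s) \<noteq> 0" for s
    by (simp add: psi0_def)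
  then show ?thesis
    unfolding Hgen_def
    by (intro continuous_on_diff continuous_on_divide continuous_on_mult continuous_on_const V psi ballI)
qed

lemma measurable_Hgen:
  assumes V: "\<And>c. (\<lambda>p. V p (snd p / c)) \<in> borel_measurable (M \<Otimes>\<^sub>M lborel)"
  shows "(\<lambda>p. Hgen (V p) m (snd p)) \<in> borel_measurable (M \<Otimes>\<^sub>M lborel)"
  unfolding Hgen_def using V[measurable] by measurable

section \<open>Moment bounds for the quadratic statistics\<close>

context std_normal_sample
begin

lemma process_bounded_rescale:
  assumes "process_bounded T F" "k \<ge> 1"
  shows "process_bounded T (\<lambda>n t. F n (t / sqrt (real k)))"
  using moments_bounded_reindex[OF assms(1), of "{1..} \<times> {-T..T}" "\<lambda>j. (fst j, snd j / sqrt (real k))"]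
    scale_mem[OF assms(2), of _ T] by auto

lemma process_bounded_psi0_Hgen:
  assumes m: "m \<ge> 1" and V: "process_bounded T (\<lambda>n t x. G n * cmod (V n x t))" and G: "\<And>n. G n \<ge> 0"
    and meas: "\<And>n t. (\<lambda>x. V n x t) \<in> borel_measurable M"
  shows "process_bounded T (\<lambda>n t x. G n * cmod (complex_of_real (psi0 t) * Hgen (V n x) m t))"
proof (rule process_bounded_dom[OF moments_bounded_cmult[OF moments_bounded_add[OF process_bounded_rescale[OF V, of "m + 1"] process_bounded_rescale[OF V m]], of "real (m + 1)"]])
  fix n t x
  note [measurable] = meas
  show "(\<lambda>x. G n * cmod (complex_of_real (psi0 t) * Hgen (V n x) m t)) \<in> borel_measurable M"
    unfolding Hgen_def by measurable
  show "G n * cmod (complex_of_real (psi0 t) * Hgen (V n x) m t)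
    \<le> real (m + 1) * (G n * cmod (V n x (t / sqrt (real (m + 1)))) + G n * cmod (V n x (t / sqrt (real m))))"
    using mult_left_mono[OF psi0_Hgen_le[OF m, of t "V n x"] G[of n]] by (simp only: distrib_left mult_ac)
qed (use G in auto)

lemma process_bounded_Dm:
  assumes m: "m \<ge> 1" and T: "T > 0"
  shows "process_bounded T (\<lambda>n t x. sqrt n * cmod (complex_of_real (sqrt n) * Dm n (Zs x) m t - complex_of_real (psi0 t) * Hgen (Uproc n (Zs x)) m t))"
proof -
  note U = process_bounded_rescale[OF process_bounded_Uproc[OF T]]
  have m': "m + 1 \<ge> 1" by simp
  show ?thesis
  proof (rule process_bounded_dom[OF moments_bounded_cmult[OF moments_bounded_add[OF moments_bounded_mult[OF U[OF m'] U[OF m']]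
          moments_bounded_mult[OF U[OF m] U[OF m]]], of "(real (m + 1))\<^sup>2"]])
    fix n t x
    show "(\<lambda>x. sqrt n * cmod (complex_of_real (sqrt n) * Dm n (Zs x) m t - complex_of_real (psi0 t) * Hgen (Uproc n (Zs x)) m t)) \<in> borel_measurable M"
      unfolding Hgen_def Dm_def Sm_def by measurable
    assume "n \<ge> 1"
    then show "sqrt n * cmod (complex_of_real (sqrt n) * Dm n (Zs x) m t - complex_of_real (psi0 t) * Hgen (Uproc n (Zs x)) m t)
      \<le> (real (m + 1))\<^sup>2 * (cmod (Uproc n (Zs x) (t / sqrt (real (m + 1)))) * cmod (Uproc n (Zs x) (t / sqrt (real (m + 1))))
        + cmod (Uproc n (Zs x) (t / sqrt (real m))) * cmod (Uproc n (Zs x) (t / sqrt (real m))))"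
      using sqrt_Dm_linearization[OF _ m, of n "Zs x" t] by (simp only: power2_eq_square)
  qed auto
qed

text \<open>Three functions are compared under one norm: \<open>a\<close> for the linearization,
  \<open>b\<close> for \<open>Uproc\<close>, \<open>c\<close> for the scaled \<open>Dm\<close>. The
  expansion of powers controls \<open>c - b\<close>, the delta method \<open>b - a\<close>, and the
  triangle inequality \<open>c - a\<close>; bounds for \<open>c\<close> itself are inherited from
  \<open>b\<close>.\<close>

lemma
  assumes m: "m \<ge> 1" and T: "T > 0" and \<beta>: "\<beta> \<ge> 0"
  shows moments_bounded_lin_stat: "moments_bounded {1..} (\<lambda>n x. Qgen T \<beta> (lin_proc n (Zs x)) m)"
    and moments_bounded_Qm: "moments_bounded {1..} (\<lambda>n x. Qm T \<beta> n (Zs x) m)"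
    and moments_bounded_Deltam: "moments_bounded {1..} (\<lambda>n x. n * Deltam T \<beta> n (Zs x) m)"
    and moments_bounded_Qm_diff: "moments_bounded {1..} (\<lambda>n x. sqrt n * (Qm T \<beta> n (Zs x) m - Qgen T \<beta> (lin_proc n (Zs x)) m))"
    and moments_bounded_Deltam_diff: "moments_bounded {1..} (\<lambda>n x. sqrt n * (n * Deltam T \<beta> n (Zs x) m - Qgen T \<beta> (lin_proc n (Zs x)) m))"
proof -
  define a where "a n x t = complex_of_real (psi0 t) * Hgen (lin_proc n (Zs x)) m t" for n x t
  define b where "b n x t = complex_of_real (psi0 t) * Hgen (Uproc n (Zs x)) m t" for n x t
  define c where "c n x t = complex_of_real (sqrt (real n)) * Dm n (Zs x) m t" for n x t
  note [measurable] = measurable_compose[OF measurable_fst measurable_Z]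
  have ma: "(\<lambda>p. a n (fst p) (snd p)) \<in> borel_measurable (M \<Otimes>\<^sub>M lborel)" for n
    unfolding a_def by (intro borel_measurable_times measurable_Hgen measurable_lin_proc) measurable
  have mb: "(\<lambda>p. b n (fst p) (snd p)) \<in> borel_measurable (M \<Otimes>\<^sub>M lborel)" for n
    unfolding b_def by (intro borel_measurable_times measurable_Hgen measurable_Uproc) measurable
  have mc: "(\<lambda>p. c n (fst p) (snd p)) \<in> borel_measurable (M \<Otimes>\<^sub>M lborel)" for n
    unfolding c_def Dm_def Sm_def
    by (intro borel_measurable_times borel_measurable_diff borel_measurable_power measurable_ecf_std) measurable
  have ca: "continuous_on {-T..T} (a n x)" and cb: "continuous_on {-T..T} (b n x)" for n x
    unfolding a_def b_def by (intro continuous_intros continuous_Hgen)+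
  have cc: "continuous_on {-T..T} (c n x)" for n x
    unfolding c_def Dm_def Sm_def divide_inverse by (intro continuous_intros)
  have A: "process_bounded T (\<lambda>n t x. cmod (a n x t))"
    using process_bounded_psi0_Hgen[OF m, where G = "\<lambda>_. 1" and V = "\<lambda>n x. lin_proc n (Zs x)", OF _ _ measurable_sample(7)]
      process_bounded_lin_proc[OF T] by (simp add: a_def)
  have B: "process_bounded T (\<lambda>n t x. cmod (b n x t))"
    using process_bounded_psi0_Hgen[OF m, where G = "\<lambda>_. 1" and V = "\<lambda>n x. Uproc n (Zs x)", OF _ _ measurable_sample(6)]
      process_bounded_Uproc[OF T] by (simp add: b_def)
  have BA: "process_bounded T (\<lambda>n t x. sqrt n * cmod (b n x t - a n x t))"
    using process_bounded_psi0_Hgen[OF m, where G = "\<lambda>n. sqrt (real n)" and V = "\<lambda>n x t. Uproc n (Zs x) t - lin_proc n (Zs x) t",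
        OF process_bounded_linearization[OF T] _ borel_measurable_diff[OF measurable_sample(6,7)]]
    by (simp add: a_def b_def Hgen_diff flip: right_diff_distrib)
  have CB: "process_bounded T (\<lambda>n t x. sqrt n * cmod (c n x t - b n x t))"
    unfolding c_def b_def by (rule process_bounded_Dm[OF m T])
  have [measurable]: "(\<lambda>x. a n x t) \<in> borel_measurable M" "(\<lambda>x. b n x t) \<in> borel_measurable M" "(\<lambda>x. c n x t) \<in> borel_measurable M" for n t
    unfolding a_def b_def c_def Hgen_def Dm_def Sm_def by measurable
  have CA: "process_bounded T (\<lambda>n t x. sqrt n * cmod (c n x t - a n x t))"
  proof (rule process_bounded_dom[OF moments_bounded_add[OF CB BA]])
    show "sqrt n * cmod (c n x t - a n x t) \<le> sqrt n * cmod (c n x t - b n x t) + sqrt n * cmod (b n x t - a n x t)" for n t x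
      using mult_left_mono[OF norm_triangle_ineq[of "c n x t - b n x t" "b n x t - a n x t"], of "sqrt n"] by (simp add: distrib_left)
  qed auto
  have C: "process_bounded T (\<lambda>n t x. cmod (c n x t))"
  proof (rule process_bounded_dom[OF moments_bounded_add[OF CB B]])
    fix n t x assume n: "(n::nat) \<ge> 1"
    have "cmod (c n x t) \<le> 1 * cmod (c n x t - b n x t) + cmod (b n x t)"
      using norm_triangle_ineq[of "c n x t - b n x t" "b n x t"] by simp
    also have "\<dots> \<le> sqrt n * cmod (c n x t - b n x t) + cmod (b n x t)"
      using n by (intro add_right_mono mult_right_mono) auto
    finally show "cmod (c n x t) \<le> sqrt n * cmod (c n x t - b n x t) + cmod (b n x t)" .
  qed auto
  show "moments_bounded {1..} (\<lambda>n x. Qgen T \<beta> (lin_proc n (Zs x)) m)"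
    using moments_bounded_wint[OF \<beta> A ma ca] by (simp add: Qgen_eq_wint a_def [abs_def])
  show "moments_bounded {1..} (\<lambda>n x. Qm T \<beta> n (Zs x) m)"
    using moments_bounded_wint[OF \<beta> B mb cb] by (simp add: Qgen_eq_wint b_def [abs_def] Qm_def)
  show "moments_bounded {1..} (\<lambda>n x. n * Deltam T \<beta> n (Zs x) m)"
    using moments_bounded_wint[OF \<beta> C mc cc] by (simp add: Deltam_eq_wint c_def [abs_def])
  show "moments_bounded {1..} (\<lambda>n x. sqrt n * (Qm T \<beta> n (Zs x) m - Qgen T \<beta> (lin_proc n (Zs x)) m))"
    using moments_bounded_wint_diff[OF \<beta> T A B BA ma mb ca cb] by (simp add: Qgen_eq_wint a_def [abs_def] b_def [abs_def] Qm_def)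
  show "moments_bounded {1..} (\<lambda>n x. sqrt n * (n * Deltam T \<beta> n (Zs x) m - Qgen T \<beta> (lin_proc n (Zs x)) m))"
    using moments_bounded_wint_diff[OF \<beta> T A C CA ma mc ca cc] by (simp add: Qgen_eq_wint a_def [abs_def] Deltam_eq_wint c_def [abs_def])
qed

end

subsection \<open>Weak limits\<close>

lemma conv_distr_iff:
  fixes Zn :: "nat \<Rightarrow> 'p \<Rightarrow> 'c::metric_space"
  assumes Zn: "\<And>n. Zn n \<in> borel_measurable P" and Z: "Z \<in> borel_measurable Q"
  shows "conv_distr P Zn Q Z \<longleftrightarrow> (\<forall>f :: 'c \<Rightarrow> real. continuous_on UNIV f \<and> bounded (range f) \<longrightarrow>
      (\<lambda>n. \<integral>x. f (Zn n x) \<partial>P) \<longlonglongrightarrow> (\<integral>x. f (Z x) \<partial>Q))"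
proof -
  have "integral\<^sup>L (distr P borel (Zn n)) f = (\<integral>x. f (Zn n x) \<partial>P)"
       "integral\<^sup>L (distr Q borel Z) f = (\<integral>x. f (Z x) \<partial>Q)" if "continuous_on UNIV f" for f :: "'c \<Rightarrow> real" and n
    using borel_measurable_continuous_onI[OF that] by (auto intro!: integral_distr Zn Z)
  then show ?thesis
    unfolding conv_distr_def weak_conv_gen_def by (auto cong: conj_cong imp_cong)
qed

text \<open>Bounded second moments give uniform integrability: truncation at \<open>c\<close>
  changes a mean by at most \<open>K / c\<close>, uniformly in \<open>n \<ge> 1\<close>. Truncated
  means converge by weak convergence; those of the limit increase and stay bounded, so monotone
  convergence yields integrability.\<close>

lemma expectation_tendsto_of_weak:
  fixes Y :: "nat \<Rightarrow> 'p \<Rightarrow> real" and L :: "'q \<Rightarrow> real"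
  assumes P: "prob_space P" and N: "prob_space N"
    and Ym: "\<And>n. Y n \<in> borel_measurable P" and Lm: "L \<in> borel_measurable N"
    and Y0: "\<And>n x. 0 \<le> Y n x" and L0: "\<And>x. 0 \<le> L x"
    and weak: "\<And>f :: real \<Rightarrow> real. continuous_on UNIV f \<Longrightarrow> bounded (range f) \<Longrightarrow>
      (\<lambda>n. \<integral>x. f (Y n x) \<partial>P) \<longlonglongrightarrow> (\<integral>x. f (L x) \<partial>N)"
    and sq: "\<And>n. n \<ge> 1 \<Longrightarrow> integrable P (\<lambda>x. (Y n x)\<^sup>2)" "\<And>n. n \<ge> 1 \<Longrightarrow> (\<integral>x. (Y n x)\<^sup>2 \<partial>P) \<le> K"
  shows "integrable N L" and "(\<lambda>n. \<integral>x. Y n x \<partial>P) \<longlonglongrightarrow> (\<integral>x. L x \<partial>N)"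
proof -
  interpret P: prob_space P by fact
  interpret N: prob_space N by fact
  note [measurable] = Ym Lm
  have K: "K \<ge> 0"
    by (rule order_trans[OF Bochner_Integration.integral_nonneg sq(2)[of 1]]) auto
  have Yi: "integrable P (Y n)" if "n \<ge> 1" for n
    by (rule P.square_integrable_imp_integrable[OF Ym sq(1)[OF that]])
  \<comment> \<open>A test function has to be bounded on the whole line, hence the clamp at 0; on
    nonnegative values it is just \<open>min x c\<close>.\<close>
  have gcont: "continuous_on UNIV (\<lambda>x. max 0 (min x c))" for c :: real
    by (intro continuous_intros)
  have gbnd: "bounded (range (\<lambda>x. max 0 (min x c)))" for c :: real
    by (rule boundedI[where B = "\<bar>c\<bar>"]) auto
  have g: "(\<lambda>n. \<integral>x. min (Y n x) c \<partial>P) \<longlonglongrightarrow> (\<integral>x. min (L x) c \<partial>N)" if "c > 0" for c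
  proof -
    have "max 0 (min (Y n x) c) = min (Y n x) c" "max 0 (min (L y) c) = min (L y) c" for n x y
      using that Y0[of n x] L0[of y] by auto
    then show ?thesis
      using weak[OF gcont gbnd, of c] by simp
  qed
  have gYi: "integrable P (\<lambda>x. min (Y n x) c)" if "c > 0" for n c
    using that Y0 by (intro P.integrable_const_bound[where B = c]) (auto simp: abs_le_iff intro: order_trans[OF _ Y0])
  have gLi: "integrable N (\<lambda>x. min (L x) c)" if "c > 0" for c
    using that L0 by (intro N.integrable_const_bound[where B = c]) (auto simp: abs_le_iff intro: order_trans[OF _ L0])
  have up: "(\<integral>x. min (Y n x) c \<partial>P) \<le> (\<integral>x. Y n x \<partial>P)" if "n \<ge> 1" "c > 0" for n c
    using that by (intro integral_mono gYi Yi) auto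
  have lo: "(\<integral>x. Y n x \<partial>P) \<le> (\<integral>x. min (Y n x) c \<partial>P) + K / c" if "n \<ge> 1" "c > 0" for n c
  proof -
    have pt: "y \<le> min y c + y\<^sup>2 / c" if "y \<ge> 0" for y
    proof (cases "y \<le> c")
      case False
      then have "y * c \<le> y\<^sup>2"
        using that by (simp add: power2_eq_square mult_left_mono)
      then have "y \<le> y\<^sup>2 / c"
        using \<open>c > 0\<close> by (simp add: le_divide_eq)
      then show ?thesis using \<open>c > 0\<close> False by simp
    qed (use \<open>c > 0\<close> in auto)
    have "(\<integral>x. Y n x \<partial>P) \<le> (\<integral>x. min (Y n x) c + (Y n x)\<^sup>2 / c \<partial>P)"
      using that sq(1) pt[OF Y0] by (intro integral_mono Bochner_Integration.integrable_add gYi Yi integrable_divide) auto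
    also have "\<dots> = (\<integral>x. min (Y n x) c \<partial>P) + (\<integral>x. (Y n x)\<^sup>2 \<partial>P) / c"
      using that sq(1) by (subst Bochner_Integration.integral_add) (auto intro!: gYi)
    also have "\<dots> \<le> (\<integral>x. min (Y n x) c \<partial>P) + K / c"
      using that sq(2) by (intro add_left_mono divide_right_mono) auto
    finally show ?thesis .
  qed
  have EY: "(\<integral>x. min (Y n x) c \<partial>P) \<le> 1 + K" if "n \<ge> 1" "c > 0" for n c
  proof -
    have "(\<integral>x. min (Y n x) 1 \<partial>P) \<le> (\<integral>x. 1 \<partial>P)"
      by (intro integral_mono gYi) auto
    then show ?thesis
      using lo[OF that(1), of 1] up[OF that] by (simp add: P.prob_space)
  qed
  have EL: "(\<integral>x. min (L x) c \<partial>N) \<le> 1 + K" if "c > 0" for c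
    by (rule LIMSEQ_le_const2[OF g[OF that]]) (use EY that in auto)
  define I where "I k = (\<integral>x. min (L x) (real (Suc k)) \<partial>N)" for k
  have "incseq I"
    unfolding I_def incseq_def by (intro allI impI integral_mono gLi) auto
  moreover have "\<bar>I k\<bar> \<le> 1 + K" for k
    using EL[of "real (Suc k)"] L0 by (auto simp: I_def abs_le_iff intro!: order_trans[OF _ Bochner_Integration.integral_nonneg] K)
  ultimately obtain l where l: "I \<longlonglongrightarrow> l"
    using incseq_convergent[of I "1 + K"] by (metis abs_le_D1)
  have lim: "(\<lambda>k. min (L x) (real (Suc k))) \<longlonglongrightarrow> L x" for x
  proof (rule tendsto_eventually)
    obtain k0 where "L x \<le> real k0" using real_arch_simple by blast
    then show "\<forall>\<^sub>F k in sequentially. min (L x) (real (Suc k)) = L x"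
      by (auto simp: eventually_sequentially min_def intro!: exI[of _ k0])
  qed
  have mono: "mono (\<lambda>k. min (L x) (real (Suc k)))" for x
    by (auto simp: mono_def)
  have gLi': "integrable N (\<lambda>x. min (L x) (real (Suc k)))" for k
    by (rule gLi) simp
  note mc = integrable_monotone_convergence[where f = "\<lambda>k x. min (L x) (real (Suc k))", OF gLi' AE_I2[OF mono] AE_I2[OF lim] l[unfolded I_def] Lm]
    integral_monotone_convergence[where f = "\<lambda>k x. min (L x) (real (Suc k))", OF gLi' AE_I2[OF mono] AE_I2[OF lim] l[unfolded I_def] Lm]
  show "integrable N L"
    by (rule mc(1))
  have IL: "I \<longlonglongrightarrow> (\<integral>x. L x \<partial>N)"
    using l by (simp only: mc(2))
  show "(\<lambda>n. \<integral>x. Y n x \<partial>P) \<longlonglongrightarrow> (\<integral>x. L x \<partial>N)"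
  proof (rule LIMSEQ_I)
    fix e :: real assume e: "0 < e"
    have "(\<lambda>k. K / real (Suc k)) \<longlonglongrightarrow> 0"
      by real_asymp
    moreover have e3: "e / 3 > 0" using e by simp
    ultimately have "\<forall>\<^sub>F k in sequentially. dist (K / real (Suc k)) 0 < e / 3"
      by (rule tendstoD)
    with tendstoD[OF IL e3] have "\<forall>\<^sub>F k in sequentially. \<bar>K / real (Suc k)\<bar> < e / 3 \<and> \<bar>I k - (\<integral>x. L x \<partial>N)\<bar> < e / 3"
      by eventually_elim (simp only: dist_real_def diff_0_right simp_thms)
    then obtain k where k: "\<bar>K / real (Suc k)\<bar> < e / 3" "\<bar>I k - (\<integral>x. L x \<partial>N)\<bar> < e / 3"
      by (auto simp: eventually_sequentially)
    obtain n0 where n0: "\<And>n. n \<ge> n0 \<Longrightarrow> \<bar>(\<integral>x. min (Y n x) (real (Suc k)) \<partial>P) - I k\<bar> < e / 3"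
      using LIMSEQ_D[OF g[of "real (Suc k)"], of "e / 3"] e unfolding I_def by auto
    show "\<exists>n0. \<forall>n\<ge>n0. norm ((\<integral>x. Y n x \<partial>P) - (\<integral>x. L x \<partial>N)) < e"
    proof (intro exI allI impI)
      fix n assume n: "n \<ge> max 1 n0"
      have "\<bar>(\<integral>x. Y n x \<partial>P) - (\<integral>x. min (Y n x) (real (Suc k)) \<partial>P)\<bar> \<le> K / real (Suc k)"
        using lo[of n "real (Suc k)"] up[of n "real (Suc k)"] n by simp
      then show "norm ((\<integral>x. Y n x \<partial>P) - (\<integral>x. L x \<partial>N)) < e"
        using k n0[of n] n unfolding real_norm_def by linarith
    qed
  qed
qed

text \<open>The metric of the countable product is governed by finitely many coordinates up to a
  tail \<open>(1/2) ^ N\<close>, and letting \<open>N\<close> grow removes the tail. Finite vectors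
  are encoded as sequences that vanish off \<open>S\<close>, which is why such pairs matter.\<close>

lemma dist_finite_support_le:
  fixes x y :: "nat \<Rightarrow> real"
  assumes S: "finite S" and xy: "\<And>m. m \<notin> S \<Longrightarrow> x m = y m"
  shows "dist x y \<le> 2 * (\<Sum>m\<in>S. \<bar>x m - y m\<bar>)"
proof -
  have c: "dist (x k) (y k) \<le> (\<Sum>m\<in>S. \<bar>x m - y m\<bar>)" for k
  proof (cases "k \<in> S")
    case True
    then show ?thesis
      using S member_le_sum[of k S "\<lambda>m. \<bar>x m - y m\<bar>"] by (simp add: dist_real_def)
  qed (simp add: xy sum_nonneg)
  have "dist x y \<le> 2 * (\<Sum>m\<in>S. \<bar>x m - y m\<bar>) + (1/2) ^ N" for N
  proof -
    have "Max {dist (x (from_nat n)) (y (from_nat n)) |n. n \<le> N} \<le> (\<Sum>m\<in>S. \<bar>x m - y m\<bar>)"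
      using c by (subst Max_le_iff) auto
    then show ?thesis
      using dist_fun_le_dist_first_terms[of x y N] by linarith
  qed
  moreover have "(\<lambda>N. 2 * (\<Sum>m\<in>S. \<bar>x m - y m\<bar>) + (1/2::real) ^ N) \<longlonglongrightarrow> 2 * (\<Sum>m\<in>S. \<bar>x m - y m\<bar>) + 0"
    by (intro tendsto_intros LIMSEQ_power_zero) auto
  ultimately show ?thesis
    by (intro LIMSEQ_le_const[where a = "dist x y"]) auto
qed

text \<open>A bounded continuous \<open>f\<close> is uniformly continuous on a compact cube. If a
  point lies outside the cube or the two points are not close, one of the three scaled sums is at
  least 1 and the trivial bound \<open>2 * B\<close> is covered. This is Markov's inequality before
  integration.\<close>

lemma bounded_continuous_perturbation:
  fixes f :: "(nat \<Rightarrow> real) \<Rightarrow> real"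
  assumes f: "continuous_on UNIV f" and B: "\<And>x. \<bar>f x\<bar> \<le> B" and S: "finite S" and e: "e > 0" and c: "c > 0"
  shows "\<exists>d>0. \<forall>x y. (\<forall>m. m \<notin> S \<longrightarrow> x m = 0 \<and> y m = 0) \<longrightarrow>
    \<bar>f x - f y\<bar> \<le> e + 2 * B * ((\<Sum>m\<in>S. \<bar>x m\<bar>) / c + (\<Sum>m\<in>S. \<bar>y m\<bar>) / c + (\<Sum>m\<in>S. \<bar>x m - y m\<bar>) / d)"
proof -
  define K :: "(nat \<Rightarrow> real) set" where "K = (\<Pi>\<^sub>E m\<in>UNIV. if m \<in> S then {-c..c} else {0})"
  have "compactin (product_topology (\<lambda>_. euclidean) UNIV) K"
    unfolding K_def by (subst compactin_PiE) auto
  then have "compact K"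
    by (simp add: euclidean_product_topology)
  then have "uniformly_continuous_on K f"
    by (intro compact_uniformly_continuous continuous_on_subset[OF f]) auto
  then obtain d where d: "d > 0" "\<And>x y. x \<in> K \<Longrightarrow> y \<in> K \<Longrightarrow> dist x y < d \<Longrightarrow> dist (f x) (f y) < e"
    using e unfolding uniformly_continuous_on_def by metis
  have B0: "B \<ge> 0" using B[of "\<lambda>_. 0"] by linarith
  have notK: "(\<Sum>m\<in>S. \<bar>z m\<bar>) / c \<ge> 1" if z: "z \<notin> K" and z0: "\<forall>m. m \<notin> S \<longrightarrow> z m = 0" for z
  proof -
    obtain m where "m \<in> S" "z m \<notin> {-c..c}"
      using z z0 by (auto simp: K_def PiE_iff split: if_splits)
    then have "c \<le> \<bar>z m\<bar>" by auto
    also have "\<dots> \<le> (\<Sum>m\<in>S. \<bar>z m\<bar>)"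
      using S \<open>m \<in> S\<close> by (intro member_le_sum) auto
    finally show ?thesis using c by simp
  qed
  show ?thesis
  \<comment> \<open>Half of the modulus of continuity, because the distance is at most twice the sum
    of the coordinate differences.\<close>
  proof (intro exI[of _ "d / 2"] conjI allI impI)
    fix x y :: "nat \<Rightarrow> real" assume sup: "\<forall>m. m \<notin> S \<longrightarrow> x m = 0 \<and> y m = 0"
    let ?a = "(\<Sum>m\<in>S. \<bar>x m\<bar>) / c" and ?b = "(\<Sum>m\<in>S. \<bar>y m\<bar>) / c" and ?c = "(\<Sum>m\<in>S. \<bar>x m - y m\<bar>) / (d / 2)"
    have nn: "0 \<le> ?a" "0 \<le> ?b" "0 \<le> ?c" using c d by (auto intro!: divide_nonneg_pos sum_nonneg)
    show "\<bar>f x - f y\<bar> \<le> e + 2 * B * (?a + ?b + ?c)"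
    proof (cases "?a < 1 \<and> ?b < 1 \<and> ?c < 1")
      case True
      then have "x \<in> K" "y \<in> K" using notK sup by force+
      moreover have "dist x y < d"
        using True d(1) dist_finite_support_le[OF S, of x y] sup by (simp add: divide_less_eq)
      ultimately have "\<bar>f x - f y\<bar> < e" using d(2) by (simp add: dist_real_def)
      moreover have "0 \<le> 2 * B * (?a + ?b + ?c)" using nn B0 by simp
      ultimately show ?thesis by linarith
    next
      case False
      then have "1 \<le> ?a + ?b + ?c" using nn by linarith
      then have "2 * B * 1 \<le> 2 * B * (?a + ?b + ?c)" using B0 by (intro mult_left_mono) auto
      then show ?thesis using B[of x] B[of y] e by linarith
    qed
  qed (use d in auto)
qed

text \<open>Slutsky's lemma with convergence in mean. The pointwise perturbation bound is
  integrated: a large cube makes the contribution of \<open>A\<close> small, after which the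
  contribution of \<open>A - C\<close> tends to 0.\<close>

lemma weak_limit_perturbation:
  fixes A C :: "nat \<Rightarrow> 'p \<Rightarrow> nat \<Rightarrow> real" and l :: real
  assumes P: "prob_space P" and S: "finite S"
    and A0: "\<And>n x m. m \<notin> S \<Longrightarrow> A n x m = 0" and C0: "\<And>n x m. m \<notin> S \<Longrightarrow> C n x m = 0"
    and Am: "\<And>n m. (\<lambda>x. A n x m) \<in> borel_measurable P" and Cm: "\<And>n m. (\<lambda>x. C n x m) \<in> borel_measurable P"
    and Ai: "\<And>n m. n \<ge> 1 \<Longrightarrow> m \<in> S \<Longrightarrow> integrable P (\<lambda>x. \<bar>A n x m\<bar>)"
    and Ab: "\<And>n m. n \<ge> 1 \<Longrightarrow> m \<in> S \<Longrightarrow> (\<integral>x. \<bar>A n x m\<bar> \<partial>P) \<le> K"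
    and Di: "\<And>n m. n \<ge> 1 \<Longrightarrow> m \<in> S \<Longrightarrow> integrable P (\<lambda>x. \<bar>A n x m - C n x m\<bar>)"
    and D: "\<And>m. m \<in> S \<Longrightarrow> (\<lambda>n. \<integral>x. \<bar>A n x m - C n x m\<bar> \<partial>P) \<longlonglongrightarrow> 0"
    and f: "continuous_on UNIV f" "bounded (range f)"
    and lim: "(\<lambda>n. \<integral>x. f (A n x) \<partial>P) \<longlonglongrightarrow> l"
  shows "(\<lambda>n. \<integral>x. f (C n x) \<partial>P) \<longlonglongrightarrow> l"
proof -
  interpret P: prob_space P by fact
  have [measurable]: "A n \<in> borel_measurable P" "C n \<in> borel_measurable P" for n
    by (auto intro!: measurable_coordinatewise_then_product Am Cm)
  have [measurable]: "f \<in> borel_measurable borel"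
    by (rule borel_measurable_continuous_onI) fact
  obtain B0 where B0: "\<And>x. \<bar>f x\<bar> \<le> B0" using f(2) unfolding bounded_iff by auto
  define B where "B = max B0 1"
  have B: "\<bar>f x\<bar> \<le> B" "B > 0" for x using B0[of x] by (auto simp: B_def)
  have fi: "integrable P (\<lambda>x. f (A n x))" "integrable P (\<lambda>x. f (C n x))" for n
    using B by (auto intro!: P.integrable_const_bound[where B = B])
  define K1 where "K1 = card S * \<bar>K\<bar>"
  have SA: "(\<integral>x. (\<Sum>m\<in>S. \<bar>A n x m\<bar>) \<partial>P) \<le> K1" if "n \<ge> 1" for n
  proof -
    have "(\<integral>x. (\<Sum>m\<in>S. \<bar>A n x m\<bar>) \<partial>P) = (\<Sum>m\<in>S. \<integral>x. \<bar>A n x m\<bar> \<partial>P)"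
      using Ai[OF that] by (intro Bochner_Integration.integral_sum) auto
    also have "\<dots> \<le> (\<Sum>m\<in>S. \<bar>K\<bar>)"
      using Ab[OF that] by (intro sum_mono) (auto intro: order_trans[OF _ abs_ge_self])
    finally show ?thesis by (simp add: K1_def)
  qed
  define \<eta> where "\<eta> n = (\<Sum>m\<in>S. \<integral>x. \<bar>A n x m - C n x m\<bar> \<partial>P)" for n
  have \<eta>: "\<eta> \<longlonglongrightarrow> 0" unfolding \<eta>_def by (intro tendsto_null_sum D)
  have SD: "(\<integral>x. (\<Sum>m\<in>S. \<bar>A n x m - C n x m\<bar>) \<partial>P) = \<eta> n" if "n \<ge> 1" for n
    unfolding \<eta>_def using Di[OF that] by (intro Bochner_Integration.integral_sum) auto
  have iA: "integrable P (\<lambda>x. \<Sum>m\<in>S. \<bar>A n x m\<bar>)" and iD: "integrable P (\<lambda>x. \<Sum>m\<in>S. \<bar>A n x m - C n x m\<bar>)" if "n \<ge> 1" for n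
    using Ai[OF that] Di[OF that] by auto
  have "(\<lambda>n. (\<integral>x. f (A n x) \<partial>P) - (\<integral>x. f (C n x) \<partial>P)) \<longlonglongrightarrow> 0"
  proof (rule LIMSEQ_I)
    fix e :: real assume e: "e > 0"
    \<comment> \<open>This makes \<open>4 * B / c * (K1 + 1)\<close> equal to \<open>e / 4\<close>;
      the added 1 keeps \<open>c\<close> positive when \<open>K1 = 0\<close>.\<close>
    define c where "c = 16 * B * (K1 + 1) / e"
    have K1: "K1 \<ge> 0" by (simp add: K1_def)
    have c: "c > 0" using B(2) e K1 by (simp add: c_def)
    obtain d where d: "d > 0" and pt: "\<And>x y. (\<forall>m. m \<notin> S \<longrightarrow> x m = 0 \<and> y m = 0) \<Longrightarrow>
      \<bar>f x - f y\<bar> \<le> e / 4 + 2 * B * ((\<Sum>m\<in>S. \<bar>x m\<bar>) / c + (\<Sum>m\<in>S. \<bar>y m\<bar>) / c + (\<Sum>m\<in>S. \<bar>x m - y m\<bar>) / d)"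
      using bounded_continuous_perturbation[OF f(1) B(1) S, of "e / 4" c] e c by auto
    define q where "q = 2 * B * (1 / c + 1 / d)"
    have q: "q > 0" using B(2) c d by (simp add: q_def add_pos_pos)
    have "\<forall>\<^sub>F n in sequentially. \<eta> n < e / (4 * q)"
      using \<eta> e q by (intro order_tendstoD(2)) auto
    then obtain n0 where n0: "\<And>n. n \<ge> n0 \<Longrightarrow> \<eta> n < e / (4 * q)"
      by (auto simp: eventually_sequentially)
    show "\<exists>n0. \<forall>n\<ge>n0. norm ((\<integral>x. f (A n x) \<partial>P) - (\<integral>x. f (C n x) \<partial>P) - 0) < e"
    proof (intro exI allI impI)
      fix n assume n: "n \<ge> max 1 n0"
      then have n1: "n \<ge> 1" by simp
      have pt2: "\<bar>f (A n x) - f (C n x)\<bar> \<le> e / 4 + (4 * B / c * (\<Sum>m\<in>S. \<bar>A n x m\<bar>) + q * (\<Sum>m\<in>S. \<bar>A n x m - C n x m\<bar>))" for x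
      proof -
        let ?a = "\<Sum>m\<in>S. \<bar>A n x m\<bar>" and ?b = "\<Sum>m\<in>S. \<bar>C n x m\<bar>" and ?d = "\<Sum>m\<in>S. \<bar>A n x m - C n x m\<bar>"
        \<comment> \<open>Bounding \<open>C\<close> by \<open>A\<close> and the difference reduces
          all estimates to the first moments of \<open>A\<close> and of \<open>A - C\<close>; the
          extra \<open>?d / c\<close> explains the summand \<open>1 / c\<close> in
          \<open>q\<close>.\<close>
        have "?b \<le> ?a + ?d"
          unfolding sum.distrib[symmetric] by (intro sum_mono) auto
        then have "?a / c + ?b / c + ?d / d \<le> ?a / c + (?a + ?d) / c + ?d / d"
          using c d by (intro add_mono divide_right_mono) auto
        then have "2 * B * (?a / c + ?b / c + ?d / d) \<le> 2 * B * (?a / c + (?a + ?d) / c + ?d / d)"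
          using B(2) by (intro mult_left_mono) auto
        also have "\<dots> = 4 * B / c * ?a + q * ?d"
          using c d by (simp add: q_def field_simps)
        finally show ?thesis
          using pt[of "A n x" "C n x"] A0 C0 by force
      qed
      have "\<bar>(\<integral>x. f (A n x) \<partial>P) - (\<integral>x. f (C n x) \<partial>P)\<bar> = \<bar>\<integral>x. f (A n x) - f (C n x) \<partial>P\<bar>"
        using fi by simp
      also have "\<dots> \<le> (\<integral>x. \<bar>f (A n x) - f (C n x)\<bar> \<partial>P)"
        by (rule integral_abs_bound)
      also have "\<dots> \<le> (\<integral>x. e / 4 + (4 * B / c * (\<Sum>m\<in>S. \<bar>A n x m\<bar>) + q * (\<Sum>m\<in>S. \<bar>A n x m - C n x m\<bar>)) \<partial>P)"
        using iA[OF n1] iD[OF n1]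
        by (intro integral_mono integrable_abs Bochner_Integration.integrable_diff Bochner_Integration.integrable_add integrable_mult_right fi pt2) auto
      also have "\<dots> = e / 4 + (4 * B / c * (\<integral>x. (\<Sum>m\<in>S. \<bar>A n x m\<bar>) \<partial>P) + q * \<eta> n)"
        using iA[OF n1] iD[OF n1] by (simp add: P.prob_space SD[OF n1, symmetric] del: Bochner_Integration.integral_sum Bochner_Integration.integral_sum')
      also have "\<dots> \<le> e / 4 + (4 * B / c * (K1 + 1) + q * (e / (4 * q)))"
        using SA[OF n1] B(2) c q n0[of n] n by (intro add_mono mult_left_mono) auto
      also have "\<dots> = e / 4 + e / 4 + e / 4"
      proof -
        have "4 * B / (16 * B * k / e) * k = e / 4" if "k > 0" for k
          using that B(2) e by (simp add: field_simps)
        from this[of "K1 + 1"] show ?thesis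
          using q K1 by (simp add: c_def)
      qed
      also have "\<dots> < e" using e by simp
      finally show "norm ((\<integral>x. f (A n x) \<partial>P) - (\<integral>x. f (C n x) \<partial>P) - 0) < e" by simp
    qed
  qed
  from tendsto_diff[OF lim this] show ?thesis by simp
qed

text \<open>The normal density is positive, so \<open>f\<close> vanishes Lebesgue-almost everywhere,
  and an open set of measure zero is empty. A vanishing integral thereby says something about a
  prescribed point.\<close>

lemma std_normal_integral_eq_0D:
  fixes f :: "real \<Rightarrow> real"
  assumes f: "continuous_on UNIV f" and nn: "\<And>x. 0 \<le> f x" and int: "integrable std_normal_distribution f"
    and 0: "(\<integral>x. f x \<partial>std_normal_distribution) = 0"
  shows "f x = 0"
proof (rule ccontr)
  assume x: "f x \<noteq> 0"
  have [measurable]: "f \<in> borel_measurable borel"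
    by (rule borel_measurable_continuous_onI) fact
  have "AE y in std_normal_distribution. f y = 0"
    using integral_nonneg_eq_0_iff_AE[OF int] nn 0 by auto
  then have "AE y in lborel. f y = 0"
    by (subst (asm) AE_density) (auto simp: normal_density_pos)
  then have null: "{y. f y \<noteq> 0} \<in> null_sets lborel"
    by (subst (asm) AE_iff_null) auto
  have "open {y. f y \<noteq> 0}"
    using open_Collect_neq[OF f continuous_on_const] .
  then obtain e where e: "e > 0" "ball x e \<subseteq> {y. f y \<noteq> 0}"
    using x unfolding open_contains_ball by blast
  then have "{x - e<..<x + e} \<in> null_sets lborel"
    using null_sets_subset[OF null, of "{x - e<..<x + e}"] by (simp add: ball_eq_greaterThanLessThan)
  then show False
    using e(1) by (simp add: null_sets_def)
qed

subsection \<open>Continuity in the limit triple\<close>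

text \<open>A linear statistic controlled by \<^const>\<open>Qgen\<close>. Taking the real part makes the contributions of
  the sample mean (purely imaginary) and of the sample standard deviation (cancelling between the
  two terms of \<^const>\<open>Hgen\<close>) disappear, so that on a sample it is exactly a normalized sum of i.i.d. terms.\<close>
definition lfun :: "real \<Rightarrow> real \<Rightarrow> nat \<Rightarrow> (real \<Rightarrow> complex) \<Rightarrow> real" where
  "lfun T \<beta> m V = integral {-T..T} (\<lambda>t. wt \<beta> t * (psi0 t)\<^sup>2 * Re (Hgen V m t))"

lemma continuous_lfun_integrand:
  "continuous_on UNIV V \<Longrightarrow> continuous_on S (\<lambda>t. wt \<beta> t * (psi0 t)\<^sup>2 * Re (Hgen V m t))"
  by (intro continuous_intros continuous_Hgen)

lemma lfun_eq_Leb: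
  "continuous_on UNIV V \<Longrightarrow> lfun T \<beta> m V = (\<integral>t. wt \<beta> t * (psi0 t)\<^sup>2 * Re (Hgen V m t) \<partial>Leb T)"
  unfolding lfun_def by (rule integral_Leb[OF continuous_lfun_integrand])

lemma measure_Leb: "T > 0 \<Longrightarrow> measure (Leb T) (space (Leb T)) = 2 * T"
  by (simp add: measure_restrict_space space_restrict_space)

lemma integral_Leb_bound:
  fixes f :: "real \<Rightarrow> real"
  assumes T: "T > 0" and f: "continuous_on {-T..T} f" and le: "\<And>t. t \<in> {-T..T} \<Longrightarrow> \<bar>f t\<bar> \<le> c"
  shows "\<bar>\<integral>t. f t \<partial>Leb T\<bar> \<le> 2 * T * c"
proof -
  interpret finite_measure "Leb T" by (rule finite_measure_Leb)
  have "\<bar>\<integral>t. f t \<partial>Leb T\<bar> \<le> (\<integral>t. \<bar>f t\<bar> \<partial>Leb T)"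
    by (rule integral_abs_bound)
  also have "\<dots> \<le> (\<integral>t. c \<partial>Leb T)"
    using le by (intro integral_mono integrable_abs integrable_Leb f) (auto simp: space_restrict_space)
  also have "\<dots> = 2 * T * c"
    using measure_Leb[OF T] by simp
  finally show ?thesis .
qed

text \<open>One of the two factors \<open>psi0\<close> is spent on the quotients in
  \<open>Hgen\<close>; the other one and the weight are bounded by 1.\<close>

lemma lfun_integrand_le:
  assumes "m \<ge> 1" "\<beta> \<ge> 0" "t \<in> {-T..T}" and V: "\<And>s. s \<in> {-T..T} \<Longrightarrow> cmod (V s) \<le> d"
  shows "\<bar>wt \<beta> t * (psi0 t)\<^sup>2 * Re (Hgen V m t)\<bar> \<le> 2 * real (m + 1) * d"
proof -
  have "\<bar>wt \<beta> t * (psi0 t)\<^sup>2 * Re (Hgen V m t)\<bar> = (wt \<beta> t * psi0 t) * \<bar>psi0 t * Re (Hgen V m t)\<bar>"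
    using wt_bounds[OF assms(2), of t] psi0_pos[of t] by (simp add: abs_mult power2_eq_square)
  also have "\<dots> \<le> 1 * \<bar>psi0 t * Re (Hgen V m t)\<bar>"
    using wt_bounds[OF assms(2), of t] psi0_pos[of t] psi0_le_1[of t] mult_mono[of "wt \<beta> t" 1 "psi0 t" 1]
    by (intro mult_right_mono) auto
  also have "\<dots> \<le> cmod (complex_of_real (psi0 t) * Hgen V m t)"
    using abs_Re_le_cmod[of "complex_of_real (psi0 t) * Hgen V m t"] by simp
  also have "\<dots> \<le> real (m + 1) * (cmod (V (t / sqrt (real (m + 1)))) + cmod (V (t / sqrt (real m))))"
    by (rule psi0_Hgen_le[OF assms(1)])
  also have "\<dots> \<le> real (m + 1) * (d + d)"
    using assms scale_mem[of m t T] scale_mem[of "m + 1" t T] by (intro mult_left_mono add_mono V) auto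
  finally show ?thesis by (simp add: algebra_simps)
qed

lemma lfun_diff:
  assumes "continuous_on UNIV V" "continuous_on UNIV V'"
  shows "lfun T \<beta> m V - lfun T \<beta> m V' = lfun T \<beta> m (\<lambda>s. V s - V' s)"
proof -
  have "lfun T \<beta> m V - lfun T \<beta> m V' = (\<integral>t. wt \<beta> t * (psi0 t)\<^sup>2 * Re (Hgen V m t) - wt \<beta> t * (psi0 t)\<^sup>2 * Re (Hgen V' m t) \<partial>Leb T)"
    unfolding lfun_eq_Leb[OF assms(1)] lfun_eq_Leb[OF assms(2)]
    by (intro Bochner_Integration.integral_diff[symmetric] integrable_Leb continuous_lfun_integrand assms)
  also have "\<dots> = lfun T \<beta> m (\<lambda>s. V s - V' s)"
    using assms by (subst lfun_eq_Leb) (auto intro!: continuous_intros simp flip: Hgen_diff simp: algebra_simps)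
  finally show ?thesis .
qed

lemma lfun_le:
  assumes "T > 0" "m \<ge> 1" "\<beta> \<ge> 0" "continuous_on UNIV V" "\<And>s. s \<in> {-T..T} \<Longrightarrow> cmod (V s) \<le> d"
  shows "\<bar>lfun T \<beta> m V\<bar> \<le> 2 * T * (2 * real (m + 1) * d)"
  unfolding lfun_eq_Leb[OF assms(4)]
  by (rule integral_Leb_bound[OF assms(1) continuous_lfun_integrand[OF assms(4)] lfun_integrand_le[OF assms(2,3) _ assms(5)]])

lemma lfun_cong:
  assumes "m \<ge> 1" "\<And>s. s \<in> {-T..T} \<Longrightarrow> V s = V' s"
  shows "lfun T \<beta> m V = lfun T \<beta> m V'" and "Qgen T \<beta> V m = Qgen T \<beta> V' m"
proof -
  have "Hgen V m t = Hgen V' m t" if "t \<in> {-T..T}" for t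
    using assms scale_mem[of m t T] scale_mem[of "m + 1" t T] that by (simp add: Hgen_def)
  then show "lfun T \<beta> m V = lfun T \<beta> m V'" "Qgen T \<beta> V m = Qgen T \<beta> V' m"
    unfolding lfun_def Qgen_def by (auto intro!: integral_cong)
qed

text \<open>From \<open>\<bar>x\<bar> \<le> x\<^sup>2 + 1\<close> a linear functional is dominated
  by the quadratic one. An almost surely constant \<open>Qgen\<close> would thus force
  \<open>lfun\<close> to be almost surely bounded.\<close>

lemma abs_lfun_le_Qgen:
  assumes T: "T > 0" and \<beta>: "\<beta> \<ge> 0" and V: "continuous_on UNIV V"
  shows "\<bar>lfun T \<beta> m V\<bar> \<le> 2 * T + Qgen T \<beta> V m"
proof -
  interpret finite_measure "Leb T" by (rule finite_measure_Leb)
  let ?w = "\<lambda>t. wt \<beta> t * (psi0 t)\<^sup>2"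
  have w: "0 \<le> ?w t" "?w t \<le> 1" for t
    using wt_bounds[OF \<beta>, of t] psi0_pos[of t] psi0_le_1[of t] mult_mono[of "wt \<beta> t" 1 "(psi0 t)\<^sup>2" 1]
    by (auto simp: power_le_one)
  have c: "continuous_on {-T..T} (\<lambda>t. ?w t * (cmod (Hgen V m t))\<^sup>2)"
    by (intro continuous_intros continuous_Hgen V)
  have "\<bar>lfun T \<beta> m V\<bar> \<le> (\<integral>t. \<bar>?w t * Re (Hgen V m t)\<bar> \<partial>Leb T)"
    unfolding lfun_eq_Leb[OF V] by (rule integral_abs_bound)
  also have "\<dots> \<le> (\<integral>t. 1 + ?w t * (cmod (Hgen V m t))\<^sup>2 \<partial>Leb T)"
  proof (intro integral_mono integrable_abs Bochner_Integration.integrable_add integrable_Leb c continuous_lfun_integrand V continuous_on_const)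
    fix t
    have "\<bar>Re (Hgen V m t)\<bar> \<le> 1 + (cmod (Hgen V m t))\<^sup>2"
      using abs_Re_le_cmod[of "Hgen V m t"] abs_le_square_plus_one[of "cmod (Hgen V m t)"] by simp
    then have "?w t * \<bar>Re (Hgen V m t)\<bar> \<le> ?w t * (1 + (cmod (Hgen V m t))\<^sup>2)"
      using w(1) by (intro mult_left_mono) auto
    also have "\<dots> \<le> 1 + ?w t * (cmod (Hgen V m t))\<^sup>2"
      using w(2)[of t] by (simp add: distrib_left)
    finally show "\<bar>?w t * Re (Hgen V m t)\<bar> \<le> 1 + ?w t * (cmod (Hgen V m t))\<^sup>2"
      unfolding abs_mult[of "?w t"] abs_of_nonneg[OF w(1)] .
  qed
  also have "\<dots> = (\<integral>t. 1 \<partial>Leb T) + (\<integral>t. ?w t * (cmod (Hgen V m t))\<^sup>2 \<partial>Leb T)"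
    by (intro Bochner_Integration.integral_add integrable_Leb c continuous_on_const)
  also have "\<dots> = 2 * T + Qgen T \<beta> V m"
    unfolding Qgen_def integral_Leb[OF c] using measure_Leb[OF T] by simp
  finally show ?thesis .
qed

lemma wint_diff_le:
  assumes T: "T > 0" and \<beta>: "\<beta> \<ge> 0" and a: "continuous_on {-T..T} a" and b: "continuous_on {-T..T} b"
    and d: "\<And>t. t \<in> {-T..T} \<Longrightarrow> cmod (b t - a t) \<le> d" and A: "\<And>t. t \<in> {-T..T} \<Longrightarrow> cmod (a t) \<le> A"
  shows "\<bar>wint T \<beta> b - wint T \<beta> a\<bar> \<le> 2 * T * (d * (2 * A + d))"
proof -
  let ?f = "\<lambda>t. cmod (b t - a t) * (cmod (a t) + cmod (b t))"
  have "\<bar>\<integral>t. ?f t \<partial>Leb T\<bar> \<le> 2 * T * (d * (2 * A + d))"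
  proof (rule integral_Leb_bound[OF T])
    show "continuous_on {-T..T} ?f"
      by (intro continuous_intros a b)
    fix t assume t: "t \<in> {-T..T}"
    have "cmod (b t) \<le> A + d"
      using norm_triangle_ineq[of "a t" "b t - a t"] A[OF t] d[OF t] by simp
    then have "?f t \<le> d * (2 * A + d)"
      using d[OF t] A[OF t] order_trans[OF norm_ge_zero d[OF t]] by (intro mult_mono) auto
    then show "\<bar>?f t\<bar> \<le> d * (2 * A + d)" by simp
  qed
  then show ?thesis
    using wint_diff_le_integral[OF \<beta> a b] by linarith
qed

text \<open>The weights are the largest values on \<open>[-T, T]\<close> of the coefficients in
  \<open>G0\<close>, with \<open>psi0\<close> replaced by 1; so this dominates \<open>G0\<close>
  uniformly on the interval.\<close>

definition trip_norm :: "real \<Rightarrow> real \<Rightarrow> (real \<Rightarrow>\<^sub>C complex) \<times> real \<times> real \<Rightarrow> real" where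
  "trip_norm T \<sigma> p = norm (fst p) + T / \<sigma> * \<bar>fst (snd p)\<bar> + T\<^sup>2 / \<sigma> * \<bar>snd (snd p)\<bar>"

abbreviation G0t :: "real \<Rightarrow> real \<Rightarrow> (real \<Rightarrow>\<^sub>C complex) \<times> real \<times> real \<Rightarrow> real \<Rightarrow> complex" where
  "G0t \<mu> \<sigma> p \<equiv> G0 \<mu> \<sigma> (fst p) (fst (snd p)) (snd (snd p))"

lemma G0t_diff: "G0t \<mu> \<sigma> q t - G0t \<mu> \<sigma> p t = G0t \<mu> \<sigma> (q - p) t"
  by (simp add: G0_def algebra_simps diff_divide_distrib)

lemma norm_G0t_le:
  assumes "\<sigma> > 0" "t \<in> {-T..T}"
  shows "cmod (G0t \<mu> \<sigma> p t) \<le> trip_norm T \<sigma> p"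
proof -
  have t: "\<bar>t\<bar> \<le> T" using assms(2) by (simp add: abs_le_iff)
  have p: "\<bar>psi0 t\<bar> \<le> 1" using psi0_pos[of t] psi0_le_1[of t] by simp
  have 1: "cmod (exp (- \<i> * complex_of_real (t * \<mu> / \<sigma>)) * apply_bcontfun (fst p) (t / \<sigma>)) \<le> norm (fst p)"
    using norm_bounded[of "fst p" "t / \<sigma>"] by (simp add: norm_mult norm_exp_eq_Re)
  have 2: "cmod (\<i> * complex_of_real (t / \<sigma> * psi0 t * fst (snd p))) \<le> T / \<sigma> * 1 * \<bar>fst (snd p)\<bar>"
    unfolding norm_mult norm_of_real abs_mult abs_divide norm_ii mult_1_left
    using assms t p by (intro mult_mono divide_mono) auto
  have "t\<^sup>2 \<le> T\<^sup>2" using t by (simp add: abs_le_square_iff[symmetric])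
  then have 3: "cmod (complex_of_real (t\<^sup>2 / \<sigma> * psi0 t * snd (snd p))) \<le> T\<^sup>2 / \<sigma> * 1 * \<bar>snd (snd p)\<bar>"
    unfolding norm_of_real abs_mult abs_divide
    using assms t p by (intro mult_mono divide_mono) auto
  show ?thesis
    unfolding G0_def trip_norm_def
    using norm_triangle_ineq[of "exp (- \<i> * complex_of_real (t * \<mu> / \<sigma>)) * apply_bcontfun (fst p) (t / \<sigma>) - \<i> * complex_of_real (t / \<sigma> * psi0 t * fst (snd p))" "complex_of_real (t\<^sup>2 / \<sigma> * psi0 t * snd (snd p))"]
      norm_triangle_ineq4[of "exp (- \<i> * complex_of_real (t * \<mu> / \<sigma>)) * apply_bcontfun (fst p) (t / \<sigma>)" "\<i> * complex_of_real (t / \<sigma> * psi0 t * fst (snd p))"] 1 2 3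
    by simp
qed

lemma continuous_G0: "continuous_on S (G0 \<mu> \<sigma> g y1 y2)"
proof -
  have "continuous_on S (\<lambda>t. apply_bcontfun g (t / \<sigma>))"
    unfolding divide_inverse
    by (rule continuous_on_compose2[OF continuous_on_apply_bcontfun[of UNIV g]]) (auto intro!: continuous_intros)
  then show ?thesis
    unfolding G0_def divide_inverse by (intro continuous_intros)
qed

lemma trip_norm_tendsto: "((\<lambda>q. trip_norm T \<sigma> (q - p)) \<longlongrightarrow> 0) (at p)"
proof -
  have "isCont (\<lambda>q. trip_norm T \<sigma> (q - p)) p"
    unfolding trip_norm_def by (intro continuous_intros)
  then show ?thesis
    by (simp add: isCont_def trip_norm_def)
qed

lemma continuous_lfun_G0t:
  assumes "T > 0" "\<sigma> > 0" "m \<ge> 1" "\<beta> \<ge> 0"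
  shows "continuous_on UNIV (\<lambda>p. lfun T \<beta> m (G0t \<mu> \<sigma> p))"
proof -
  have "isCont (\<lambda>p. lfun T \<beta> m (G0t \<mu> \<sigma> p)) p" for p
    unfolding isCont_def
  proof (rule Lim_transform[OF tendsto_const])
    have le: "norm (lfun T \<beta> m (G0t \<mu> \<sigma> q) - lfun T \<beta> m (G0t \<mu> \<sigma> p)) \<le> 2 * T * (2 * real (m + 1) * trip_norm T \<sigma> (q - p))" for q
    proof -
      have "\<bar>lfun T \<beta> m (G0t \<mu> \<sigma> (q - p))\<bar> \<le> 2 * T * (2 * real (m + 1) * trip_norm T \<sigma> (q - p))"
        by (rule lfun_le[OF assms(1,3,4) continuous_G0 norm_G0t_le[OF assms(2)]])
      moreover have "lfun T \<beta> m (G0t \<mu> \<sigma> q) - lfun T \<beta> m (G0t \<mu> \<sigma> p) = lfun T \<beta> m (G0t \<mu> \<sigma> (q - p))"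
        unfolding lfun_diff[OF continuous_G0 continuous_G0] G0t_diff ..
      ultimately show ?thesis
        by (simp only: real_norm_def)
    qed
    have "((\<lambda>q. 2 * T * (2 * real (m + 1) * trip_norm T \<sigma> (q - p))) \<longlongrightarrow> 0) (at p)"
      using tendsto_mult_right_zero[OF tendsto_mult_right_zero[OF trip_norm_tendsto]] .
    then show "((\<lambda>q. lfun T \<beta> m (G0t \<mu> \<sigma> q) - lfun T \<beta> m (G0t \<mu> \<sigma> p)) \<longlongrightarrow> 0) (at p)"
      by (rule Lim_null_comparison[rotated]) (use le in auto)
  qed
  then show ?thesis
    by (simp add: continuous_on_eq_continuous_at)
qed

text \<open>\<open>G0\<close> is linear in the triple, which makes \<open>Qgen\<close> a quadratic
  form in it. Its increment at \<open>p\<close> is at most a multiple of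
  \<open>d * (2 * A + d)\<close>, with \<open>d\<close> proportional to the size of
  \<open>q - p\<close> and \<open>A\<close> to that of \<open>p\<close>.\<close>

lemma continuous_Qgen_G0t:
  assumes "T > 0" "\<sigma> > 0" "m \<ge> 1" "\<beta> \<ge> 0"
  shows "continuous_on UNIV (\<lambda>p. Qgen T \<beta> (G0t \<mu> \<sigma> p) m)"
proof -
  define a where "a p t = complex_of_real (psi0 t) * Hgen (G0t \<mu> \<sigma> p) m t" for p t
  define c where "c = 2 * real (m + 1)"
  have cont: "continuous_on {-T..T} (a p)" for p
    unfolding a_def by (intro continuous_intros continuous_Hgen continuous_G0)
  have le: "cmod (a p t) \<le> c * trip_norm T \<sigma> p" if t: "t \<in> {-T..T}" for p t
  proof -
    have "cmod (a p t) \<le> real (m + 1) * (cmod (G0t \<mu> \<sigma> p (t / sqrt (real (m + 1)))) + cmod (G0t \<mu> \<sigma> p (t / sqrt (real m))))"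
      unfolding a_def by (rule psi0_Hgen_le[OF assms(3)])
    also have "\<dots> \<le> real (m + 1) * (trip_norm T \<sigma> p + trip_norm T \<sigma> p)"
      using assms t scale_mem[of m t T] scale_mem[of "m + 1" t T] by (intro mult_left_mono add_mono norm_G0t_le) auto
    finally show ?thesis by (simp add: c_def algebra_simps)
  qed
  have diff: "a q t - a p t = a (q - p) t" for p q t
    unfolding a_def right_diff_distrib[symmetric] Hgen_diff G0t_diff ..
  have "isCont (\<lambda>p. wint T \<beta> (a p)) p" for p
    unfolding isCont_def
  proof (rule Lim_transform[OF tendsto_const])
    let ?d = "\<lambda>q. c * trip_norm T \<sigma> (q - p)"
    have bnd: "norm (wint T \<beta> (a q) - wint T \<beta> (a p)) \<le> 2 * T * (?d q * (2 * (c * trip_norm T \<sigma> p) + ?d q))" for q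
      using wint_diff_le[OF assms(1,4) cont[of p] cont[of q], of "?d q" "c * trip_norm T \<sigma> p"] le
      unfolding diff real_norm_def by simp
    have "((\<lambda>q. 2 * T * (?d q * (2 * (c * trip_norm T \<sigma> p) + ?d q))) \<longlongrightarrow> 2 * T * (c * 0 * (2 * (c * trip_norm T \<sigma> p) + c * 0))) (at p)"
      by (intro tendsto_intros trip_norm_tendsto)
    then have "((\<lambda>q. 2 * T * (?d q * (2 * (c * trip_norm T \<sigma> p) + ?d q))) \<longlongrightarrow> 0) (at p)"
      by simp
    then show "((\<lambda>q. wint T \<beta> (a q) - wint T \<beta> (a p)) \<longlongrightarrow> 0) (at p)"
      by (rule Lim_null_comparison[rotated]) (use bnd in auto)
  qed
  then show ?thesis
    by (simp add: continuous_on_eq_continuous_at Qgen_eq_wint a_def [abs_def])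
qed

section \<open>The empirical triple as a function of the sample\<close>

lemma ext_cont_in_bcontfun:
  fixes f :: "real \<Rightarrow> complex"
  assumes f: "continuous_on UNIV f"
  shows "ext_cont f a b \<in> bcontfun"
proof -
  have f': "continuous_on (cbox a b) f" by (rule continuous_on_subset[OF f]) simp
  show ?thesis
    using f'
    by (auto intro!: continuous_on_ext_cont simp: bcontfun_def)
       (auto simp: ext_cont_def intro!: clamp_bounded compact_imp_bounded[OF compact_continuous_image] f')
qed

lemma continuous_psiN[continuous_intros]: "continuous_on S (\<lambda>t. psiN \<mu> \<sigma> t)"
  unfolding psiN_def divide_inverse by (intro continuous_intros)

lemma apply_ecf_proc:
  "apply_bcontfun (ecf_proc \<mu> \<sigma> a n xs) = ext_cont (\<lambda>t. complex_of_real (sqrt n) * (ecf n xs t - psiN \<mu> \<sigma> t)) (-a) a"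
  unfolding ecf_proc_def by (intro Bcontfun_inverse ext_cont_in_bcontfun continuous_intros)

definition sample_map :: "real \<Rightarrow> real \<Rightarrow> real \<Rightarrow> nat \<Rightarrow> (nat \<Rightarrow> real) \<Rightarrow> (real \<Rightarrow>\<^sub>C complex) \<times> real \<times> real" where
  "sample_map \<mu> \<sigma> T n xs = (ecf_proc \<mu> \<sigma> (T / \<sigma>) n xs, sqrt n * (smean n xs - \<mu>), sqrt n * (ssd n xs - \<sigma>))"

text \<open>Borel measurability of the triple is derived from this continuity: the bounded
  continuous functions on the line form a non-separable space, so measurability of all evaluations
  is not enough by itself. The process component is Lipschitz in each observation because its
  argument is clamped to \<open>[-a, a]\<close>.\<close>

lemma continuous_sample_map:
  assumes "T > 0" "\<sigma> > 0"
  shows "continuous_on UNIV (sample_map \<mu> \<sigma> T n)"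
proof -
  define a where "a = T / \<sigma>"
  have a: "a > 0" using assms by (simp add: a_def)
  have coord: "continuous_on UNIV (\<lambda>xs :: nat \<Rightarrow> real. xs k)" for k
    by (rule continuous_on_product_then_coordinatewise[OF continuous_on_id])
  have sm: "continuous_on UNIV (\<lambda>xs. smean n xs)"
    unfolding smean_def divide_inverse by (intro continuous_intros coord)
  have sd: "continuous_on UNIV (\<lambda>xs. ssd n xs)"
    unfolding ssd_def divide_inverse by (intro continuous_intros coord sm)
  have "isCont (ecf_proc \<mu> \<sigma> a n) xs" for xs
    unfolding isCont_def
  proof (rule metric_tendsto_imp_tendsto)
    let ?b = "\<lambda>ys. sqrt n * (a * (\<Sum>k<n. \<bar>ys k - xs k\<bar>) / n)"
    have "isCont ?b xs"
    proof -
      have "isCont (\<lambda>xs :: nat \<Rightarrow> real. xs k) xs" for k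
        using coord[of k] unfolding continuous_on_eq_continuous_at[OF open_UNIV] by blast
      then show ?thesis
        unfolding divide_inverse by (intro continuous_intros)
    qed
    then show "(?b \<longlongrightarrow> 0) (at xs)"
      by (simp add: isCont_def)
    have "dist (ecf_proc \<mu> \<sigma> a n ys) (ecf_proc \<mu> \<sigma> a n xs) \<le> ?b ys" for ys
    proof (rule dist_bound)
      fix t
      define s where "s = clamp (- a) a t"
      have s: "\<bar>s\<bar> \<le> a"
        using clamp_in_interval[of "- a" a t] a by (simp add: s_def abs_le_iff)
      have "dist (apply_bcontfun (ecf_proc \<mu> \<sigma> a n ys) t) (apply_bcontfun (ecf_proc \<mu> \<sigma> a n xs) t) = sqrt n * cmod ((\<Sum>k<n. iexp (s * ys k) - iexp (s * xs k)) / of_nat n)"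
        by (simp add: apply_ecf_proc ext_cont_def s_def [symmetric] dist_norm right_diff_distrib [symmetric] norm_mult
            ecf_def sum_subtractf diff_divide_distrib)
      also have "\<dots> \<le> sqrt n * ((\<Sum>k<n. a * \<bar>ys k - xs k\<bar>) / n)"
      proof (intro mult_left_mono norm_avg_le)
        fix k
        show "cmod (iexp (s * ys k) - iexp (s * xs k)) \<le> a * \<bar>ys k - xs k\<bar>"
          using norm_iexp_diff_le[of "s * ys k" "s * xs k"] mult_right_mono[OF s, of "\<bar>ys k - xs k\<bar>"]
          unfolding right_diff_distrib[symmetric] abs_mult by linarith
      qed simp
      finally show "dist (apply_bcontfun (ecf_proc \<mu> \<sigma> a n ys) t) (apply_bcontfun (ecf_proc \<mu> \<sigma> a n xs) t) \<le> ?b ys"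
        by (simp add: sum_distrib_left)
    qed
    moreover have "?b ys \<le> dist (?b ys) 0" for ys
      unfolding dist_real_def diff_0_right by (rule abs_ge_self)
    ultimately show "\<forall>\<^sub>F ys in at xs. dist (ecf_proc \<mu> \<sigma> a n ys) (ecf_proc \<mu> \<sigma> a n xs) \<le> dist (?b ys) 0"
      by (intro always_eventually allI) (rule order_trans)
  qed
  then have "continuous_on UNIV (ecf_proc \<mu> \<sigma> a n)"
    by (simp add: continuous_on_eq_continuous_at)
  then show ?thesis
    unfolding sample_map_def a_def [symmetric] by (intro continuous_intros sm sd)
qed

text \<open>The phase factor and the rescaled argument undo the affine change of variables, so the
  image of the empirical triple is the linearization with no error term. For \<open>t\<close> in
  \<open>[-T, T]\<close> the argument \<open>t / \<sigma>\<close> stays where the constant extension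
  is inactive.\<close>

lemma G0t_sample_map:
  assumes n: "n \<ge> 1" and \<sigma>: "\<sigma> > 0" and t: "t \<in> {-T..T}"
  shows "G0t \<mu> \<sigma> (sample_map \<mu> \<sigma> T n (\<lambda>k. \<mu> + \<sigma> * zs k)) t = lin_proc n zs t"
proof -
  define xs where "xs = (\<lambda>k. \<mu> + \<sigma> * zs k)"
  have "t / \<sigma> \<in> cbox (- (T / \<sigma>)) (T / \<sigma>)"
    using divide_right_mono[of "- T" t \<sigma>] divide_right_mono[of t T \<sigma>] t \<sigma> by (simp only: cbox_interval atLeastAtMost_iff minus_divide_left)
  then have e: "apply_bcontfun (ecf_proc \<mu> \<sigma> (T / \<sigma>) n xs) (t / \<sigma>) = complex_of_real (sqrt n) * (ecf n xs (t / \<sigma>) - psiN \<mu> \<sigma> (t / \<sigma>))"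
    by (simp add: apply_ecf_proc)
  have "exp (- \<i> * complex_of_real (t * \<mu> / \<sigma>)) * iexp (t / \<sigma> * xs k) = iexp (t * zs k)" for k
    using \<sigma> by (simp add: xs_def exp_add [symmetric] field_simps)
  then have 1: "exp (- \<i> * complex_of_real (t * \<mu> / \<sigma>)) * ecf n xs (t / \<sigma>) = ecf n zs t"
    by (simp add: ecf_def sum_distrib_left)
  have "exp (- \<i> * complex_of_real (t * \<mu> / \<sigma>)) * psiN \<mu> \<sigma> (t / \<sigma>) = exp (- complex_of_real (\<sigma>\<^sup>2 * (t / \<sigma>)\<^sup>2 / 2))"
    unfolding psiN_def exp_add [symmetric] by (simp add: field_simps)
  also have "\<sigma>\<^sup>2 * (t / \<sigma>)\<^sup>2 / 2 = t\<^sup>2 / 2"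
    using \<sigma> by (simp add: power_divide)
  also have "exp (- complex_of_real (t\<^sup>2 / 2)) = complex_of_real (psi0 t)"
    by (simp add: psi0_def exp_of_real [symmetric])
  finally have 2: "exp (- \<i> * complex_of_real (t * \<mu> / \<sigma>)) * psiN \<mu> \<sigma> (t / \<sigma>) = complex_of_real (psi0 t)" .
  have 3: "exp (- \<i> * complex_of_real (t * \<mu> / \<sigma>)) * apply_bcontfun (ecf_proc \<mu> \<sigma> (T / \<sigma>) n xs) (t / \<sigma>) = complex_of_real (sqrt n) * (ecf n zs t - complex_of_real (psi0 t))"
    unfolding e 1 [symmetric] 2 [symmetric] by (simp add: algebra_simps)
  have 4: "t / \<sigma> * psi0 t * (sqrt n * (smean n xs - \<mu>)) = sqrt n * (t * psi0 t * smean n zs)"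
    using n \<sigma> by (simp add: xs_def smean_affine)
  have 5: "t\<^sup>2 / \<sigma> * psi0 t * (sqrt n * (ssd n xs - \<sigma>)) = sqrt n * (t\<^sup>2 * psi0 t * (ssd n zs - 1))"
  proof -
    have "ssd n xs - \<sigma> = \<sigma> * (ssd n zs - 1)"
      using n \<sigma> by (simp add: xs_def ssd_affine algebra_simps)
    then show ?thesis using \<sigma> by simp
  qed
  show ?thesis
    unfolding xs_def [symmetric] sample_map_def fst_conv snd_conv G0_def 3 4 5 lin_proc_def
    by (simp add: algebra_simps)
qed

lemma Re_Hgen_lin_proc:
  assumes n: "n \<ge> 1" and m: "m \<ge> 1"
  shows "Re (Hgen (lin_proc n zs) m t) = (\<Sum>k<n. Re (Hgen (\<lambda>s. iexp (s * zs k) - complex_of_real (psi0 s)) m t)) / sqrt n"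
proof -
  have one: "Re (of_nat j * lin_proc n zs (t / sqrt (real j)) / complex_of_real (psi0 (t / sqrt (real j))))
     = (\<Sum>k<n. Re (of_nat j * (iexp (t / sqrt (real j) * zs k) - complex_of_real (psi0 (t / sqrt (real j)))) / complex_of_real (psi0 (t / sqrt (real j))))) / sqrt n
       + sqrt n * (t\<^sup>2 * (ssd n zs - 1))" if j: "j \<ge> 1" for j :: nat
  proof -
    define s where "s = t / sqrt (real j)"
    \<comment> \<open>The value does not depend on \<open>j\<close>: the contributions of the
      standard deviation for \<open>j = m\<close> and \<open>j = m + 1\<close> coincide and cancel
      in the difference.\<close>
    have s2: "real j * s\<^sup>2 = t\<^sup>2" using j by (simp add: s_def power_divide)
    have p: "psi0 s > 0" by (rule psi0_pos)
    have sn: "sqrt n * (c / n) = c / sqrt n" for c :: real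
      using n by (simp add: field_simps flip: real_sqrt_mult_self[of n])
    have Re_lin: "Re (lin_proc n zs s) = sqrt n * ((\<Sum>k<n. cos (s * zs k) - psi0 s) / n) + sqrt n * (s\<^sup>2 * psi0 s * (ssd n zs - 1))"
      using n by (simp add: lin_proc_def ecf_def Re_exp sum_subtractf diff_divide_distrib distrib_left)
    have "Re (of_nat j * lin_proc n zs s / complex_of_real (psi0 s)) = real j / psi0 s * ((\<Sum>k<n. cos (s * zs k) - psi0 s) / sqrt n) + sqrt n * ((real j * s\<^sup>2) * (ssd n zs - 1))"
    proof -
      have gen: "real j * (C + r * (u * w * D)) / w = real j / w * C + r * ((real j * u) * D)" if "w > 0" for C r u w D :: real
        using that by (simp add: field_simps)
      have "Re (of_nat j * lin_proc n zs s / complex_of_real (psi0 s)) = real j * Re (lin_proc n zs s) / psi0 s"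
        by simp
      then show ?thesis
        unfolding Re_lin sn gen[OF p] .
    qed
    also have "\<dots> = (\<Sum>k<n. real j / psi0 s * (cos (s * zs k) - psi0 s)) / sqrt n + sqrt n * (t\<^sup>2 * (ssd n zs - 1))"
      unfolding s2 by (simp add: sum_distrib_left)
    also have "(\<Sum>k<n. real j / psi0 s * (cos (s * zs k) - psi0 s)) = (\<Sum>k<n. Re (of_nat j * (iexp (s * zs k) - complex_of_real (psi0 s)) / complex_of_real (psi0 s)))"
      by (intro sum.cong refl) (simp add: Re_exp field_simps)
    finally show ?thesis unfolding s_def .
  qed
  have "Re (Hgen (lin_proc n zs) m t) =
     Re (of_nat (m + 1) * lin_proc n zs (t / sqrt (real (m + 1))) / complex_of_real (psi0 (t / sqrt (real (m + 1)))))
   - Re (of_nat m * lin_proc n zs (t / sqrt (real m)) / complex_of_real (psi0 (t / sqrt (real m))))"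
    unfolding Hgen_def minus_complex.sel ..
  also have "\<dots> = ((\<Sum>k<n. Re (of_nat (m + 1) * (iexp (t / sqrt (real (m + 1)) * zs k) - complex_of_real (psi0 (t / sqrt (real (m + 1))))) / complex_of_real (psi0 (t / sqrt (real (m + 1))))))
      - (\<Sum>k<n. Re (of_nat m * (iexp (t / sqrt (real m) * zs k) - complex_of_real (psi0 (t / sqrt (real m)))) / complex_of_real (psi0 (t / sqrt (real m)))))) / sqrt n"
    using one[OF m] one[of "m + 1"] by (simp only: diff_divide_distrib)
  finally show ?thesis
    unfolding Hgen_def minus_complex.sel sum_subtractf .
qed

subsection \<open>Non-degeneracy of the limit\<close>

text \<open>The contribution of one observation to \<^const>\<open>lfun\<close> of the linearized process.\<close>
definition hsm :: "real \<Rightarrow> real \<Rightarrow> nat \<Rightarrow> real \<Rightarrow> real" where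
  "hsm T \<beta> m z = lfun T \<beta> m (\<lambda>s. iexp (s * z) - complex_of_real (psi0 s))"

lemma continuous_kernel: "continuous_on S (\<lambda>s. iexp (s * z) - complex_of_real (psi0 s))"
  by (intro continuous_intros)

lemma norm_kernel_le: "cmod (iexp (s * z) - complex_of_real (psi0 s)) \<le> 2"
  using norm_triangle_ineq4[of "iexp (s * z)" "complex_of_real (psi0 s)"] psi0_pos[of s] psi0_le_1[of s] by simp

lemma continuous_lin_proc': "continuous_on S (lin_proc n zs)"
  by (intro continuous_intros)

lemma lfun_lin_proc:
  assumes n: "n \<ge> 1" and m: "m \<ge> 1"
  shows "lfun T \<beta> m (lin_proc n zs) = (\<Sum>k<n. hsm T \<beta> m (zs k)) / sqrt n"
proof -
  let ?r = "\<lambda>k t. wt \<beta> t * (psi0 t)\<^sup>2 * Re (Hgen (\<lambda>s. iexp (s * zs k) - complex_of_real (psi0 s)) m t)"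
  have "lfun T \<beta> m (lin_proc n zs) = (\<integral>t. (\<Sum>k<n. ?r k t) / sqrt n \<partial>Leb T)"
    unfolding lfun_eq_Leb[OF continuous_lin_proc'] Re_Hgen_lin_proc[OF n m] by (simp add: sum_distrib_left)
  also have "\<dots> = (\<Sum>k<n. \<integral>t. ?r k t \<partial>Leb T) / sqrt n"
    unfolding integral_divide_zero
    by (subst Bochner_Integration.integral_sum) (rule integrable_Leb[OF continuous_lfun_integrand[OF continuous_kernel]], rule refl)
  finally show ?thesis
    unfolding hsm_def lfun_eq_Leb[OF continuous_kernel] .
qed

text \<open>The tangent to \<open>x ^ (p + 2)\<close> at \<open>a > 1\<close>, evaluated at
  \<open>x = 1\<close>, lies strictly below the graph.\<close>

lemma strict_tangent_power:
  fixes a :: real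
  assumes "a > 1"
  shows "real (Suc (Suc p)) * a ^ Suc p < real (Suc p) * a ^ Suc (Suc p) + 1"
proof (induction p)
  case 0
  have "0 < (a - 1)\<^sup>2" using assms by simp
  then show ?case unfolding power2_diff by (simp add: power2_eq_square)
next
  case (Suc p)
  have "a * (real (Suc (Suc p)) * a ^ Suc p) < a * (real (Suc p) * a ^ Suc (Suc p) + 1)"
    using Suc.IH assms by (intro mult_strict_left_mono) auto
  moreover have "0 < (a - 1) * (a ^ Suc (Suc p) - 1)"
    using assms one_less_power[of a "Suc (Suc p)"] by (intro mult_pos_pos) auto
  ultimately show ?case
    by (simp add: algebra_simps)
qed

context
  fixes T \<beta> :: real and m :: nat
  assumes T: "T > 0" and \<beta>: "\<beta> \<ge> 0" and m: "m \<ge> 1"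
begin

lemma abs_hsm_le: "\<bar>hsm T \<beta> m z\<bar> \<le> 2 * T * (2 * real (m + 1) * 2)"
  unfolding hsm_def by (rule lfun_le[OF T m \<beta> continuous_kernel norm_kernel_le])

text \<open>On \<open>[-T, T]\<close> the kernel is Lipschitz in \<open>z\<close> with constant
  \<open>T\<close>, and \<open>lfun\<close> is linear and bounded. Continuity spreads the
  non-vanishing at 0 to an interval of positive measure.\<close>

lemma continuous_hsm: "continuous_on UNIV (hsm T \<beta> m)"
proof (rule lipschitz_on_continuous_on)
  show "(2 * T * (2 * real (m + 1) * T))-lipschitz_on UNIV (hsm T \<beta> m)"
  proof (rule lipschitz_onI)
    fix z z' :: real
    have "hsm T \<beta> m z - hsm T \<beta> m z' = lfun T \<beta> m (\<lambda>s. iexp (s * z) - iexp (s * z'))"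
      unfolding hsm_def by (subst lfun_diff[OF continuous_kernel continuous_kernel]) simp
    also have "\<bar>\<dots>\<bar> \<le> 2 * T * (2 * real (m + 1) * (T * \<bar>z - z'\<bar>))"
    proof (rule lfun_le[OF T m \<beta>])
      show "continuous_on UNIV (\<lambda>s. iexp (s * z) - iexp (s * z'))" by (intro continuous_intros)
      fix s assume "s \<in> {-T..T}"
      then have s: "\<bar>s\<bar> \<le> T" by (simp add: abs_le_iff)
      show "cmod (iexp (s * z) - iexp (s * z')) \<le> T * \<bar>z - z'\<bar>"
        using norm_iexp_diff_le[of "s * z" "s * z'"] mult_right_mono[OF s, of "\<bar>z - z'\<bar>"]
        unfolding right_diff_distrib[symmetric] abs_mult by linarith
    qed
    finally show "dist (hsm T \<beta> m z) (hsm T \<beta> m z') \<le> 2 * T * (2 * real (m + 1) * T) * dist z z'"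
      by (simp add: dist_real_def mult_ac)
  qed (use T in auto)
qed

lemma measurable_hsm[measurable]: "hsm T \<beta> m \<in> borel_measurable borel"
  by (rule borel_measurable_continuous_onI[OF continuous_hsm])

lemma integrable_hsm_power: "integrable std_normal_distribution (\<lambda>z. hsm T \<beta> m z ^ p)"
proof -
  interpret N: prob_space std_normal_distribution by (rule prob_space_normal_density) simp
  show ?thesis
    using abs_hsm_le
    by (intro N.integrable_const_bound[where B = "(2 * T * (2 * real (m + 1) * 2)) ^ p"])
       (auto simp: power_abs intro!: AE_I2 power_mono)
qed

text \<open>At \<open>z = 0\<close> the kernel is \<open>r (m + 1) - r m\<close> with \<open>r k = k (exp (t\<^sup>2 / (2 k)) - 1)\<close>, which is
  strictly decreasing in \<open>k\<close> by strict convexity of the exponential.\<close>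
lemma kernel_0_neg:
  assumes "t \<noteq> 0"
  shows "Re (Hgen (\<lambda>s. iexp (s * 0) - complex_of_real (psi0 s)) m t) < 0"
proof -
  obtain p where p: "m = Suc p" using m by (cases m) auto
  \<comment> \<open>A common base: \<open>1 / (m + 1)\<close> and \<open>1 / m\<close> are integer
    multiples of \<open>1 / (m * (m + 1))\<close>, so both exponentials become powers of
    \<open>a\<close>.\<close>
  define a where "a = exp (t\<^sup>2 / 2 / (real m * real (m + 1)))"
  have a1: "a > 1" using assms m by (simp add: a_def)
  have inv: "1 / psi0 (t / sqrt (real k)) = exp (t\<^sup>2 / 2 / real k)" for k :: nat
    by (simp add: psi0_def power_divide exp_minus field_simps)
  have em: "exp (t\<^sup>2 / 2 / real (m + 1)) = a ^ m" "exp (t\<^sup>2 / 2 / real m) = a ^ (m + 1)"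
  proof -
    have "u / y = x * (u / (x * y))" if "x > 0" for x y u :: real
      using that by simp
    from this[of "real m" "t\<^sup>2 / 2" "real (m + 1)"] this[of "real (m + 1)" "t\<^sup>2 / 2" "real m"] m
    have "t\<^sup>2 / 2 / real (m + 1) = real m * (t\<^sup>2 / 2 / (real m * real (m + 1)))"
      "t\<^sup>2 / 2 / real m = real (m + 1) * (t\<^sup>2 / 2 / (real (m + 1) * real m))"
      by simp_all
    then show "exp (t\<^sup>2 / 2 / real (m + 1)) = a ^ m" "exp (t\<^sup>2 / 2 / real m) = a ^ (m + 1)"
      unfolding a_def exp_of_nat_mult[symmetric] by (simp_all only: mult.commute[of "real (m + 1)" "real m"])
  qed
  have one: "Re (of_nat k * (iexp (t / sqrt (real k) * 0) - complex_of_real (psi0 (t / sqrt (real k)))) / complex_of_real (psi0 (t / sqrt (real k))))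
     = real k * (1 / psi0 (t / sqrt (real k)) - 1)" for k :: nat
    using psi0_pos[of "t / sqrt (real k)"] by (simp add: field_simps)
  have "Re (Hgen (\<lambda>s. iexp (s * 0) - complex_of_real (psi0 s)) m t) = real (m + 1) * (a ^ m - 1) - real m * (a ^ (m + 1) - 1)"
    unfolding Hgen_def minus_complex.sel one inv em ..
  also have "\<dots> < 0"
    using strict_tangent_power[OF a1, of p] by (simp add: p algebra_simps)
  finally show ?thesis .
qed

text \<open>The point 0 is chosen because the integrand has constant sign there. If its integral
  were zero, continuity would make it vanish everywhere, in particular at \<open>t = T\<close>,
  where it is strictly negative.\<close>

lemma hsm_0_neq: "hsm T \<beta> m 0 \<noteq> 0"
proof
  let ?k = "\<lambda>t. Re (Hgen (\<lambda>s. iexp (s * 0) - complex_of_real (psi0 s)) m t)"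
  let ?f = "\<lambda>t. - (wt \<beta> t * (psi0 t)\<^sup>2 * ?k t)"
  assume "hsm T \<beta> m 0 = 0"
  then have "integral {-T..T} ?f = 0"
    unfolding hsm_def lfun_def by (simp only: integral_neg)
  moreover have k: "?k t \<le> 0" for t
  proof (cases "t = 0")
    case True
    then show ?thesis by (simp add: Hgen_def psi0_def)
  qed (use kernel_0_neg[of t] in auto)
  have "0 \<le> ?f t" for t
    using k[of t] wt_bounds[OF \<beta>, of t] by (simp add: mult_nonneg_nonpos)
  ultimately have "\<forall>t\<in>{-T..T}. ?f t = 0"
    using T by (subst (asm) integral_eq_0_iff) (auto intro!: continuous_on_minus continuous_lfun_integrand continuous_intros)
  then have "?f T = 0" using T by auto
  moreover have "?f T > 0"
    using kernel_0_neg[of T] T psi0_pos[of T] by (simp add: mult_pos_neg wt_def)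
  ultimately show False by linarith
qed

text \<open>The kernel is centred for each fixed \<open>t\<close>, and Fubini exchanges the
  integrals; a bounded integrand on a finite product measure is integrable.\<close>

lemma integral_hsm: "(\<integral>z. hsm T \<beta> m z \<partial>std_normal_distribution) = 0"
proof -
  interpret N: prob_space std_normal_distribution by (rule prob_space_normal_density) simp
  interpret L: finite_measure "Leb T" by (rule finite_measure_Leb)
  interpret pair_sigma_finite std_normal_distribution "Leb T" ..
  interpret PF: finite_measure "std_normal_distribution \<Otimes>\<^sub>M Leb T"
    by (rule finite_measure_pair_measure) unfold_locales
  let ?V = "\<lambda>z s. iexp (s * z) - complex_of_real (psi0 s)"
  let ?f = "\<lambda>z t. wt \<beta> t * (psi0 t)\<^sup>2 * Re (Hgen (?V z) m t)"
  have meas: "(\<lambda>p. ?f (fst p) (snd p)) \<in> borel_measurable (std_normal_distribution \<Otimes>\<^sub>M lborel)"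
    unfolding Hgen_def by measurable
  have "integrable (std_normal_distribution \<Otimes>\<^sub>M Leb T) (\<lambda>p. ?f (fst p) (snd p))"
  proof (rule PF.integrable_const_bound[where B = "2 * real (m + 1) * 2"])
    have "\<bar>?f z t\<bar> \<le> 2 * real (m + 1) * 2" if "t \<in> {-T..T}" for z t
      by (rule lfun_integrand_le[OF m \<beta> that norm_kernel_le])
    then show "AE p in std_normal_distribution \<Otimes>\<^sub>M Leb T. norm (?f (fst p) (snd p)) \<le> 2 * real (m + 1) * 2"
      unfolding real_norm_def by (intro AE_I2) (simp only: space_pair_measure space_restrict_space, force)
  qed (rule measurable_pair_Leb[OF meas])
  then have int: "integrable (std_normal_distribution \<Otimes>\<^sub>M Leb T) (\<lambda>(z, t). ?f z t)"
    by (simp add: split_beta')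
  have V: "integrable std_normal_distribution (\<lambda>z. ?V z s)" "(\<integral>z. ?V z s \<partial>std_normal_distribution) = 0" for s
    using has_bochner_integral_iexp_minus_psi0[of s] by (auto simp: has_bochner_integral_iff)
  have H: "integrable std_normal_distribution (\<lambda>z. Hgen (?V z) m t)" "(\<integral>z. Hgen (?V z) m t \<partial>std_normal_distribution) = 0" for t
  proof -
    have "integrable std_normal_distribution (\<lambda>z. c * f z / d - c' * g z / d') \<and> (\<integral>z. c * f z / d - c' * g z / d' \<partial>std_normal_distribution) = 0"
      if "integrable std_normal_distribution f" "(\<integral>z. f z \<partial>std_normal_distribution) = 0"
        "integrable std_normal_distribution g" "(\<integral>z. g z \<partial>std_normal_distribution) = 0" for f g :: "real \<Rightarrow> complex" and c d c' d'
      using that by simp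
    from this[OF V V] show "integrable std_normal_distribution (\<lambda>z. Hgen (?V z) m t)" "(\<integral>z. Hgen (?V z) m t \<partial>std_normal_distribution) = 0"
      unfolding Hgen_def by blast+
  qed
  have zero: "(\<integral>z. ?f z t \<partial>std_normal_distribution) = 0" for t
    using H[of t] by simp
  have "(\<integral>z. hsm T \<beta> m z \<partial>std_normal_distribution) = (\<integral>z. (\<integral>t. ?f z t \<partial>Leb T) \<partial>std_normal_distribution)"
    unfolding hsm_def lfun_eq_Leb[OF continuous_kernel] ..
  also have "\<dots> = (\<integral>t. (\<integral>z. ?f z t \<partial>std_normal_distribution) \<partial>Leb T)"
    by (rule Fubini_integral[OF int, symmetric])
  also have "\<dots> = 0"
    unfolding zero by simp
  finally show ?thesis .
qed

lemma hsm_variance_pos: "(\<integral>z. (hsm T \<beta> m z)\<^sup>2 \<partial>std_normal_distribution) > 0"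
proof -
  have "0 \<le> (\<integral>z. (hsm T \<beta> m z)\<^sup>2 \<partial>std_normal_distribution)"
    by simp
  moreover have "(\<integral>z. (hsm T \<beta> m z)\<^sup>2 \<partial>std_normal_distribution) \<noteq> 0"
    using std_normal_integral_eq_0D[of "\<lambda>z. (hsm T \<beta> m z)\<^sup>2" 0] hsm_0_neq integrable_hsm_power[of 2]
      continuous_on_power[OF continuous_hsm] by auto
  ultimately show ?thesis by linarith
qed

end

section \<open>Central limit theorem for the linear statistic and positive limit variance\<close>

context std_normal_sample
begin

text \<open>The classical theorem normalizes by \<open>sqrt (n * v)\<close>, with the variance
  positive by \<open>hsm_variance_pos\<close>; the factor \<open>sqrt v\<close> is moved into the
  test function.\<close>

lemma hsm_clt:
  fixes f :: "real \<Rightarrow> real"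
  assumes "T > 0" "\<beta> \<ge> 0" "m \<ge> 1" and f: "continuous_on UNIV f" "bounded (range f)"
  defines "v \<equiv> \<integral>z. (hsm T \<beta> m z)\<^sup>2 \<partial>std_normal_distribution"
  shows "(\<lambda>n. expectation (\<lambda>x. f ((\<Sum>k<n. hsm T \<beta> m (Z k x)) / sqrt n))) \<longlonglongrightarrow> (\<integral>y. f (sqrt v * y) \<partial>std_normal_distribution)"
proof -
  note A = assms(1-3)
  note [measurable] = measurable_hsm[OF A]
  have v: "v > 0" unfolding v_def by (rule hsm_variance_pos[OF A])
  have mean: "expectation (\<lambda>x. hsm T \<beta> m (Z k x)) = 0" for k
    by (subst expectation_Z) (auto simp: integral_hsm[OF A])
  let ?W = "\<lambda>n x. (\<Sum>k<n. hsm T \<beta> m (Z k x)) / sqrt (n * (sqrt v)\<^sup>2)"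
  have conv: "weak_conv_m (\<lambda>n. distr M borel (?W n)) std_normal_distribution"
  proof (rule central_limit_theorem_zero_mean[where \<mu> = "distr std_normal_distribution borel (hsm T \<beta> m)"])
    show "indep_vars (\<lambda>i. borel) (\<lambda>k x. hsm T \<beta> m (Z k x)) UNIV"
      by (rule indep_vars_compose2[OF indep]) auto
    show "expectation (\<lambda>x. hsm T \<beta> m (Z k x)) = 0" for k by (rule mean)
    show "0 < sqrt v" using v by simp
    show "integrable M (\<lambda>x. (hsm T \<beta> m (Z k x))\<^sup>2)" for k
      using integrable_hsm_power[OF A, of 2] by (subst integrable_Z) auto
    show "variance (\<lambda>x. hsm T \<beta> m (Z k x)) = (sqrt v)\<^sup>2" for k
      unfolding mean using v expectation_Z[of "\<lambda>z. (hsm T \<beta> m z)\<^sup>2" k] by (simp add: v_def)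
    show "distr M borel (\<lambda>x. hsm T \<beta> m (Z k x)) = distr std_normal_distribution borel (hsm T \<beta> m)" for k
      unfolding distr_Z[of k, symmetric] by (subst distr_distr) (auto simp: comp_def)
  qed
  obtain B where B: "\<And>x. \<bar>f x\<bar> \<le> B" using f(2) unfolding bounded_iff by auto
  have [measurable]: "f \<in> borel_measurable borel" by (rule borel_measurable_continuous_onI[OF f(1)])
  have "(\<lambda>n. integral\<^sup>L (distr M borel (?W n)) (\<lambda>y. f (sqrt v * y))) \<longlonglongrightarrow> (\<integral>y. f (sqrt v * y) \<partial>std_normal_distribution)"
  proof (rule weak_conv_imp_integral_bdd_continuous_conv[OF _ _ conv])
    show "real_distribution (distr M borel (?W n))" for n
      by (rule real_distribution_distr) measurable
    show "real_distribution std_normal_distribution" by (rule real_dist_normal_dist)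
    show "isCont (\<lambda>y. f (sqrt v * y)) y" for y
      using continuous_on_compose2[OF f(1), of UNIV "\<lambda>y. sqrt v * y"]
      by (auto simp: continuous_on_eq_continuous_at intro!: continuous_intros)
    show "norm (f (sqrt v * y)) \<le> B" for y using B by simp
  qed
  moreover have "integral\<^sup>L (distr M borel (?W n)) (\<lambda>y. f (sqrt v * y)) = expectation (\<lambda>x. f ((\<Sum>k<n. hsm T \<beta> m (Z k x)) / sqrt n))" for n
    using v by (subst integral_distr) (auto simp: real_sqrt_mult)
  ultimately show ?thesis by simp
qed

text \<open>Zero variance would make \<open>Q\<close> almost surely constant and hence
  \<open>L\<close> almost surely bounded. Uniqueness of limits identifies the test integrals of
  \<open>L\<close> with those of a centred normal law of variance \<open>v > 0\<close>, whose
  support is unbounded.\<close>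

lemma limit_variance_pos:
  fixes N :: "'q measure" and Q L :: "'q \<Rightarrow> real"
  assumes "T > 0" "\<beta> \<ge> 0" "m \<ge> 1" and N: "prob_space N"
    and [measurable]: "L \<in> borel_measurable N"
    and weak: "\<And>f :: real \<Rightarrow> real. continuous_on UNIV f \<Longrightarrow> bounded (range f) \<Longrightarrow>
      (\<lambda>n. expectation (\<lambda>x. f ((\<Sum>k<n. hsm T \<beta> m (Z k x)) / sqrt n))) \<longlonglongrightarrow> (\<integral>y. f (L y) \<partial>N)"
    and LQ: "\<And>y. \<bar>L y\<bar> \<le> c + Q y" and Q: "integrable N Q" "integrable N (\<lambda>y. (Q y)\<^sup>2)"
  shows "(\<integral>y. (Q y - (\<integral>y. Q y \<partial>N))\<^sup>2 \<partial>N) > 0"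
proof (rule ccontr)
  interpret N: prob_space N by fact
  define \<mu> where "\<mu> = (\<integral>y. Q y \<partial>N)"
  define v where "v = (\<integral>z. (hsm T \<beta> m z)\<^sup>2 \<partial>std_normal_distribution)"
  have v: "v > 0" unfolding v_def by (rule hsm_variance_pos[OF assms(1-3)])
  have int: "integrable N (\<lambda>y. (Q y - \<mu>)\<^sup>2)"
    unfolding power2_diff using Q by (intro Bochner_Integration.integrable_add Bochner_Integration.integrable_diff integrable_mult_left integrable_mult_right) auto
  assume "\<not> (\<integral>y. (Q y - (\<integral>y. Q y \<partial>N))\<^sup>2 \<partial>N) > 0"
  moreover have "0 \<le> (\<integral>y. (Q y - \<mu>)\<^sup>2 \<partial>N)" by simp
  ultimately have "(\<integral>y. (Q y - \<mu>)\<^sup>2 \<partial>N) = 0"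
    unfolding \<mu>_def by linarith
  then have "AE y in N. (Q y - \<mu>)\<^sup>2 = 0"
    using integral_nonneg_eq_0_iff_AE[OF int] by auto
  then have bnd: "AE y in N. \<bar>L y\<bar> \<le> c + \<mu>"
  proof eventually_elim
    case (elim y)
    then show ?case using LQ[of y] by simp
  qed
  \<comment> \<open>Zero exactly where \<open>\<bar>y\<bar> \<le> c + \<mu>\<close>, and 1 as soon
    as \<open>\<bar>y\<bar>\<close> exceeds that bound by 1.\<close>
  define f where "f y = min 1 (max 0 (\<bar>y\<bar> - (c + \<mu>)))" for y :: real
  have fc: "continuous_on UNIV f" unfolding f_def by (intro continuous_intros)
  have fb: "\<bar>f y\<bar> \<le> 1" for y by (auto simp: f_def)
  have fbd: "bounded (range f)" by (rule boundedI[where B = 1]) (use fb in auto)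
  have [measurable]: "f \<in> borel_measurable borel" by (rule borel_measurable_continuous_onI[OF fc])
  have "(\<integral>y. f (L y) \<partial>N) = (\<integral>y. 0 \<partial>N)"
    by (intro integral_cong_AE) (use bnd in \<open>auto simp: f_def\<close>)
  moreover have "(\<integral>y. f (L y) \<partial>N) = (\<integral>y. f (sqrt v * y) \<partial>std_normal_distribution)"
    using LIMSEQ_unique[OF weak[OF fc fbd] hsm_clt[OF assms(1-3) fc fbd]] by (simp add: v_def)
  ultimately have 0: "(\<integral>y. f (sqrt v * y) \<partial>std_normal_distribution) = 0" by simp
  interpret S: prob_space std_normal_distribution by (rule prob_space_normal_density) simp
  have "f (sqrt v * y) = 0" for y
  proof (rule std_normal_integral_eq_0D[OF _ _ _ 0])
    show "continuous_on UNIV (\<lambda>y. f (sqrt v * y))"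
      by (rule continuous_on_compose2[OF fc]) (auto intro!: continuous_intros)
    show "integrable std_normal_distribution (\<lambda>y. f (sqrt v * y))"
      using fb by (intro S.integrable_const_bound[where B = 1]) auto
  qed (simp add: f_def)
  \<comment> \<open>A point at which the test function equals 1; the absolute value spares a sign
    discussion for \<open>c + \<mu>\<close>.\<close>
  from this[of "(\<bar>c + \<mu>\<bar> + 1) / sqrt v"] show False
    using v by (simp add: f_def)
qed

end

subsection \<open>Standardized statistics\<close>

lemma Max_continuous_on:
  fixes f :: "'i \<Rightarrow> 'c::topological_space \<Rightarrow> real"
  assumes "finite A" "A \<noteq> {}" "\<And>i. i \<in> A \<Longrightarrow> continuous_on S (f i)"
  shows "continuous_on S (\<lambda>x. Max ((\<lambda>i. f i x) ` A))"
  using assms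
proof (induction A rule: finite_ne_induct)
  case (insert i A)
  then have "continuous_on S (\<lambda>x. max (f i x) (Max ((\<lambda>i. f i x) ` A)))"
    by (intro continuous_on_max) auto
  with insert show ?case by simp
qed simp

lemma conv_distr_compose:
  fixes V :: "nat \<Rightarrow> 'p \<Rightarrow> 'c::metric_space" and g :: "'c \<Rightarrow> 'd::metric_space"
  assumes c: "conv_distr P V Q W" and V: "\<And>n. V n \<in> borel_measurable P" and W: "W \<in> borel_measurable Q"
    and g: "continuous_on UNIV g"
  shows "conv_distr P (\<lambda>n x. g (V n x)) Q (\<lambda>y. g (W y))"
proof -
  have gm: "g \<in> borel_measurable borel" by (rule borel_measurable_continuous_onI[OF g])
  have fg: "continuous_on UNIV (\<lambda>x. f (g x)) \<and> bounded (range (\<lambda>x. f (g x)))"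
    if "continuous_on UNIV f \<and> bounded (range f)" for f :: "'d \<Rightarrow> real"
    using that continuous_on_compose2[OF _ g, of UNIV f] by (auto intro: bounded_subset[of "range f"])
  show ?thesis
    using c fg unfolding conv_distr_iff[OF V W]
    by (subst conv_distr_iff) (auto intro: measurable_compose[OF V gm] measurable_compose[OF W gm])
qed

section \<open>Measurability of the statistics and the null model\<close>

lemma Deltam_eq_wint': "Deltam T \<beta> n xs m = wint T \<beta> (Dm n xs m)"
  by (simp add: Deltam_def wint_def)

lemma continuous_Dm: "continuous_on S (Dm n xs m)"
  unfolding Dm_def Sm_def divide_inverse by (intro continuous_intros)

lemma measurable_Deltam:
  assumes N: "prob_space N" and f: "\<And>k. f k \<in> borel_measurable N"
  shows "(\<lambda>x. Deltam T \<beta> n (\<lambda>k. f k x) m) \<in> borel_measurable N"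
proof -
  note [measurable] = measurable_compose[OF measurable_fst f]
  show ?thesis
    unfolding Deltam_eq_wint'
  proof (rule prob_space.measurable_wint[OF N _ continuous_Dm])
    show "(\<lambda>p. Dm n (\<lambda>k. f k (fst p)) m (snd p)) \<in> borel_measurable (N \<Otimes>\<^sub>M lborel)"
      unfolding Dm_def Sm_def
      by (intro borel_measurable_diff borel_measurable_power measurable_ecf_std) measurable
  qed
qed

lemma measurable_Qm:
  assumes N: "prob_space N" and f: "\<And>k. f k \<in> borel_measurable N"
  shows "(\<lambda>x. Qm T \<beta> n (\<lambda>k. f k x) m) \<in> borel_measurable N"
proof -
  note [measurable] = measurable_compose[OF measurable_fst f]
  show ?thesis
    unfolding Qm_def Qgen_eq_wint
  proof (rule prob_space.measurable_wint[OF N])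
    show "(\<lambda>p. complex_of_real (psi0 (snd p)) * Hgen (Uproc n (\<lambda>k. f k (fst p))) m (snd p)) \<in> borel_measurable (N \<Otimes>\<^sub>M lborel)"
      by (intro borel_measurable_times measurable_Hgen measurable_Uproc) measurable
    show "continuous_on {-T..T} (\<lambda>t. complex_of_real (psi0 t) * Hgen (Uproc n (\<lambda>k. f k x)) m t)" for x
      by (intro continuous_intros continuous_Hgen)
  qed
qed

lemma ecf_std_cong:
  assumes "\<And>k. k < n \<Longrightarrow> xs k = ys k"
  shows "ecf_std n xs = ecf_std n ys"
proof -
  have 1: "smean n xs = smean n ys"
    unfolding smean_def using assms by (auto intro!: sum.cong)
  have 2: "ssd n xs = ssd n ys"
    unfolding ssd_def 1 using assms by (auto intro!: sum.cong)
  show ?thesis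
    unfolding ecf_std_eq [abs_def] std_obs_def 1 2 using assms by (auto intro!: sum.cong)
qed

lemma stat_cong:
  assumes "ecf_std n xs = ecf_std n ys"
  shows "Deltam T \<beta> n xs m = Deltam T \<beta> n ys m" "Qm T \<beta> n xs m = Qm T \<beta> n ys m"
  using assms by (simp_all add: Deltam_def Dm_def Sm_def Qm_def Uproc_def [abs_def])

lemma prob_space_H0: "prob_space (H0 n)"
  unfolding H0_def by (rule prob_space_PiM) (rule prob_space_normal_density, simp)

lemma measurable_H0_coordinate: "(\<lambda>xs. xs k) \<in> borel_measurable (H0 n)"
proof (cases "k < n")
  case True
  then have "(\<lambda>xs. xs k) \<in> measurable (H0 n) std_normal_distribution"
    unfolding H0_def by (intro measurable_component_singleton) simp
  then show ?thesis by (simp cong: measurable_cong_sets)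
next
  case False
  have "(\<lambda>xs. undefined) \<in> borel_measurable (H0 n)" by simp
  \<comment> \<open>Points of the finite product are \<open>undefined\<close> outside
    \<open>{..<n}\<close>, so the later coordinates are constant there.\<close>
  moreover have "xs k = undefined" if "xs \<in> space (H0 n)" for xs
    using that False by (auto simp: H0_def space_PiM PiE_def extensional_def)
  ultimately show ?thesis
    using measurable_cong[of "H0 n" "\<lambda>xs. xs k" "\<lambda>_. undefined" borel] by blast
qed

lemma EH0_cmult: "EH0 n (\<lambda>xs. c * f xs) = c * EH0 n f"
  by (simp add: EH0_def)

lemma VarH0_cmult: "VarH0 n (\<lambda>xs. c * f xs) = c\<^sup>2 * VarH0 n f"
  by (simp add: VarH0_def EH0_cmult right_diff_distrib [symmetric] power_mult_distrib)

text \<open>Standardization ignores positive factors, so \<open>Deltam\<close>, which is of order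
  \<open>1 / n\<close>, may be replaced by \<open>n\<close> times itself, which has a non-degenerate
  limit.\<close>

lemma standardize_cmult: "c > 0 \<Longrightarrow> standardize n (\<lambda>xs. c * f xs) xs = standardize n f xs"
  by (simp add: standardize_def EH0_cmult VarH0_cmult real_sqrt_mult right_diff_distrib [symmetric])

context std_normal_sample
begin

text \<open>By independence the first \<open>n\<close> variables have joint law \<open>H0 n\<close>.
  A point of that product is \<open>undefined\<close> from index \<open>n\<close> on, whereas
  \<open>Zs x\<close> continues, hence the assumption that \<open>f\<close> sees the first
  \<open>n\<close> entries alone. The characterization of independence by product laws asks for a
  nonempty index set.\<close>

lemma EH0_eq:
  assumes n: "n \<ge> 1" and f: "f \<in> borel_measurable (H0 n)"
    and dep: "\<And>xs ys. (\<And>k. k < n \<Longrightarrow> xs k = ys k) \<Longrightarrow> f xs = f ys"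
  shows "EH0 n f = expectation (\<lambda>x. f (Zs x))"
proof -
  let ?r = "\<lambda>x. \<lambda>k\<in>{..<n}. Z k x"
  have "distr M (\<Pi>\<^sub>M k\<in>{..<n}. borel) ?r = (\<Pi>\<^sub>M k\<in>{..<n}. distr M borel (Z k))"
    using n indep_vars_subset[OF indep, of "{..<n}"]
    by (subst indep_vars_iff_distr_eq_PiM[symmetric]) (auto simp: lessThan_empty_iff)
  then have d: "distr M (\<Pi>\<^sub>M k\<in>{..<n}. borel) ?r = H0 n"
    by (simp add: distr_Z H0_def)
  have s: "sets (\<Pi>\<^sub>M k\<in>{..<n}. borel :: real measure) = sets (H0 n)"
    unfolding H0_def by (intro sets_PiM_cong) auto
  have "EH0 n f = (\<integral>xs. f xs \<partial>distr M (\<Pi>\<^sub>M k\<in>{..<n}. borel) ?r)"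
    unfolding EH0_def d ..
  also have "\<dots> = expectation (\<lambda>x. f (?r x))"
  proof (rule integral_distr)
    show "?r \<in> measurable M (\<Pi>\<^sub>M k\<in>{..<n}. borel)" by measurable
    show "f \<in> borel_measurable (\<Pi>\<^sub>M k\<in>{..<n}. borel)"
      using f s by (simp cong: measurable_cong_sets)
  qed
  also have "\<dots> = expectation (\<lambda>x. f (Zs x))"
    by (intro Bochner_Integration.integral_cong refl dep) simp
  finally show ?thesis .
qed

lemma moments_bounded_scaled_tendsto_0:
  fixes F :: "nat \<Rightarrow> 'a \<Rightarrow> real"
  assumes "moments_bounded {1..} (\<lambda>n x. sqrt n * F n x)"
  shows "(\<lambda>n. expectation (\<lambda>x. \<bar>F n x\<bar>)) \<longlonglongrightarrow> 0"
    and "\<And>n. n \<ge> 1 \<Longrightarrow> integrable M (\<lambda>x. \<bar>F n x\<bar>)"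
proof -
  obtain K where "K \<ge> 0" and K: "\<And>n. n \<in> {1..} \<Longrightarrow> integrable M (\<lambda>x. \<bar>sqrt (real n) * F n x\<bar> ^ 1)"
    "\<And>n. n \<in> {1..} \<Longrightarrow> expectation (\<lambda>x. \<bar>sqrt (real n) * F n x\<bar> ^ 1) \<le> K"
    by (rule moments_boundedD[OF assms, where p = 1]) (rule that)
  have eq: "\<bar>F n x\<bar> = \<bar>sqrt (real n) * F n x\<bar> ^ 1 / sqrt n" if "n \<ge> 1" for n x
    using that by (simp add: abs_mult)
  show int: "integrable M (\<lambda>x. \<bar>F n x\<bar>)" if "n \<ge> 1" for n
    unfolding eq[OF that] using K(1)[of n] that by (intro integrable_divide) auto
  show "(\<lambda>n. expectation (\<lambda>x. \<bar>F n x\<bar>)) \<longlonglongrightarrow> 0"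
  proof (rule tendsto_sandwich[OF _ _ tendsto_const])
    show "(\<lambda>n. K / sqrt (real n)) \<longlonglongrightarrow> 0" by real_asymp
    show "\<forall>\<^sub>F n in sequentially. expectation (\<lambda>x. \<bar>F n x\<bar>) \<le> K / sqrt (real n)"
      using eventually_ge_at_top[of 1]
    proof eventually_elim
      case (elim n)
      have "expectation (\<lambda>x. \<bar>F n x\<bar>) = expectation (\<lambda>x. \<bar>sqrt (real n) * F n x\<bar> ^ 1) / sqrt n"
        unfolding eq[OF elim] by (rule integral_divide_zero)
      then show ?case
        using K(2)[of n] elim by (simp add: divide_right_mono)
    qed
  qed (simp add: always_eventually)
qed

lemma expectation_tendsto_of_close:
  fixes F G :: "nat \<Rightarrow> 'a \<Rightarrow> real"
  assumes F: "moments_bounded {1..} F" and G: "moments_bounded {1..} G"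
    and d: "moments_bounded {1..} (\<lambda>n x. sqrt n * (F n x - G n x))" and lim: "(\<lambda>n. expectation (G n)) \<longlonglongrightarrow> l"
  shows "(\<lambda>n. expectation (F n)) \<longlonglongrightarrow> l"
proof -
  have "(\<lambda>n. expectation (F n) - expectation (G n)) \<longlonglongrightarrow> 0"
  proof (rule Lim_null_comparison[OF _ moments_bounded_scaled_tendsto_0(1)[OF d]])
    show "\<forall>\<^sub>F n in sequentially. norm (expectation (F n) - expectation (G n)) \<le> expectation (\<lambda>x. \<bar>F n x - G n x\<bar>)"
      using eventually_ge_at_top[of 1]
    proof eventually_elim
      case (elim n)
      have "integrable M (F n)" "integrable M (G n)"
        using moments_bounded_integrable[OF F, of n 1] moments_bounded_integrable[OF G, of n 1] elim by auto
      then have "expectation (F n) - expectation (G n) = expectation (\<lambda>x. F n x - G n x)"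
        by simp
      then show ?case by (simp only: real_norm_def integral_abs_bound)
    qed
  qed
  from tendsto_add[OF this lim] show ?thesis by simp
qed

text \<open>Two changes separate the standardized statistic from a known weak limit:
  \<open>q\<close> is replaced by \<open>\<Phi>\<close>, and the null mean and variance by their
  limits. Each costs an error that tends to 0 in mean, so the perturbation lemma carries the limit
  over.\<close>

lemma standardized_weak_limit:
  fixes q :: "nat \<Rightarrow> (nat \<Rightarrow> real) \<Rightarrow> nat \<Rightarrow> real" and \<Phi> :: "nat \<Rightarrow> 'a \<Rightarrow> nat \<Rightarrow> real"
    and N :: "'q measure" and Q :: "nat \<Rightarrow> 'q \<Rightarrow> real" and f :: "(nat \<Rightarrow> real) \<Rightarrow> real"
  assumes S: "finite S"
    and qH: "\<And>n m. (\<lambda>ys. q n ys m) \<in> borel_measurable (H0 n)"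
    and qdep: "\<And>n m xs ys. (\<And>k. k < n \<Longrightarrow> xs k = ys k) \<Longrightarrow> q n xs m = q n ys m"
    and qM: "\<And>n m. (\<lambda>x. q n (Zs x) m) \<in> borel_measurable M"
    and \<Phi>M: "\<And>n m. (\<lambda>x. \<Phi> n x m) \<in> borel_measurable M"
    and q: "\<And>m. m \<in> S \<Longrightarrow> moments_bounded {1..} (\<lambda>n x. q n (Zs x) m)"
    and \<Phi>: "\<And>m. m \<in> S \<Longrightarrow> moments_bounded {1..} (\<lambda>n x. \<Phi> n x m)"
    and d: "\<And>m. m \<in> S \<Longrightarrow> moments_bounded {1..} (\<lambda>n x. sqrt n * (q n (Zs x) m - \<Phi> n x m))"
    and weak: "\<And>f :: (nat \<Rightarrow> real) \<Rightarrow> real. continuous_on UNIV f \<Longrightarrow> bounded (range f) \<Longrightarrow>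
      (\<lambda>n. expectation (\<lambda>x. f (\<lambda>m. if m \<in> S then \<Phi> n x m else 0))) \<longlonglongrightarrow> (\<integral>y. f (\<lambda>m. if m \<in> S then Q m y else 0) \<partial>N)"
    and E1: "\<And>m. m \<in> S \<Longrightarrow> (\<lambda>n. expectation (\<lambda>x. \<Phi> n x m)) \<longlonglongrightarrow> a m"
    and E2: "\<And>m. m \<in> S \<Longrightarrow> (\<lambda>n. expectation (\<lambda>x. (\<Phi> n x m)\<^sup>2)) \<longlonglongrightarrow> v m + (a m)\<^sup>2"
    and v: "\<And>m. m \<in> S \<Longrightarrow> v m > 0"
    and f: "continuous_on UNIV f" "bounded (range f)"
  shows "(\<lambda>n. expectation (\<lambda>x. f (\<lambda>m. if m \<in> S then standardize n (\<lambda>ys. q n ys m) (Zs x) else 0)))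
    \<longlonglongrightarrow> (\<integral>y. f (\<lambda>m. if m \<in> S then (Q m y - a m) / sqrt (v m) else 0) \<partial>N)"
proof -
  define e where "e n m = EH0 n (\<lambda>ys. q n ys m)" for n m
  define w where "w n m = VarH0 n (\<lambda>ys. q n ys m)" for n m
  have e_eq: "e n m = expectation (\<lambda>x. q n (Zs x) m)" if "n \<ge> 1" for n m
    unfolding e_def by (rule EH0_eq[OF that qH]) (rule qdep)
  have w_eq: "w n m = expectation (\<lambda>x. (q n (Zs x) m)\<^sup>2) - (e n m)\<^sup>2" if n: "n \<ge> 1" and m: "m \<in> S" for n m
  proof -
    note [measurable] = qH
    have i: "integrable M (\<lambda>x. q n (Zs x) m)" "integrable M (\<lambda>x. (q n (Zs x) m)\<^sup>2)"
      using moments_bounded_integrable[OF q[OF m], of n 1] moments_bounded_integrable[OF q[OF m], of n 2] n by auto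
    have "w n m = EH0 n (\<lambda>ys. (q n ys m - e n m)\<^sup>2)"
      by (simp add: w_def VarH0_def EH0_def e_def)
    also have "\<dots> = expectation (\<lambda>x. (q n (Zs x) m - e n m)\<^sup>2)"
      by (rule EH0_eq[OF n]) (measurable, metis qdep)
    also have "\<dots> = expectation (\<lambda>x. (q n (Zs x) m)\<^sup>2 - 2 * e n m * q n (Zs x) m + (e n m)\<^sup>2)"
      by (intro Bochner_Integration.integral_cong refl) (simp add: power2_eq_square algebra_simps)
    also have "\<dots> = expectation (\<lambda>x. (q n (Zs x) m)\<^sup>2) - 2 * e n m * e n m + (e n m)\<^sup>2"
      using i by (simp add: e_eq[OF n] prob_space)
    finally show ?thesis by (simp add: power2_eq_square)
  qed
  have e_lim: "(\<lambda>n. e n m) \<longlonglongrightarrow> a m" if m: "m \<in> S" for m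
    by (rule Lim_transform_eventually[OF expectation_tendsto_of_close[OF q[OF m] \<Phi>[OF m] d[OF m] E1[OF m]]])
       (use eventually_ge_at_top[of 1] in \<open>eventually_elim, simp add: e_eq\<close>)
  have w_lim: "(\<lambda>n. w n m) \<longlonglongrightarrow> v m" if m: "m \<in> S" for m
  proof -
    \<comment> \<open>The difference of squares is \<open>q - \<Phi>\<close> times
      \<open>q + \<Phi>\<close>, small times bounded; hence the second moments share their
      limit.\<close>
    have "moments_bounded {1..} (\<lambda>n x. sqrt n * (q n (Zs x) m * q n (Zs x) m - \<Phi> n x m * \<Phi> n x m))"
      by (rule moments_bounded_cong[OF moments_bounded_mult[OF d[OF m] moments_bounded_add[OF q[OF m] \<Phi>[OF m]]]])
         (simp add: algebra_simps)
    from expectation_tendsto_of_close[OF moments_bounded_mult[OF q[OF m] q[OF m]] moments_bounded_mult[OF \<Phi>[OF m] \<Phi>[OF m]] this, of "v m + (a m)\<^sup>2"] E2[OF m]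
    have "(\<lambda>n. expectation (\<lambda>x. (q n (Zs x) m)\<^sup>2)) \<longlonglongrightarrow> v m + (a m)\<^sup>2"
      by (simp add: power2_eq_square)
    from tendsto_diff[OF this tendsto_power[OF e_lim[OF m], of 2]]
    have "(\<lambda>n. expectation (\<lambda>x. (q n (Zs x) m)\<^sup>2) - (e n m)\<^sup>2) \<longlonglongrightarrow> v m" by simp
    then show ?thesis
      by (rule Lim_transform_eventually) (use eventually_ge_at_top[of 1] in \<open>eventually_elim, simp add: w_eq m\<close>)
  qed
  define s where "s n m = 1 / sqrt (w n m)" for n m
  define r where "r m = 1 / sqrt (v m)" for m
  have s_lim: "(\<lambda>n. s n m) \<longlonglongrightarrow> r m" if "m \<in> S" for m
    unfolding s_def r_def using v[OF that] by (intro tendsto_intros w_lim that) auto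
  \<comment> \<open>\<open>A\<close> uses the limiting constants and is thus a fixed continuous
    image of \<open>\<Phi>\<close>; \<open>C\<close> uses the null moments at
    \<open>n\<close>.\<close>
  define A where "A n x m = (if m \<in> S then (\<Phi> n x m - a m) * r m else 0)" for n x m
  define C where "C n x m = (if m \<in> S then (q n (Zs x) m - e n m) * s n m else 0)" for n x m
  have C_eq: "(\<lambda>m. if m \<in> S then standardize n (\<lambda>ys. q n ys m) (Zs x) else 0) = C n x" for n x
    by (auto simp: C_def standardize_def e_def s_def w_def fun_eq_iff)
  note [measurable] = qM \<Phi>M
  have \<Phi>i: "integrable M (\<lambda>x. \<bar>\<Phi> n x m\<bar>)" if "n \<ge> 1" "m \<in> S" for n m
    using moments_bounded_integrable[OF \<Phi>[OF that(2)], of n 1] that(1) by auto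
  have "\<exists>K. \<forall>n\<ge>1. expectation (\<lambda>x. \<bar>\<Phi> n x m\<bar>) \<le> K" if m: "m \<in> S" for m
  proof -
    obtain K where "K \<ge> 0" "\<And>n. n \<in> {1..} \<Longrightarrow> integrable M (\<lambda>x. \<bar>\<Phi> n x m\<bar> ^ 1)"
      and K: "\<And>n. n \<in> {1..} \<Longrightarrow> expectation (\<lambda>x. \<bar>\<Phi> n x m\<bar> ^ 1) \<le> K"
      by (rule moments_boundedD[OF \<Phi>[OF m], where p = 1]) (rule that)
    then show ?thesis by (intro exI[of _ K]) auto
  qed
  then have "\<forall>m\<in>S. \<exists>K. \<forall>n\<ge>1. expectation (\<lambda>x. \<bar>\<Phi> n x m\<bar>) \<le> K" by blast
  then obtain K where K: "\<And>m n. m \<in> S \<Longrightarrow> n \<ge> 1 \<Longrightarrow> expectation (\<lambda>x. \<bar>\<Phi> n x m\<bar>) \<le> K m"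
    by (auto dest!: bchoice)
  define K1 where "K1 = (\<Sum>m\<in>S. (\<bar>K m\<bar> + \<bar>a m\<bar>) * \<bar>r m\<bar>)"
  have A_int: "integrable M (\<lambda>x. \<bar>A n x m\<bar>)" and A_le: "expectation (\<lambda>x. \<bar>A n x m\<bar>) \<le> K1" if n: "n \<ge> 1" and m: "m \<in> S" for n m
  proof -
    have \<Phi>i': "integrable M (\<lambda>x. \<Phi> n x m)"
      using moments_bounded_integrable[OF \<Phi>[OF m], of n 1] n by auto
    then show int: "integrable M (\<lambda>x. \<bar>A n x m\<bar>)"
      using m by (auto simp: A_def intro!: integrable_abs integrable_mult_left Bochner_Integration.integrable_diff)
    have "expectation (\<lambda>x. \<bar>A n x m\<bar>) \<le> expectation (\<lambda>x. (\<bar>\<Phi> n x m\<bar> + \<bar>a m\<bar>) * \<bar>r m\<bar>)"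
      using m \<Phi>i[OF n m]
      by (intro integral_mono int integrable_mult_left Bochner_Integration.integrable_add) (auto simp: A_def abs_mult intro!: mult_right_mono)
    also have "\<dots> = (expectation (\<lambda>x. \<bar>\<Phi> n x m\<bar>) + \<bar>a m\<bar>) * \<bar>r m\<bar>"
      using \<Phi>i[OF n m] by (simp add: prob_space)
    also have "\<dots> \<le> (\<bar>K m\<bar> + \<bar>a m\<bar>) * \<bar>r m\<bar>"
      using K[OF m n] by (intro mult_right_mono add_mono) auto
    also have "\<dots> \<le> K1"
      unfolding K1_def using S m by (intro member_le_sum) auto
    finally show "expectation (\<lambda>x. \<bar>A n x m\<bar>) \<le> K1" .
  qed
  have D_le: "\<bar>A n x m - C n x m\<bar> \<le> \<bar>\<Phi> n x m\<bar> * \<bar>r m - s n m\<bar> + (\<bar>q n (Zs x) m - \<Phi> n x m\<bar> * \<bar>s n m\<bar> + \<bar>a m * r m - e n m * s n m\<bar>)" if "m \<in> S" for n x m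
  proof -
    \<comment> \<open>Three sources of error: the scale, the approximation of \<open>q\<close> by
      \<open>\<Phi>\<close>, and the centring.\<close>
    have "A n x m - C n x m = \<Phi> n x m * (r m - s n m) - ((q n (Zs x) m - \<Phi> n x m) * s n m + (a m * r m - e n m * s n m))"
      using that by (simp add: A_def C_def algebra_simps)
    also have "\<bar>\<dots>\<bar> \<le> \<bar>\<Phi> n x m * (r m - s n m)\<bar> + (\<bar>(q n (Zs x) m - \<Phi> n x m) * s n m\<bar> + \<bar>a m * r m - e n m * s n m\<bar>)"
      by linarith
    finally show ?thesis by (simp only: abs_mult)
  qed
  have D_int2: "integrable M (\<lambda>x. \<bar>\<Phi> n x m\<bar> * \<bar>r m - s n m\<bar> + (\<bar>q n (Zs x) m - \<Phi> n x m\<bar> * \<bar>s n m\<bar> + \<bar>a m * r m - e n m * s n m\<bar>))" if n: "n \<ge> 1" and m: "m \<in> S" for n m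
    using \<Phi>i[OF n m] moments_bounded_scaled_tendsto_0(2)[OF d[OF m] n] by auto
  have C_meas: "(\<lambda>x. C n x m) \<in> borel_measurable M" and A_meas: "(\<lambda>x. A n x m) \<in> borel_measurable M" for n m
    unfolding A_def C_def by measurable
  note [measurable] = C_meas A_meas
  have D_int: "integrable M (\<lambda>x. \<bar>A n x m - C n x m\<bar>)" if n: "n \<ge> 1" and m: "m \<in> S" for n m
    by (rule Bochner_Integration.integrable_bound[OF D_int2[OF n m]])
       (use D_le[OF m] in \<open>auto intro!: AE_I2 order_trans[OF _ abs_ge_self]\<close>)
  have D_lim: "(\<lambda>n. expectation (\<lambda>x. \<bar>A n x m - C n x m\<bar>)) \<longlonglongrightarrow> 0" if m: "m \<in> S" for m
  proof (rule tendsto_sandwich[OF _ _ tendsto_const])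
    let ?u = "\<lambda>n. K m * \<bar>r m - s n m\<bar> + (expectation (\<lambda>x. \<bar>q n (Zs x) m - \<Phi> n x m\<bar>) * \<bar>s n m\<bar> + \<bar>a m * r m - e n m * s n m\<bar>)"
    have "?u \<longlonglongrightarrow> K m * \<bar>r m - r m\<bar> + (0 * \<bar>r m\<bar> + \<bar>a m * r m - a m * r m\<bar>)"
      by (intro tendsto_intros s_lim[OF m] e_lim[OF m] moments_bounded_scaled_tendsto_0(1)[OF d[OF m]])
    then show "?u \<longlonglongrightarrow> 0" by simp
    show "\<forall>\<^sub>F n in sequentially. expectation (\<lambda>x. \<bar>A n x m - C n x m\<bar>) \<le> ?u n"
      using eventually_ge_at_top[of 1]
    proof eventually_elim
      case (elim n)
      have "expectation (\<lambda>x. \<bar>A n x m - C n x m\<bar>)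
        \<le> expectation (\<lambda>x. \<bar>\<Phi> n x m\<bar> * \<bar>r m - s n m\<bar> + (\<bar>q n (Zs x) m - \<Phi> n x m\<bar> * \<bar>s n m\<bar> + \<bar>a m * r m - e n m * s n m\<bar>))"
        by (intro integral_mono D_int[OF elim m] D_int2[OF elim m] D_le[OF m])
      also have "\<dots> = expectation (\<lambda>x. \<bar>\<Phi> n x m\<bar>) * \<bar>r m - s n m\<bar> + (expectation (\<lambda>x. \<bar>q n (Zs x) m - \<Phi> n x m\<bar>) * \<bar>s n m\<bar> + \<bar>a m * r m - e n m * s n m\<bar>)"
        using \<Phi>i[OF elim m] moments_bounded_scaled_tendsto_0(2)[OF d[OF m] elim] by (simp add: prob_space)
      also have "\<dots> \<le> ?u n"
        using K[OF m elim] by (intro add_right_mono mult_right_mono) auto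
      finally show ?case .
    qed
  qed (simp add: always_eventually)
  let ?g = "\<lambda>x :: nat \<Rightarrow> real. f (\<lambda>m. if m \<in> S then (x m - a m) * r m else 0)"
  have "(\<lambda>n. expectation (\<lambda>x. ?g (\<lambda>m. if m \<in> S then \<Phi> n x m else 0))) \<longlonglongrightarrow> (\<integral>y. ?g (\<lambda>m. if m \<in> S then Q m y else 0) \<partial>N)"
  proof (rule weak)
    have "continuous_on UNIV (\<lambda>x :: nat \<Rightarrow> real. \<lambda>m. if m \<in> S then (x m - a m) * r m else 0)"
    proof (rule continuous_on_coordinatewise_then_product)
      fix m
      have "continuous_on UNIV (\<lambda>x :: nat \<Rightarrow> real. x m)"
        by (rule continuous_on_product_then_coordinatewise[OF continuous_on_id])
      then show "continuous_on UNIV (\<lambda>x :: nat \<Rightarrow> real. if m \<in> S then (x m - a m) * r m else 0)"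
        by (cases "m \<in> S") (auto intro!: continuous_intros)
    qed
    then show "continuous_on UNIV ?g"
      by (rule continuous_on_compose2[OF f(1)]) auto
    show "bounded (range ?g)"
      by (rule bounded_subset[OF f(2)]) auto
  qed
  then have "(\<lambda>n. expectation (\<lambda>x. f (A n x))) \<longlonglongrightarrow> (\<integral>y. f (\<lambda>m. if m \<in> S then (Q m y - a m) * r m else 0) \<partial>N)"
    by (simp add: A_def [abs_def] cong: if_cong)
  note lim = this
  have A0: "A n x m = 0" and C0: "C n x m = 0" if "m \<notin> S" for n x m
    using that by (simp_all add: A_def C_def)
  have "(\<lambda>n. expectation (\<lambda>x. f (C n x))) \<longlonglongrightarrow> (\<integral>y. f (\<lambda>m. if m \<in> S then (Q m y - a m) * r m else 0) \<partial>N)"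
    by (rule weak_limit_perturbation[OF prob_space_axioms S A0 C0 A_meas C_meas A_int A_le D_int D_lim f lim])
  then show ?thesis
    unfolding C_eq r_def times_divide_eq_right mult_1_right .
qed

end

lemma affine_stat_eq:
  assumes "n \<ge> 1" "\<sigma> > 0"
  shows "Deltam T \<beta> n (\<lambda>k. \<mu> + \<sigma> * zs k) m = Deltam T \<beta> n zs m"
    and "Qm T \<beta> n (\<lambda>k. \<mu> + \<sigma> * zs k) m = Qm T \<beta> n zs m"
  using assms by (auto intro!: stat_cong simp: fun_eq_iff ecf_std_affine)

text \<open>The assumptions on \<open>q\<close> isolate what \<open>Qm\<close> and the scaled
  \<open>Deltam\<close> have in common, above all closeness of order \<open>1 / sqrt n\<close> to
  the same linearized statistic. Both therefore have the same limit.\<close>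

lemma (in std_normal_sample) conv_distr_standardized:
  fixes X :: "nat \<Rightarrow> 'a \<Rightarrow> real" and N :: "'q measure" and Y :: "'q \<Rightarrow> (real \<Rightarrow>\<^sub>C complex) \<times> real \<times> real"
    and q :: "nat \<Rightarrow> (nat \<Rightarrow> real) \<Rightarrow> nat \<Rightarrow> real" and \<mu> \<sigma> T \<beta> :: real and K :: nat
  assumes X: "\<And>k x. X k x = \<mu> + \<sigma> * Z k x" and \<sigma>: "\<sigma> > 0" and T: "T > 0" and \<beta>: "\<beta> > 0"
    and N: "prob_space N" and Y[measurable]: "Y \<in> borel_measurable N"
    and conv: "conv_distr M (\<lambda>n x. sample_map \<mu> \<sigma> T n (\<lambda>k. X k x)) N Y"
    and qmeas: "\<And>N' :: (nat \<Rightarrow> real) measure. \<And>f n m. prob_space N' \<Longrightarrow> (\<And>k. f k \<in> borel_measurable N') \<Longrightarrow> (\<lambda>x. q n (\<lambda>k. f k x) m) \<in> borel_measurable N'"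
    and qM: "\<And>f n m. (\<And>k. f k \<in> borel_measurable M) \<Longrightarrow> (\<lambda>x. q n (\<lambda>k. f k x) m) \<in> borel_measurable M"
    and qdep: "\<And>n m xs ys. (\<And>k. k < n \<Longrightarrow> xs k = ys k) \<Longrightarrow> q n xs m = q n ys m"
    and qaff: "\<And>n m zs. n \<ge> 1 \<Longrightarrow> q n (\<lambda>k. \<mu> + \<sigma> * zs k) m = q n zs m"
    and qmb: "\<And>m. m \<ge> 1 \<Longrightarrow> moments_bounded {1..} (\<lambda>n x. q n (Zs x) m)"
    and qd: "\<And>m. m \<ge> 1 \<Longrightarrow> moments_bounded {1..} (\<lambda>n x. sqrt n * (q n (Zs x) m - Qgen T \<beta> (lin_proc n (Zs x)) m))"
  defines "Q m y \<equiv> Qgen T \<beta> (G0t \<mu> \<sigma> (Y y)) m"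
  defines "V n x m \<equiv> if m \<in> {1..K} then standardize n (\<lambda>ys. q n ys m) (\<lambda>k. X k x) else 0"
  defines "W y m \<equiv> if m \<in> {1..K} then (Q m y - (\<integral>y. Q m y \<partial>N)) / sqrt (\<integral>y'. (Q m y' - (\<integral>y. Q m y \<partial>N))\<^sup>2 \<partial>N) else 0"
  shows "conv_distr M V N W" and "\<And>n. V n \<in> borel_measurable M" and "W \<in> borel_measurable N"
proof -
  interpret N: prob_space N by fact
  have \<beta>0: "\<beta> \<ge> 0" using \<beta> by simp
  have X_eq: "(\<lambda>k. X k x) = (\<lambda>k. \<mu> + \<sigma> * Z k x)" for x by (simp add: X)
  have Xm[measurable]: "X k \<in> borel_measurable M" for k
    unfolding X [abs_def] by measurable
  have sm[measurable]: "(\<lambda>x. sample_map \<mu> \<sigma> T n (\<lambda>k. X k x)) \<in> borel_measurable M" for n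
    by (rule measurable_compose[OF _ borel_measurable_continuous_onI[OF continuous_sample_map[OF T \<sigma>]]])
       (rule measurable_coordinatewise_then_product, measurable)
  \<comment> \<open>Transfers the assumed convergence to every bounded continuous function of the
    triple. Agreement for \<open>n \<ge> 1\<close> is enough for a limit, and the identities
    involved divide by \<open>n\<close>.\<close>
  have base: "(\<lambda>n. expectation (\<Psi> n)) \<longlonglongrightarrow> (\<integral>y. F (Y y) \<partial>N)"
    if F: "continuous_on UNIV F" "bounded (range F)" and eq: "\<And>n x. n \<ge> 1 \<Longrightarrow> F (sample_map \<mu> \<sigma> T n (\<lambda>k. X k x)) = \<Psi> n x" for F :: "_ \<Rightarrow> real" and \<Psi>
  proof (rule Lim_transform_eventually)
    show "(\<lambda>n. expectation (\<lambda>x. F (sample_map \<mu> \<sigma> T n (\<lambda>k. X k x)))) \<longlonglongrightarrow> (\<integral>y. F (Y y) \<partial>N)"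
      using conv F unfolding conv_distr_iff[OF sm Y] by blast
    show "\<forall>\<^sub>F n in sequentially. expectation (\<lambda>x. F (sample_map \<mu> \<sigma> T n (\<lambda>k. X k x))) = expectation (\<Psi> n)"
      using eventually_ge_at_top[of 1] by eventually_elim (simp add: eq)
  qed
  define \<Phi> where "\<Phi> n x m = Qgen T \<beta> (lin_proc n (Zs x)) m" for n x m
  have \<Phi>_eq: "Qgen T \<beta> (G0t \<mu> \<sigma> (sample_map \<mu> \<sigma> T n (\<lambda>k. X k x))) m = \<Phi> n x m"
    and L_eq: "lfun T \<beta> m (G0t \<mu> \<sigma> (sample_map \<mu> \<sigma> T n (\<lambda>k. X k x))) = (\<Sum>k<n. hsm T \<beta> m (Z k x)) / sqrt n"
    if "n \<ge> 1" "m \<ge> 1" for n m x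
  proof -
    have "G0t \<mu> \<sigma> (sample_map \<mu> \<sigma> T n (\<lambda>k. X k x)) s = lin_proc n (Zs x) s" if "s \<in> {-T..T}" for s
      unfolding X_eq by (rule G0t_sample_map[OF \<open>n \<ge> 1\<close> \<sigma> that])
    then show "Qgen T \<beta> (G0t \<mu> \<sigma> (sample_map \<mu> \<sigma> T n (\<lambda>k. X k x))) m = \<Phi> n x m"
      "lfun T \<beta> m (G0t \<mu> \<sigma> (sample_map \<mu> \<sigma> T n (\<lambda>k. X k x))) = (\<Sum>k<n. hsm T \<beta> m (Z k x)) / sqrt n"
      unfolding \<Phi>_def lfun_lin_proc[OF that, symmetric] using lfun_cong[OF that(2)] by blast+
  qed
  have Qc: "continuous_on UNIV (\<lambda>p. Qgen T \<beta> (G0t \<mu> \<sigma> p) m)" if "m \<ge> 1" for m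
    by (rule continuous_Qgen_G0t[OF T \<sigma> that \<beta>0])
  have Qm[measurable]: "Q m \<in> borel_measurable N" if "m \<ge> 1" for m
    unfolding Q_def [abs_def] by (rule measurable_compose[OF Y borel_measurable_continuous_onI[OF Qc[OF that]]])
  have Q0: "0 \<le> Q m y" for m y by (simp add: Q_def Qgen_eq_wint wint_nonneg)
  have \<Phi>0: "0 \<le> \<Phi> n x m" for n x m by (simp add: \<Phi>_def Qgen_eq_wint wint_nonneg)
  have \<Phi>M[measurable]: "(\<lambda>x. \<Phi> n x m) \<in> borel_measurable M" for n m
  proof -
    note [measurable] = measurable_compose[OF measurable_fst measurable_Z]
    show ?thesis
      unfolding \<Phi>_def Qgen_eq_wint
      by (intro measurable_wint borel_measurable_times measurable_Hgen measurable_lin_proc continuous_intros continuous_Hgen) measurable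
  qed
  have \<Phi>mb: "moments_bounded {1..} (\<lambda>n x. \<Phi> n x m)" if "m \<ge> 1" for m
    unfolding \<Phi>_def by (rule moments_bounded_lin_stat[OF that T \<beta>0])
  have weak1: "(\<lambda>n. expectation (\<lambda>x. F (\<Phi> n x m))) \<longlonglongrightarrow> (\<integral>y. F (Q m y) \<partial>N)"
    if F: "continuous_on UNIV F" "bounded (range F)" and m: "m \<ge> 1" for F :: "real \<Rightarrow> real" and m
    unfolding Q_def
  proof (rule base)
    show "continuous_on UNIV (\<lambda>p. F (Qgen T \<beta> (G0t \<mu> \<sigma> p) m))"
      by (rule continuous_on_compose2[OF F(1) Qc[OF m]]) simp
    show "bounded (range (\<lambda>p. F (Qgen T \<beta> (G0t \<mu> \<sigma> p) m)))"
      by (rule bounded_subset[OF F(2)]) blast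
  qed (simp only: \<Phi>_eq m)
  have weakV: "(\<lambda>n. expectation (\<lambda>x. F (\<lambda>m. if m \<in> {1..K} then \<Phi> n x m else 0))) \<longlonglongrightarrow> (\<integral>y. F (\<lambda>m. if m \<in> {1..K} then Q m y else 0) \<partial>N)"
    if F: "continuous_on UNIV F" "bounded (range F)" for F :: "(nat \<Rightarrow> real) \<Rightarrow> real"
    unfolding Q_def
  proof (rule base)
    let ?h = "\<lambda>p. \<lambda>m. if m \<in> {1..K} then Qgen T \<beta> (G0t \<mu> \<sigma> p) m else 0"
    have "continuous_on UNIV (\<lambda>p. ?h p m)" for m
      using Qc[of m] by (cases "m \<in> {1..K}") auto
    then show "continuous_on UNIV (\<lambda>p. F (?h p))"
      by (intro continuous_on_compose2[OF F(1) continuous_on_coordinatewise_then_product[of UNIV ?h]]) auto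
    show "bounded (range (\<lambda>p. F (?h p)))"
      by (rule bounded_subset[OF F(2)]) blast
    show "F (?h (sample_map \<mu> \<sigma> T n (\<lambda>k. X k x))) = F (\<lambda>m. if m \<in> {1..K} then \<Phi> n x m else 0)" if "n \<ge> 1" for n x
      by (rule arg_cong[where f = F]) (use that in \<open>auto simp: fun_eq_iff \<Phi>_eq\<close>)
  qed
  \<comment> \<open>Convergence of means is applied to \<open>p\<close>-th powers; their second
    moments are the moments of order \<open>2 * p\<close> of the linearized statistic, which are
    bounded.\<close>
  have mom: "integrable N (\<lambda>y. Q m y ^ p)" "(\<lambda>n. expectation (\<lambda>x. \<Phi> n x m ^ p)) \<longlonglongrightarrow> (\<integral>y. Q m y ^ p \<partial>N)" if m: "m \<ge> 1" for m p
  proof -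
    obtain B where "B \<ge> 0" and B: "\<And>n. n \<in> {1..} \<Longrightarrow> integrable M (\<lambda>x. \<bar>\<Phi> n x m\<bar> ^ (p * 2))"
      "\<And>n. n \<in> {1..} \<Longrightarrow> expectation (\<lambda>x. \<bar>\<Phi> n x m\<bar> ^ (p * 2)) \<le> B"
      by (rule moments_boundedD[OF \<Phi>mb[OF m], where p = "p * 2"]) (rule that)
    have pw: "(\<lambda>n. expectation (\<lambda>x. f (\<Phi> n x m ^ p))) \<longlonglongrightarrow> (\<integral>y. f (Q m y ^ p) \<partial>N)"
      if f: "continuous_on UNIV f" "bounded (range f)" for f :: "real \<Rightarrow> real"
      by (rule weak1[of "\<lambda>x. f (x ^ p)", OF _ _ m])
         (auto intro!: continuous_on_compose2[OF f(1)] continuous_intros bounded_subset[OF f(2)])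
    have sq: "\<bar>\<Phi> n x m\<bar> ^ (p * 2) = (\<Phi> n x m ^ p)\<^sup>2" for n x
      using \<Phi>0[of n x m] by (simp add: power_mult)
    have meas: "(\<lambda>x. \<Phi> n x m ^ p) \<in> borel_measurable M" "(\<lambda>y. Q m y ^ p) \<in> borel_measurable N" for n
      using Qm[OF m] by simp_all
    have int2: "integrable M (\<lambda>x. (\<Phi> n x m ^ p)\<^sup>2)" "expectation (\<lambda>x. (\<Phi> n x m ^ p)\<^sup>2) \<le> B" if "n \<ge> 1" for n
      using B[of n] that unfolding sq by auto
    note lim = expectation_tendsto_of_weak[where Y = "\<lambda>n x. \<Phi> n x m ^ p" and L = "\<lambda>y. Q m y ^ p" and K = B,
        OF prob_space_axioms N meas zero_le_power[OF \<Phi>0] zero_le_power[OF Q0] pw int2]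
    show "integrable N (\<lambda>y. Q m y ^ p)" "(\<lambda>n. expectation (\<lambda>x. \<Phi> n x m ^ p)) \<longlonglongrightarrow> (\<integral>y. Q m y ^ p \<partial>N)"
      by (rule lim; assumption)+
  qed
  define a where "a m = (\<integral>y. Q m y \<partial>N)" for m
  define v where "v m = (\<integral>y. (Q m y - a m)\<^sup>2 \<partial>N)" for m
  have Qi: "integrable N (Q m)" "integrable N (\<lambda>y. (Q m y)\<^sup>2)" if "m \<ge> 1" for m
    using mom(1)[OF that, of 1] mom(1)[OF that, of 2] by simp_all
  have v_eq: "(\<integral>y. (Q m y)\<^sup>2 \<partial>N) = v m + (a m)\<^sup>2" if m: "m \<ge> 1" for m
  proof -
    have "v m = (\<integral>y. (Q m y)\<^sup>2 - 2 * a m * Q m y + (a m)\<^sup>2 \<partial>N)"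
      unfolding v_def by (intro Bochner_Integration.integral_cong refl) (simp add: power2_eq_square algebra_simps)
    also have "\<dots> = (\<integral>y. (Q m y)\<^sup>2 \<partial>N) - 2 * a m * a m + (a m)\<^sup>2"
      using Qi[OF m] by (simp add: a_def N.prob_space)
    finally show ?thesis by (simp add: power2_eq_square)
  qed
  \<comment> \<open>Evaluating the linear and the quadratic functional at the same limit triple
    gives their pointwise comparison; at the empirical triple the linear one is the normalized sum
    of \<open>hsm\<close>.\<close>
  have v_pos: "v m > 0" if m: "m \<ge> 1" for m
  proof -
    let ?L = "\<lambda>y. lfun T \<beta> m (G0t \<mu> \<sigma> (Y y))"
    note Lc = continuous_lfun_G0t[OF T \<sigma> m \<beta>0, of \<mu>]
    have "0 < (\<integral>y. (Q m y - (\<integral>y. Q m y \<partial>N))\<^sup>2 \<partial>N)"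
    proof (rule limit_variance_pos[OF T \<beta>0 m N, where L = ?L and c = "2 * T"])
      show "?L \<in> borel_measurable N"
        by (rule measurable_compose[OF Y borel_measurable_continuous_onI[OF Lc]])
      show "\<bar>?L y\<bar> \<le> 2 * T + Q m y" for y
        unfolding Q_def by (rule abs_lfun_le_Qgen[OF T \<beta>0 continuous_G0])
      fix f :: "real \<Rightarrow> real" assume f: "continuous_on UNIV f" "bounded (range f)"
      show "(\<lambda>n. expectation (\<lambda>x. f ((\<Sum>k<n. hsm T \<beta> m (Z k x)) / sqrt n))) \<longlonglongrightarrow> (\<integral>y. f (?L y) \<partial>N)"
      proof (rule base)
        show "continuous_on UNIV (\<lambda>p. f (lfun T \<beta> m (G0t \<mu> \<sigma> p)))"
          by (rule continuous_on_compose2[OF f(1) Lc]) simp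
        show "bounded (range (\<lambda>p. f (lfun T \<beta> m (G0t \<mu> \<sigma> p))))"
          by (rule bounded_subset[OF f(2)]) blast
      qed (simp only: L_eq m)
    qed (use Qi[OF m] in auto)
    then show ?thesis by (simp add: v_def a_def)
  qed
  show Vm: "V n \<in> borel_measurable M" for n
  proof (rule measurable_coordinatewise_then_product)
    show "(\<lambda>x. V n x m) \<in> borel_measurable M" for m
    proof -
      have [measurable]: "(\<lambda>x. q n (\<lambda>k. X k x) m) \<in> borel_measurable M"
        by (rule qM[OF Xm])
      show ?thesis unfolding V_def standardize_def by measurable
    qed
  qed
  show Wm: "W \<in> borel_measurable N"
  proof (rule measurable_coordinatewise_then_product)
    show "(\<lambda>y. W y m) \<in> borel_measurable N" for m
      unfolding W_def by (cases "m \<in> {1..K}") (use Qm[of m] in auto)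
  qed
  have "(\<lambda>n. expectation (\<lambda>x. f (V n x))) \<longlonglongrightarrow> (\<integral>y. f (W y) \<partial>N)" if f: "continuous_on UNIV f" "bounded (range f)" for f :: "(nat \<Rightarrow> real) \<Rightarrow> real"
  proof -
    have "(\<lambda>n. expectation (\<lambda>x. f (\<lambda>m. if m \<in> {1..K} then standardize n (\<lambda>ys. q n ys m) (Zs x) else 0)))
      \<longlonglongrightarrow> (\<integral>y. f (\<lambda>m. if m \<in> {1..K} then (Q m y - a m) / sqrt (v m) else 0) \<partial>N)"
    proof (rule standardized_weak_limit[where \<Phi> = \<Phi>, OF _ _ qdep _ \<Phi>M _ _ _ weakV _ _ _ f])
      show "(\<lambda>ys. q n ys m) \<in> borel_measurable (H0 n)" for n m
        by (rule qmeas[OF prob_space_H0 measurable_H0_coordinate])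
      show "(\<lambda>x. q n (Zs x) m) \<in> borel_measurable M" for n m
        by (rule qM[OF measurable_Z])
      fix m assume "m \<in> {1..K}"
      then have m: "m \<ge> 1" by simp
      show "moments_bounded {1..} (\<lambda>n x. q n (Zs x) m)" by (rule qmb[OF m])
      show "moments_bounded {1..} (\<lambda>n x. \<Phi> n x m)" by (rule \<Phi>mb[OF m])
      show "moments_bounded {1..} (\<lambda>n x. sqrt (real n) * (q n (Zs x) m - \<Phi> n x m))" unfolding \<Phi>_def by (rule qd[OF m])
      show "(\<lambda>n. expectation (\<lambda>x. \<Phi> n x m)) \<longlonglongrightarrow> a m" using mom(2)[OF m, of 1] by (simp add: a_def)
      show "(\<lambda>n. expectation (\<lambda>x. (\<Phi> n x m)\<^sup>2)) \<longlonglongrightarrow> v m + (a m)\<^sup>2" using mom(2)[OF m, of 2] by (simp add: v_eq[OF m])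
      show "v m > 0" by (rule v_pos[OF m])
    qed simp_all
    moreover have "(\<lambda>m. if m \<in> {1..K} then (Q m y - a m) / sqrt (v m) else 0) = W y" for y
      by (simp add: W_def a_def v_def fun_eq_iff)
    ultimately have "(\<lambda>n. expectation (\<lambda>x. f (\<lambda>m. if m \<in> {1..K} then standardize n (\<lambda>ys. q n ys m) (Zs x) else 0))) \<longlonglongrightarrow> (\<integral>y. f (W y) \<partial>N)"
      by (simp only:)
    then show ?thesis
    proof (rule Lim_transform_eventually)
      show "\<forall>\<^sub>F n in sequentially. expectation (\<lambda>x. f (\<lambda>m. if m \<in> {1..K} then standardize n (\<lambda>ys. q n ys m) (Zs x) else 0)) = expectation (\<lambda>x. f (V n x))"
        using eventually_ge_at_top[of 1]
      proof eventually_elim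
        case (elim n)
        have "(\<lambda>m. if m \<in> {1..K} then standardize n (\<lambda>ys. q n ys m) (Zs x) else 0) = V n x" for x
          using qaff[OF elim] by (simp add: V_def X_eq standardize_def fun_eq_iff)
        then show ?case by (simp only:)
      qed
    qed
  qed
  then show "conv_distr M V N W"
    unfolding conv_distr_iff[OF Vm Wm] by blast
qed

theorem theorem3:
  fixes P :: "'a measure" and X :: "nat \<Rightarrow> 'a \<Rightarrow> real"
    and N :: "'b measure" and G :: "'b \<Rightarrow> (real \<Rightarrow>\<^sub>C complex)" and Y1 Y2 :: "'b \<Rightarrow> real"
    and \<mu> \<sigma> T \<beta> :: real and M :: nat
  assumes "prob_space P"
    and "prob_space.indep_vars P (\<lambda>_. borel) X UNIV"
    and "\<And>i. distributed P lborel (X i) (normal_density \<mu> \<sigma>)"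
    and "\<sigma> > 0" and "T > 0" and "\<beta> > 0" and "M \<ge> 1"
    and "prob_space N"
    and "(\<lambda>\<omega>. (G \<omega>, Y1 \<omega>, Y2 \<omega>)) \<in> borel_measurable N"
    and "conv_distr P
           (\<lambda>n \<omega>. (ecf_proc \<mu> \<sigma> (T / \<sigma>) n (\<lambda>k. X k \<omega>),
                    sqrt (real n) * (smean n (\<lambda>k. X k \<omega>) - \<mu>),
                    sqrt (real n) * (ssd n (\<lambda>k. X k \<omega>) - \<sigma>)))
           N (\<lambda>\<omega>. (G \<omega>, Y1 \<omega>, Y2 \<omega>))"
  shows "conv_distr P
           (\<lambda>n \<omega>. (\<lambda>m. if m \<in> {1..M} then Tnm T \<beta> n m (\<lambda>k. X k \<omega>) else 0))
           N (\<lambda>\<omega>. (\<lambda>m. if m \<in> {1..M} then Tlim N \<mu> \<sigma> T \<beta> G Y1 Y2 m \<omega> else 0))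
       \<and> conv_distr P (\<lambda>n \<omega>. Tn T \<beta> M n (\<lambda>k. X k \<omega>))
           N (TlimMax N \<mu> \<sigma> T \<beta> M G Y1 Y2)
       \<and> conv_distr P (\<lambda>n \<omega>. Ttn T \<beta> M n (\<lambda>k. X k \<omega>))
           N (TlimMax N \<mu> \<sigma> T \<beta> M G Y1 Y2)"
  proof -
  note \<sigma> = assms(4) and T = assms(5) and \<beta> = assms(6) and M = assms(7)
  define Z where "Z k x = (X k x - \<mu>) / \<sigma>" for k x
  interpret std_normal_sample P Z
  proof (rule std_normal_sample.intro[OF assms(1)], rule std_normal_sample_axioms.intro)
    show "prob_space.indep_vars P (\<lambda>_. borel) Z UNIV"
      unfolding Z_def [abs_def] by (rule prob_space.indep_vars_compose2[OF assms(1,2)]) simp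
    show "distributed P lborel (Z k) std_normal_density" for k
      unfolding Z_def [abs_def]
      using prob_space.normal_standard_normal_convert[OF assms(1) \<sigma>, of "X k" \<mu>] assms(3)[of k] by simp
  qed
  have X: "X k x = \<mu> + \<sigma> * Z k x" for k x
    using \<sigma> by (simp add: Z_def)
  have \<beta>0: "\<beta> \<ge> 0" using \<beta> by simp
  let ?Y = "\<lambda>\<omega>. (G \<omega>, Y1 \<omega>, Y2 \<omega>)"
  have conv: "conv_distr P (\<lambda>n x. sample_map \<mu> \<sigma> T n (\<lambda>k. X k x)) N ?Y"
    using assms(10) by (simp add: sample_map_def)
  note core = conv_distr_standardized[OF X \<sigma> T \<beta> assms(8,9) conv, where K = M]
  \<comment> \<open>The factor is \<open>n\<close>, kept positive at \<open>n = 0\<close> so that standardization is insensitive to it for every \<open>n\<close>.\<close>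
  define D where "D n xs m = real (max 1 n) * Deltam T \<beta> n xs m" for n xs m
  let ?V = "\<lambda>n x m. if m \<in> {1..M} then Tnm T \<beta> n m (\<lambda>k. X k x) else 0"
  let ?V' = "\<lambda>n x m. if m \<in> {1..M} then Ttnm T \<beta> n m (\<lambda>k. X k x) else 0"
  let ?W = "\<lambda>\<omega> m. if m \<in> {1..M} then Tlim N \<mu> \<sigma> T \<beta> G Y1 Y2 m \<omega> else 0"
  have V_eq: "Tnm T \<beta> n m xs = standardize n (\<lambda>ys. D n ys m) xs" for n m xs
    by (simp add: Tnm_def D_def standardize_cmult)
  have W_eq: "Tlim N \<mu> \<sigma> T \<beta> G Y1 Y2 m \<omega> = (Qgen T \<beta> (G0t \<mu> \<sigma> (?Y \<omega>)) m - (\<integral>y. Qgen T \<beta> (G0t \<mu> \<sigma> (?Y y)) m \<partial>N))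
     / sqrt (\<integral>y'. (Qgen T \<beta> (G0t \<mu> \<sigma> (?Y y')) m - (\<integral>y. Qgen T \<beta> (G0t \<mu> \<sigma> (?Y y)) m \<partial>N))\<^sup>2 \<partial>N)" for m \<omega>
    by (simp add: Tlim_def Let_def)
  have Dmeas1: "(\<lambda>x. D n (\<lambda>k. f k x) m) \<in> borel_measurable N'"
    if "prob_space N'" "\<And>k. f k \<in> borel_measurable N'" for N' :: "(nat \<Rightarrow> real) measure" and f n m
    unfolding D_def using measurable_Deltam[OF that] by (intro borel_measurable_times) auto
  have Dmeas2: "(\<lambda>x. D n (\<lambda>k. f k x) m) \<in> borel_measurable P"
    if "\<And>k. f k \<in> borel_measurable P" for f n m
    unfolding D_def using measurable_Deltam[OF assms(1) that] by (intro borel_measurable_times) auto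
  have Ddep: "D n xs m = D n ys m" if "\<And>k. k < n \<Longrightarrow> xs k = ys k" for n m xs ys
    unfolding D_def by (intro arg_cong[where f = "\<lambda>u. real (max 1 n) * u"] stat_cong(1) ecf_std_cong that)
  have Daff: "D n (\<lambda>k. \<mu> + \<sigma> * zs k) m = D n zs m" if "n \<ge> 1" for n m zs
    unfolding D_def affine_stat_eq(1)[OF that \<sigma>] ..
  have Dmb: "moments_bounded {1..} (\<lambda>n x. D n (Zs x) m)" if "m \<ge> 1" for m
    by (rule moments_bounded_cong[OF moments_bounded_Deltam[OF that T \<beta>0]]) (auto simp: D_def max_def)
  have Dd: "moments_bounded {1..} (\<lambda>n x. sqrt (real n) * (D n (Zs x) m - Qgen T \<beta> (lin_proc n (Zs x)) m))" if "m \<ge> 1" for m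
    by (rule moments_bounded_cong[OF moments_bounded_Deltam_diff[OF that T \<beta>0]]) (auto simp: D_def max_def)
  have Qmeas: "(\<lambda>x. Qm T \<beta> n (\<lambda>k. f k x) m) \<in> borel_measurable P"
    if "\<And>k. f k \<in> borel_measurable P" for f n m
    by (rule measurable_Qm[OF assms(1) that])
  have Qdep: "Qm T \<beta> n xs m = Qm T \<beta> n ys m" if "\<And>k. k < n \<Longrightarrow> xs k = ys k" for n m xs ys
    by (intro stat_cong(2) ecf_std_cong that)
  note V = core[OF Dmeas1 Dmeas2 Ddep Daff Dmb Dd, folded V_eq W_eq]
  note V' = core[OF measurable_Qm Qmeas Qdep affine_stat_eq(2)[OF _ \<sigma>] moments_bounded_Qm[OF _ T \<beta>0] moments_bounded_Qm_diff[OF _ T \<beta>0],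
      folded Ttnm_def W_eq]
  let ?g = "\<lambda>v :: nat \<Rightarrow> real. Max ((\<lambda>m. \<bar>v m\<bar>) ` {1..M})"
  have g: "continuous_on UNIV ?g"
    using M continuous_on_product_then_coordinatewise[OF continuous_on_id]
    by (intro Max_continuous_on continuous_on_rabs) auto
  have gV: "?g (?V n x) = Tn T \<beta> M n (\<lambda>k. X k x)" and gV': "?g (?V' n x) = Ttn T \<beta> M n (\<lambda>k. X k x)" for n x
    unfolding Tn_def Ttn_def by (intro arg_cong[where f = Max] image_cong; simp)+
  have gW: "?g (?W \<omega>) = TlimMax N \<mu> \<sigma> T \<beta> M G Y1 Y2 \<omega>" for \<omega>
    unfolding TlimMax_def by (intro arg_cong[where f = Max] image_cong) simp_all
  have "conv_distr P ?V N ?W" by (rule V(1))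
  moreover have "conv_distr P (\<lambda>n \<omega>. Tn T \<beta> M n (\<lambda>k. X k \<omega>)) N (TlimMax N \<mu> \<sigma> T \<beta> M G Y1 Y2)"
    using conv_distr_compose[OF V g] unfolding gV gW .
  moreover have "conv_distr P (\<lambda>n \<omega>. Ttn T \<beta> M n (\<lambda>k. X k \<omega>)) N (TlimMax N \<mu> \<sigma> T \<beta> M G Y1 Y2)"
    using conv_distr_compose[OF V' g] unfolding gV' gW .
  ultimately show ?thesis by blast
qed

end
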